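(* In the tabular episodic setting described in the context, let $\varepsilon=\Pr(\tilde\pi^1\ne\pi^* )$ be the probability that the policy used by iPSRL in the first episode differs from the optimal policy $\pi^*=\pi^*(\theta^* )$. Then $$\mathfrak{BR}_T(\phi^{\mathrm{iPSRL}})=O\!\left(\sqrt{\varepsilon H^4S^2AT}\,(1+\log T)\right),$$ where $O(\cdot)$ hides an absolute constant.
   Context: Setting. A finite-horizon MDP has finite state space $\mathcal S$ ($|\mathcal S|=S$), finite action space $\mathcal A$ ($|\mathcal A|=A$), horizon $H\ge 1$, initial state distribution $\nu$, known deterministic rewards $r_h(s,a)\in[0,1]$ for $h=0,\dots,H-1$ and terminal reward $r_H(s)\in[0,1]$ (also written $r_H(s,a)$, although no action is taken at period $H$), and transition kernels $P_h(s'|s,a)$, $0\le h\le H-1$. The kernel is unknown to the agent: $\theta=(P_h^\theta)_h$ ranges over a set $\Theta$ of transition kernels, and the true parameter $\theta^*$ is random with prior $\mu_0$ on $\Theta$, independent across (state, period, action) triples. The optimal values under $\theta$ are given by $V_H(s;\theta)=r_H(s)$, $Q_h(s,a;\theta)=r_h(s,a)+\sum_{s'}P_h^\theta(s'|s,a)V_{h+1}(s';\theta)$, $V_h(s;\theta)=\max_a Q_h(s,a;\theta)$; write $V_0^*(s;\theta)=V_0(s;\theta)$. Fix a measurable map $\theta\mapsto\pi^*(\theta)$ assigning to each $\theta$ a deterministic Markov policy that is optimal for $\theta$; write $\pi^*=\pi^*(\theta^* )$. Offline data. Given $\theta^*$, the expert generates an offline dataset $\mathcal D_0$ of $L$ independent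 trajectories $(\bar s_0^l,\bar a_0^l,\dots,\bar s_H^l)$, $l=1,\dots,L$, in the MDP $\theta^*$ (with $\bar s_0^l\sim\nu$) using the policy $\pi_h^\beta(a|s)=\exp(\beta Q_h(s,a;\theta^* ))/\sum_b\exp(\beta Q_h(s,b;\theta^* ))$, where $\beta\ge0$ is a known constant. iPSRL. For episodes $t=1,\dots,T$ ($T\ge1$): let $\mu_t$ be the exact posterior of $\theta^*$ given $\mathcal D_0$ and the online history $\mathcal H_{t-1}$ of the first $t-1$ online episodes; sample $\tilde\theta_t\sim\mu_t$ (conditionally independent of $\theta^*$ given $\mathcal D_0,\mathcal H_{t-1}$); set $\tilde\pi^t=\pi^*(\tilde\theta_t)$; draw $s_0^t\sim\nu$ and run $\tilde\pi^t$ for the episode in the MDP $\theta^*$, observing $(s_h^t,a_h^t)$. Bayesian regret. $\mathfrak{BR}_T(\phi^{\mathrm{iPSRL}})=\mathbb E\big[\sum_{t=1}^T\big(V_0^*(s_0^t;\theta^* )-\sum_{h=0}^{H}r_h(s_h^t,a_h^t)\big)\big]$, the expectation being over $\theta^*$, $\mathcal D_0$, and the algorithm–environment interaction. *)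

theory Defs
  imports "HOL-Probability.Probability"
begin

text \<open>
  States and actions are natural numbers and the state and action spaces are finite sets of them.
  (With type variables of class \<open>finite\<close> an absolute constant could not be quantified before
  the state and action spaces.)
\<close>

record mdp =
  states :: "nat set"
  actions :: "nat set"
  horizon :: nat
  init :: "nat pmf"
  rew :: "nat \<Rightarrow> nat \<Rightarrow> nat \<Rightarrow> real"
  final_rew :: "nat \<Rightarrow> real"

definition wf_mdp :: "mdp \<Rightarrow> bool" where
  "wf_mdp M \<longleftrightarrow>
     finite (states M) \<and> states M \<noteq> {} \<and> finite (actions M) \<and> actions M \<noteq> {} \<and>
     1 \<le> horizon M \<and> set_pmf (init M) \<subseteq> states M \<and>
     (\<forall>h<horizon M. \<forall>s\<in>states M. \<forall>a\<in>actions M. rew M h s a \<in> {0..1}) \<and>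
     (\<forall>s\<in>states M. final_rew M s \<in> {0..1})"

text \<open>A transition kernel \<open>\<theta>\<close> maps \<open>(h, s, a)\<close> to the next-state distribution \<open>P\<^sub>h(\<cdot> | s, a)\<close>.\<close>

type_synonym kernel = "nat \<times> nat \<times> nat \<Rightarrow> nat pmf"

definition triples :: "mdp \<Rightarrow> (nat \<times> nat \<times> nat) set" where
  "triples M = {..<horizon M} \<times> states M \<times> actions M"

definition kernels :: "mdp \<Rightarrow> kernel set" where
  "kernels M = (\<Pi>\<^sub>E i\<in>triples M. {p. set_pmf p \<subseteq> states M})"

text \<open>The \<open>\<sigma>\<close>-algebra on distributions that is generated by the evaluations \<open>p \<mapsto> p(B)\<close>.\<close>

definition pmf_space :: "nat pmf measure" where
  "pmf_space = vimage_algebra UNIV measure_pmf (subprob_algebra (count_space UNIV))"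

definition kernel_space :: "mdp \<Rightarrow> kernel measure" where
  "kernel_space M = (\<Pi>\<^sub>M i\<in>triples M. pmf_space)"

definition is_prior :: "mdp \<Rightarrow> kernel set \<Rightarrow> kernel measure \<Rightarrow> bool" where
  "is_prior M \<Theta> \<mu>0 \<longleftrightarrow>
     prob_space \<mu>0 \<and> sets \<mu>0 = sets (restrict_space (kernel_space M) \<Theta>) \<and>
     prob_space.indep_vars \<mu>0 (\<lambda>_. pmf_space) (\<lambda>i \<theta>. \<theta> i) (triples M)"

function opt_V :: "mdp \<Rightarrow> kernel \<Rightarrow> nat \<Rightarrow> nat \<Rightarrow> real"
  and opt_Q :: "mdp \<Rightarrow> kernel \<Rightarrow> nat \<Rightarrow> nat \<Rightarrow> nat \<Rightarrow> real" where
  "opt_V M \<theta> h s =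
     (if h < horizon M then Max ((\<lambda>a. opt_Q M \<theta> h s a) ` actions M) else final_rew M s)"
| "opt_Q M \<theta> h s a =
     rew M h s a + (\<Sum>s'\<in>states M. pmf (\<theta> (h, s, a)) s' * opt_V M \<theta> (Suc h) s')"
  by pat_completeness auto
termination
  by (relation "Wellfounded.measure (\<lambda>x. case x of
        Inl (M, \<theta>, h, s) \<Rightarrow> if h < horizon M then 2 * (horizon M - h) else 0
      | Inr (M, \<theta>, h, s, a) \<Rightarrow> if h < horizon M then 2 * (horizon M - h) - 1 else 1)") auto

declare opt_V.simps [simp del] opt_Q.simps [simp del]

text \<open>
  A trajectory is the list of the pairs \<open>(s\<^sub>h, a\<^sub>h)\<close> for \<open>h < H\<close> together with the final
  state \<open>s\<^sub>H\<close>.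
\<close>

type_synonym traj = "(nat \<times> nat) list \<times> nat"

text \<open>\<open>rollout \<theta> \<pi> h n s\<close> runs \<open>\<pi>\<close> from state \<open>s\<close> at period \<open>h\<close> for \<open>n\<close> more periods.\<close>

fun rollout :: "kernel \<Rightarrow> (nat \<Rightarrow> nat \<Rightarrow> nat pmf) \<Rightarrow> nat \<Rightarrow> nat \<Rightarrow> nat \<Rightarrow> traj pmf" where
  "rollout \<theta> \<pi> h 0 s = return_pmf ([], s)"
| "rollout \<theta> \<pi> h (Suc n) s =
     do {
       a \<leftarrow> \<pi> h s;
       s' \<leftarrow> \<theta> (h, s, a);
       (xs, sH) \<leftarrow> rollout \<theta> \<pi> (Suc h) n s';
       return_pmf ((s, a) # xs, sH)
     }"

definition episode :: "mdp \<Rightarrow> kernel \<Rightarrow> (nat \<Rightarrow> nat \<Rightarrow> nat pmf) \<Rightarrow> traj pmf" where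
  "episode M \<theta> \<pi> = do { s \<leftarrow> init M; rollout \<theta> \<pi> 0 (horizon M) s }"

definition init_state :: "traj \<Rightarrow> nat" where
  "init_state \<tau> = fst (fst \<tau> ! 0)"

definition total_reward :: "mdp \<Rightarrow> traj \<Rightarrow> real" where
  "total_reward M \<tau> =
     (\<Sum>h<horizon M. rew M h (fst (fst \<tau> ! h)) (snd (fst \<tau> ! h))) + final_rew M (snd \<tau>)"

text \<open>
  Deterministic Markov policies are extensional, so that equality of policies means agreement at
  all periods \<open>h < H\<close> and all states.
\<close>

type_synonym policy = "nat \<Rightarrow> nat \<Rightarrow> nat"

definition policies :: "mdp \<Rightarrow> policy set" where
  "policies M = (\<Pi>\<^sub>E h\<in>{..<horizon M}. \<Pi>\<^sub>E s\<in>states M. actions M)"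

abbreviation det_policy :: "policy \<Rightarrow> nat \<Rightarrow> nat \<Rightarrow> nat pmf" where
  "det_policy \<pi> \<equiv> \<lambda>h s. return_pmf (\<pi> h s)"

definition policy_value :: "mdp \<Rightarrow> kernel \<Rightarrow> policy \<Rightarrow> nat \<Rightarrow> real" where
  "policy_value M \<theta> \<pi> s =
     measure_pmf.expectation (rollout \<theta> (det_policy \<pi>) 0 (horizon M) s) (total_reward M)"

definition optimal_policy :: "mdp \<Rightarrow> kernel \<Rightarrow> policy \<Rightarrow> bool" where
  "optimal_policy M \<theta> \<pi> \<longleftrightarrow>
     \<pi> \<in> policies M \<and> (\<forall>s\<in>states M. policy_value M \<theta> \<pi> s = opt_V M \<theta> 0 s)"

definition expert :: "mdp \<Rightarrow> real \<Rightarrow> kernel \<Rightarrow> nat \<Rightarrow> nat \<Rightarrow> nat pmf" where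
  "expert M \<beta> \<theta> h s =
     embed_pmf (\<lambda>a. if a \<in> actions M
       then exp (\<beta> * opt_Q M \<theta> h s a) / (\<Sum>b\<in>actions M. exp (\<beta> * opt_Q M \<theta> h s b)) else 0)"

definition offline :: "mdp \<Rightarrow> real \<Rightarrow> nat \<Rightarrow> kernel \<Rightarrow> traj list pmf" where
  "offline M \<beta> L \<theta> = replicate_pmf L (episode M \<theta> (expert M \<beta> \<theta>))"

text \<open>
  An outcome of the first \<open>t\<close> episodes is \<open>(\<theta>\<^sup>*, D\<^sub>0, es)\<close>, where \<open>es\<close> lists, for each online
  episode, the policy that was run and the observed trajectory.
\<close>

type_synonym outcome = "kernel \<times> traj list \<times> (policy \<times> traj) list"

definition outcome_space :: "mdp \<Rightarrow> kernel measure \<Rightarrow> outcome measure" where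
  "outcome_space M \<mu>0 = \<mu>0 \<Otimes>\<^sub>M count_space (UNIV \<times> lists (policies M \<times> UNIV))"

definition observed :: "outcome \<Rightarrow> traj list \<times> traj list" where
  "observed = (\<lambda>(\<theta>, D, es). (D, map snd es))"

text \<open>
  The conditional distribution of \<open>\<theta>\<^sup>*\<close> given that the data equal \<open>x\<close>, under the joint law \<open>J\<close>.
  The data are discrete, so this is elementary conditioning (\<open>uniform_measure J E\<close> is
  \<open>J(\<cdot> | E)\<close>); for data of probability zero it is the null measure.
\<close>

definition posterior ::
  "kernel measure \<Rightarrow> outcome measure \<Rightarrow> traj list \<times> traj list \<Rightarrow> kernel measure" where
  "posterior \<mu>0 J x = distr (uniform_measure J {\<omega>\<in>space J. observed \<omega> = x}) \<mu>0 fst"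

text \<open>
  The joint law of the true kernel, the offline data and the first \<open>t\<close> online episodes of iPSRL.
  The kernel \<open>\<theta>'\<close> sampled from the posterior depends on the past only through the data.
\<close>

primrec ipsrl ::
  "mdp \<Rightarrow> real \<Rightarrow> nat \<Rightarrow> kernel measure \<Rightarrow> (kernel \<Rightarrow> policy) \<Rightarrow> nat \<Rightarrow> outcome measure" where
  "ipsrl M \<beta> L \<mu>0 pistar 0 =
     do {
       \<theta> \<leftarrow> \<mu>0;
       distr (measure_pmf (offline M \<beta> L \<theta>)) (outcome_space M \<mu>0) (\<lambda>D. (\<theta>, D, []))
     }"
| "ipsrl M \<beta> L \<mu>0 pistar (Suc t) =
     do {
       \<omega> \<leftarrow> ipsrl M \<beta> L \<mu>0 pistar t;
       \<theta>' \<leftarrow> posterior \<mu>0 (ipsrl M \<beta> L \<mu>0 pistar t) (observed \<omega>);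
       (case \<omega> of (\<theta>, D, es) \<Rightarrow>
         distr (measure_pmf (episode M \<theta> (det_policy (pistar \<theta>')))) (outcome_space M \<mu>0)
           (\<lambda>\<tau>. (\<theta>, D, es @ [(pistar \<theta>', \<tau>)])))
     }"

definition bayes_regret ::
  "mdp \<Rightarrow> real \<Rightarrow> nat \<Rightarrow> kernel measure \<Rightarrow> (kernel \<Rightarrow> policy) \<Rightarrow> nat \<Rightarrow> real" where
  "bayes_regret M \<beta> L \<mu>0 pistar T =
     (LINT \<omega>|ipsrl M \<beta> L \<mu>0 pistar T. (case \<omega> of (\<theta>, D, es) \<Rightarrow>
        (\<Sum>t<T. opt_V M \<theta> 0 (init_state (snd (es ! t))) - total_reward M (snd (es ! t)))))"

definition first_error ::
  "mdp \<Rightarrow> real \<Rightarrow> nat \<Rightarrow> kernel measure \<Rightarrow> (kernel \<Rightarrow> policy) \<Rightarrow> real" where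
  "first_error M \<beta> L \<mu>0 pistar =
     \<P>((\<theta>, D, es) in ipsrl M \<beta> L \<mu>0 pistar 1. fst (es ! 0) \<noteq> pistar \<theta>)"

end

theory Submission
  imports Defs
begin

text \<open>
  Given the data before an episode, the true kernel \<open>\<theta>\<close> and the sampled kernel \<open>\<theta>'\<close> are independent
  with the same law. The regret of the episode lives on the event that the two optimal policies
  differ, which is symmetric in \<open>\<theta>\<close> and \<open>\<theta>'\<close>; so there the optimal value of \<open>\<theta>\<close> may be replaced by that
  of \<open>\<theta>'\<close>, and the regret becomes the difference of the values of one policy under \<open>\<theta>'\<close> and \<open>\<theta>\<close>. It is at
  most \<open>H\<close> times the sum, along the episode, of the \<open>L\<^sup>1\<close> distances of the two kernels. By
  Cauchy-Schwarz the probability of the event splits off. This probability does not increase over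
  time, because posteriors are martingales and the collision probability is convex.

  The squared \<open>L\<^sup>1\<close> distance to the empirical kernel after \<open>n\<close> visits is compared with \<open>x / n\<close> for
  \<open>x = 4 S (1 + ln T)\<close>. These terms sum up to \<open>HSA \<cdot> O(S (1 + ln T)\<^sup>2)\<close>. The excess over \<open>x / n\<close> is
  simply summed over all triples \<open>(h, s, a)\<close>, with no union bound, so that no logarithm of \<open>HSA\<close> arises;
  by exponential supermartingales its expectation is at most \<open>4 / T\<close> per triple and episode.
\<close>

text \<open>The obstacle is that \<open>ipsrl\<close> is a recursion on measures over kernels in
  which the posterior conditions the very law that is being built. Only the kernel ranges over an
  uncountable set, however. So the sampled kernels are integrated out, keeping just the policies
  that they select, and \<open>obs_law t \<theta>\<close> is left: for each kernel a distribution of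
  the data with finite support. A prior average becomes a finite sum over data of evidence times
  posterior integral, and the pair of kernels has a product measure, invariant under swapping.

  Kernel errors are measured along the episode that is run under \<open>\<theta>\<close>, since
  those are the visits that later data count. The bonus depends on the data alone, so it telescopes
  on every path. The excess of \<open>\<theta>'\<close> cannot be bounded directly, because the data
  were not generated by \<open>\<theta>'\<close>. Summed over all triples it no longer depends on
  the path, and then it can be exchanged for the excess of \<open>\<theta>\<close>.\<close>

abbreviation expect :: "'a pmf \<Rightarrow> ('a \<Rightarrow> real) \<Rightarrow> real" where
  "expect p f \<equiv> measure_pmf.expectation p f"

section \<open>Expectations under finitely supported distributions\<close>

lemma expect_bind:
  assumes "finite (set_pmf p)" "\<And>x. x \<in> set_pmf p \<Longrightarrow> finite (set_pmf (f x))"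
  shows "expect (bind_pmf p f) g = expect p (\<lambda>x. expect (f x) g)"
  using assms
  by (subst pmf_expectation_bind[where A = "set_pmf p"], auto)
     (subst integral_measure_pmf[where A = "set_pmf p"], auto)

lemma expect_finite:
  assumes "finite A" "set_pmf p \<subseteq> A"
  shows "expect p f = (\<Sum>x\<in>A. pmf p x * f x)"
  using assms by (subst integral_measure_pmf[where A = A]) auto

lemma expect_mono:
  assumes "finite (set_pmf p)" "\<And>x. x \<in> set_pmf p \<Longrightarrow> f x \<le> g x"
  shows "expect p f \<le> expect p g"
  using assms by (auto intro!: integral_mono_AE integrable_measure_pmf_finite simp: AE_measure_pmf_iff)

lemma expect_cong: "(\<And>x. x \<in> set_pmf p \<Longrightarrow> f x = g x) \<Longrightarrow> expect p f = expect p g"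
  by (intro integral_cong_AE) (auto simp: AE_measure_pmf_iff)

lemma expect_le_const:
  assumes "finite (set_pmf p)" "\<And>x. x \<in> set_pmf p \<Longrightarrow> f x \<le> c"
  shows "expect p f \<le> c"
  using expect_mono[OF assms(1), of f "\<lambda>_. c"] assms(2) by simp

lemma expect_ge_const:
  assumes "finite (set_pmf p)" "\<And>x. x \<in> set_pmf p \<Longrightarrow> c \<le> f x"
  shows "c \<le> expect p f"
  using expect_mono[OF assms(1), of "\<lambda>_. c" f] assms(2) by simp

lemma expect_add:
  assumes "finite (set_pmf p)"
  shows "expect p (\<lambda>x. f x + g x) = expect p f + expect p g"
  using assms by (intro Bochner_Integration.integral_add integrable_measure_pmf_finite)

lemma expect_diff:
  assumes "finite (set_pmf p)"
  shows "expect p (\<lambda>x. f x - g x) = expect p f - expect p g"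
  using assms by (intro Bochner_Integration.integral_diff integrable_measure_pmf_finite)

lemma expect_sum:
  assumes "finite (set_pmf p)"
  shows "expect p (\<lambda>x. \<Sum>i\<in>I. f i x) = (\<Sum>i\<in>I. expect p (f i))"
  using assms by (intro Bochner_Integration.integral_sum integrable_measure_pmf_finite)

text \<open>Hoeffding's lemma for an interval of length 2 gives the exponent
  \<open>l\<^sup>2 * 4 / 8\<close>. It is moved to the left so that the integrand is the one-step
  factor of a supermartingale.\<close>

lemma Hoeffdings_lemma_pmf:
  fixes g :: "nat \<Rightarrow> real" and S :: "nat set"
  assumes S: "finite S" "set_pmf p \<subseteq> S" and g: "\<And>x. x \<in> S \<Longrightarrow> \<bar>g x\<bar> \<le> 1" and "0 \<le> l"
  shows "expect p (\<lambda>x. exp (l * (g x - expect p g) - l\<^sup>2 / 2)) \<le> 1"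
proof (cases "l = 0")
  case False
  then have l: "l > 0" using \<open>0 \<le> l\<close> by simp
  interpret interval_bounded_random_variable "measure_pmf p" g "-1" 1
    using g S(2) by unfold_locales (auto simp: AE_measure_pmf_iff abs_le_iff subset_iff minus_le_iff)
  have fin: "finite (set_pmf p)" using S finite_subset by blast
  have "ennreal (expect p (\<lambda>x. exp (l * (g x - expect p g))))
      = (\<integral>\<^sup>+x. ennreal (exp (l * (g x - expect p g))) \<partial>p)"
    by (intro nn_integral_eq_integral[symmetric] integrable_measure_pmf_finite fin) auto
  also have "\<dots> \<le> ennreal (exp (l\<^sup>2 * (1 - (-1))\<^sup>2 / 8))"
    by (rule Hoeffdings_lemma_nn_integral[OF l])
  finally have *: "expect p (\<lambda>x. exp (l * (g x - expect p g))) \<le> exp (l\<^sup>2 / 2)"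
    by (simp add: power2_eq_square)
  have "expect p (\<lambda>x. exp (l * (g x - expect p g) - l\<^sup>2 / 2))
      = expect p (\<lambda>x. exp (l * (g x - expect p g))) / exp (l\<^sup>2 / 2)"
    by (simp add: exp_diff)
  with * show ?thesis by simp
qed simp

subsection \<open>Rollouts\<close>

text \<open>Rewards, kernel distances and bonuses are all additive along a trajectory. The start
  period lets the sum follow the recursion of \<open>rollout\<close>.\<close>

definition step_sum :: "(nat \<times> nat \<times> nat \<Rightarrow> real) \<Rightarrow> nat \<Rightarrow> (nat \<times> nat) list \<Rightarrow> real" where
  "step_sum f h xs = (\<Sum>i<length xs. f (h + i, fst (xs ! i), snd (xs ! i)))"

lemma step_sum_Nil [simp]: "step_sum f h [] = 0"
  by (simp add: step_sum_def)

lemma step_sum_Cons [simp]: "step_sum f h ((s, a) # xs) = f (h, s, a) + step_sum f (Suc h) xs"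
  by (simp add: step_sum_def sum.lessThan_Suc_shift del: sum.lessThan_Suc)

text \<open>A trajectory stores its final state apart; with this function
  \<open>traj_state \<tau> (Suc i)\<close> is the successor of step \<open>i\<close> also at the
  last step.\<close>

definition traj_state :: "traj \<Rightarrow> nat \<Rightarrow> nat" where
  "traj_state \<tau> i = (if i < length (fst \<tau>) then fst (fst \<tau> ! i) else snd \<tau>)"

text \<open>\<open>h0\<close> is the period of the first entry of the trajectory.\<close>

definition visits :: "nat \<Rightarrow> nat \<times> nat \<times> nat \<Rightarrow> traj \<Rightarrow> bool" where
  "visits h0 i \<tau> \<longleftrightarrow> h0 \<le> fst i \<and> fst i - h0 < length (fst \<tau>) \<and> fst \<tau> ! (fst i - h0) = snd i"

definition reward_from :: "mdp \<Rightarrow> nat \<Rightarrow> traj \<Rightarrow> real" where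
  "reward_from M h \<tau> = step_sum (\<lambda>(h, s, a). rew M h s a) h (fst \<tau>) + final_rew M (snd \<tau>)"

definition trajs :: "mdp \<Rightarrow> nat \<Rightarrow> traj set" where
  "trajs M n = {xs. set xs \<subseteq> states M \<times> actions M \<and> length xs = n} \<times> states M"

definition valid_policy :: "mdp \<Rightarrow> (nat \<Rightarrow> nat \<Rightarrow> nat pmf) \<Rightarrow> bool" where
  "valid_policy M \<psi> \<longleftrightarrow> (\<forall>h<horizon M. \<forall>s\<in>states M. set_pmf (\<psi> h s) \<subseteq> actions M)"

definition kernel_dist :: "mdp \<Rightarrow> kernel \<Rightarrow> kernel \<Rightarrow> nat \<times> nat \<times> nat \<Rightarrow> real" where
  "kernel_dist M \<theta> \<theta>' i = (\<Sum>s'\<in>states M. \<bar>pmf (\<theta> i) s' - pmf (\<theta>' i) s'\<bar>)"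

locale finite_mdp =
  fixes M :: mdp
  assumes wf: "wf_mdp M"
begin

abbreviation "S \<equiv> states M"
abbreviation "A \<equiv> actions M"
abbreviation "H \<equiv> horizon M"

lemma finite_states [simp, intro]: "finite S" and states_nonempty [simp]: "S \<noteq> {}"
  and finite_actions [simp, intro]: "finite A" and actions_nonempty [simp]: "A \<noteq> {}"
  and horizon_pos [simp]: "0 < H"
  and set_init: "set_pmf (init M) \<subseteq> S"
  and rew_bounds: "h < H \<Longrightarrow> s \<in> S \<Longrightarrow> a \<in> A \<Longrightarrow> 0 \<le> rew M h s a \<and> rew M h s a \<le> 1"
  and final_rew_bounds: "s \<in> S \<Longrightarrow> 0 \<le> final_rew M s \<and> final_rew M s \<le> 1"
  using wf by (auto simp: wf_mdp_def)

lemma finite_triples [simp, intro]: "finite (triples M)"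
  by (simp add: triples_def)

lemma card_triples: "card (triples M) = H * (card S * card A)"
  by (simp add: triples_def card_cartesian_product)

lemma finite_policies [simp, intro]: "finite (policies M)"
  unfolding policies_def by (intro finite_PiE) auto

lemma finite_trajs [simp, intro]: "finite (trajs M n)"
  unfolding trajs_def by (intro finite_cartesian_product finite_lists_length_eq) auto

lemma set_kernel: "\<theta> \<in> kernels M \<Longrightarrow> i \<in> triples M \<Longrightarrow> set_pmf (\<theta> i) \<subseteq> S"
  by (auto simp: kernels_def PiE_iff)

lemma sum_kernel: "\<theta> \<in> kernels M \<Longrightarrow> i \<in> triples M \<Longrightarrow> (\<Sum>s'\<in>S. pmf (\<theta> i) s') = 1"
  by (intro sum_pmf_eq_1 set_kernel) auto

lemma valid_det_policy: "\<pi> \<in> policies M \<Longrightarrow> valid_policy M (det_policy \<pi>)"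
  by (auto simp: valid_policy_def policies_def PiE_iff)

lemma in_triples [simp]: "(h, s, a) \<in> triples M \<longleftrightarrow> h < H \<and> s \<in> S \<and> a \<in> A"
  by (auto simp: triples_def)

lemma set_rollout:
  assumes "\<theta> \<in> kernels M" "valid_policy M \<psi>" "h + n \<le> H" "s \<in> S"
  shows "set_pmf (rollout \<theta> \<psi> h n s) \<subseteq> trajs M n"
  using assms(3,4)
proof (induction n arbitrary: h s)
  case 0
  then show ?case by (auto simp: trajs_def)
next
  case (Suc n)
  show ?case
  proof
    fix \<tau> assume "\<tau> \<in> set_pmf (rollout \<theta> \<psi> h (Suc n) s)"
    then obtain a s' xs sH where *: "a \<in> set_pmf (\<psi> h s)" "s' \<in> set_pmf (\<theta> (h, s, a))"
      "(xs, sH) \<in> set_pmf (rollout \<theta> \<psi> (Suc h) n s')" "\<tau> = ((s, a) # xs, sH)"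
      by (auto simp: set_bind_pmf split: prod.splits)
    have "set_pmf (\<psi> h s) \<subseteq> A" using Suc.prems assms(2) by (simp add: valid_policy_def)
    with *(1) have a: "a \<in> A" by blast
    have "s' \<in> S" using set_kernel[OF assms(1), of "(h, s, a)"] a * Suc.prems by auto
    with Suc.IH[of "Suc h" s'] * Suc.prems a show "\<tau> \<in> trajs M (Suc n)"
      by (auto simp: trajs_def)
  qed
qed

lemma finite_set_rollout:
  assumes "\<theta> \<in> kernels M" "valid_policy M \<psi>" "h + n \<le> H" "s \<in> S"
  shows "finite (set_pmf (rollout \<theta> \<psi> h n s))"
  using set_rollout[OF assms] finite_subset by blast

lemma traj_state_rollout:
  "\<tau> \<in> set_pmf (rollout \<theta> \<psi> h n s) \<Longrightarrow> traj_state \<tau> 0 = s"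
  by (cases n) (auto simp: traj_state_def split: prod.splits)

text \<open>All inductions over rollouts use this equation. Its finite sums serve measurability in
  the kernel as well as inequalities; \<open>F\<close> changes along an induction because the first
  step is absorbed into it.\<close>

lemma expect_rollout_Suc:
  assumes "\<theta> \<in> kernels M" "valid_policy M \<psi>" "h + Suc n \<le> H" "s \<in> S"
  shows "expect (rollout \<theta> \<psi> h (Suc n) s) F =
    (\<Sum>a\<in>A. pmf (\<psi> h s) a * (\<Sum>s'\<in>S. pmf (\<theta> (h, s, a)) s' *
       expect (rollout \<theta> \<psi> (Suc h) n s') (\<lambda>\<tau>. F ((s, a) # fst \<tau>, snd \<tau>))))"
proof -
  have A: "set_pmf (\<psi> h s) \<subseteq> A" using assms by (auto simp: valid_policy_def)
  have K: "set_pmf (\<theta> (h, s, a)) \<subseteq> S" if "a \<in> A" for a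
    using set_kernel[OF assms(1), of "(h, s, a)"] that assms by auto
  have fK: "finite (set_pmf (\<theta> (h, s, a)))" if "a \<in> A" for a
    using K[OF that] finite_subset by blast
  have fR: "finite (set_pmf (rollout \<theta> \<psi> (Suc h) n s'))" if "s' \<in> S" for s'
    using finite_set_rollout[of \<theta> \<psi> "Suc h" n s'] assms that by auto
  have fB: "finite (set_pmf (rollout \<theta> \<psi> (Suc h) n s' \<bind> (\<lambda>(xs, sH). return_pmf ((s, a) # xs, sH))))"
    if "s' \<in> S" for s' a
    using fR[OF that] by (auto simp: set_bind_pmf split: prod.splits)
  have 1: "expect (rollout \<theta> \<psi> (Suc h) n s' \<bind> (\<lambda>(xs, sH). return_pmf ((s, a) # xs, sH))) F
      = expect (rollout \<theta> \<psi> (Suc h) n s') (\<lambda>\<tau>. F ((s, a) # fst \<tau>, snd \<tau>))" if "s' \<in> S" for s' a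
    by (subst expect_bind) (auto simp: fR that case_prod_beta)
  have 2: "expect (\<theta> (h, s, a) \<bind> (\<lambda>s'. rollout \<theta> \<psi> (Suc h) n s' \<bind>
       (\<lambda>(xs, sH). return_pmf ((s, a) # xs, sH)))) F
     = (\<Sum>s'\<in>S. pmf (\<theta> (h, s, a)) s' *
       expect (rollout \<theta> \<psi> (Suc h) n s') (\<lambda>\<tau>. F ((s, a) # fst \<tau>, snd \<tau>)))" if "a \<in> A" for a
    using K[OF that] fB by (subst pmf_expectation_bind[where A = S]) (auto simp: 1)
  have 3: "finite (set_pmf (\<theta> (h, s, a) \<bind> (\<lambda>s'. rollout \<theta> \<psi> (Suc h) n s' \<bind>
       (\<lambda>(xs, sH). return_pmf ((s, a) # xs, sH)))))" if "a \<in> A" for a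
    unfolding set_bind_pmf[of "\<theta> (h, s, a)"] using fK[OF that] K[OF that] fB by (intro finite_UN_I) auto
  show ?thesis
    unfolding rollout.simps using A
    by (subst pmf_expectation_bind[where A = A]) (simp_all add: 2 3 del: set_bind_pmf)
qed

text \<open>Kernel and policy both vary with \<open>x\<close>, since the expert's policy depends on
  the kernel. After unrolling, only point masses of the two enter, in finite sums and
  products.\<close>

lemma measurable_expect_rollout:
  assumes F: "\<And>\<tau>. (\<lambda>x. F x \<tau>) \<in> borel_measurable N"
    and \<theta>: "\<And>x. x \<in> space N \<Longrightarrow> \<theta> x \<in> kernels M"
      "\<And>i s'. i \<in> triples M \<Longrightarrow> (\<lambda>x. pmf (\<theta> x i) s') \<in> borel_measurable N"
    and \<psi>: "\<And>x. x \<in> space N \<Longrightarrow> valid_policy M (\<psi> x)"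
      "\<And>h s a. h < H \<Longrightarrow> s \<in> S \<Longrightarrow> a \<in> A \<Longrightarrow> (\<lambda>x. pmf (\<psi> x h s) a) \<in> borel_measurable N"
    and "h + n \<le> H" "s \<in> S"
  shows "(\<lambda>x. expect (rollout (\<theta> x) (\<psi> x) h n s) (F x)) \<in> borel_measurable N"
  using assms(1,6,7)
proof (induction n arbitrary: h s F)
  case 0
  then show ?case by simp
next
  case (Suc n)
  have [measurable]: "(\<lambda>x. expect (rollout (\<theta> x) (\<psi> x) (Suc h) n s')
      (\<lambda>\<tau>. F x ((s, a) # fst \<tau>, snd \<tau>))) \<in> borel_measurable N" if "s' \<in> S" for s' a
    using Suc.prems that by (intro Suc.IH) auto
  have "(\<lambda>x. \<Sum>a\<in>A. pmf (\<psi> x h s) a * (\<Sum>s'\<in>S. pmf (\<theta> x (h, s, a)) s' *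
       expect (rollout (\<theta> x) (\<psi> x) (Suc h) n s') (\<lambda>\<tau>. F x ((s, a) # fst \<tau>, snd \<tau>))))
    \<in> borel_measurable N"
    using Suc.prems \<theta>(2) \<psi>(2) by (intro borel_measurable_sum borel_measurable_times) auto
  then show ?case
    using Suc.prems
    by (subst measurable_cong[OF expect_rollout_Suc[OF \<theta>(1) \<psi>(1)]]) auto
qed

lemma reward_from_Cons [simp]:
  "reward_from M h ((s, a) # xs, sH) = rew M h s a + reward_from M (Suc h) (xs, sH)"
  by (simp add: reward_from_def)

lemma reward_from_bounds:
  assumes "\<tau> \<in> trajs M n" "h + n \<le> H"
  shows "0 \<le> reward_from M h \<tau> \<and> reward_from M h \<tau> \<le> real n + 1"
  using assms
proof (induction n arbitrary: h \<tau>)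
  case 0
  then show ?case using final_rew_bounds by (auto simp: trajs_def reward_from_def)
next
  case (Suc n)
  then obtain s a xs sH where \<tau>: "\<tau> = ((s, a) # xs, sH)" "(xs, sH) \<in> trajs M n" "s \<in> S" "a \<in> A"
    by (auto simp: trajs_def length_Suc_conv)
  then show ?case using Suc.IH[of "(xs, sH)" "Suc h"] rew_bounds[of h s a] Suc.prems by auto
qed

text \<open>The simulation lemma. One step contributes \<open>(P' - P) V'\<close>, where the
  continuation value \<open>V'\<close> lies between 0 and \<open>H\<close>; the rest,
  \<open>P (V' - V)\<close>, is the induction hypothesis averaged under \<open>P\<close>. This way
  of splitting puts the expectation under \<open>\<theta>\<close>, the kernel that generates the
  episode.\<close>

lemma value_difference:
  assumes \<theta>: "\<theta> \<in> kernels M" "\<theta>' \<in> kernels M" and \<psi>: "valid_policy M \<psi>"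
    and "h + n = H" "s \<in> S"
  shows "expect (rollout \<theta>' \<psi> h n s) (reward_from M h) - expect (rollout \<theta> \<psi> h n s) (reward_from M h)
     \<le> expect (rollout \<theta> \<psi> h n s) (\<lambda>\<tau>. real H * step_sum (kernel_dist M \<theta> \<theta>') h (fst \<tau>))"
  using assms(4,5)
proof (induction n arbitrary: h s)
  case 0
  then show ?case by simp
next
  case (Suc n)
  define V where "V = (\<lambda>\<theta> s'. expect (rollout \<theta> \<psi> (Suc h) n s') (reward_from M (Suc h)))"
  define W where "W = (\<lambda>s'. expect (rollout \<theta> \<psi> (Suc h) n s')
    (\<lambda>\<tau>. real H * step_sum (kernel_dist M \<theta> \<theta>') (Suc h) (fst \<tau>)))"
  have fin: "finite (set_pmf (rollout \<kappa> \<psi> (Suc h) n s'))" if "s' \<in> S" "\<kappa> \<in> kernels M" for s' \<kappa>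
    using finite_set_rollout[of \<kappa> \<psi> "Suc h" n s'] \<psi> Suc.prems that by auto
  have IH: "V \<theta>' s' \<le> V \<theta> s' + W s'" if "s' \<in> S" for s'
    using Suc.IH[of "Suc h" s'] Suc.prems that by (auto simp: V_def W_def)
  \<comment> \<open>After one step at most \<open>n + 1 = H - h\<close> rewards remain, the final
    one included, so the bound is \<open>H\<close> and not \<open>H + 1\<close>.\<close>
  have V: "0 \<le> V \<theta>' s'" "V \<theta>' s' \<le> H" if "s' \<in> S" for s'
  proof -
    have *: "0 \<le> reward_from M (Suc h) \<tau> \<and> reward_from M (Suc h) \<tau> \<le> real n + 1"
      if "\<tau> \<in> set_pmf (rollout \<theta>' \<psi> (Suc h) n s')" for \<tau>
      using reward_from_bounds[of \<tau> n "Suc h"] set_rollout[OF \<theta>(2) \<psi>, of "Suc h" n s'] that \<open>s' \<in> S\<close>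
        Suc.prems by auto
    show "0 \<le> V \<theta>' s'" unfolding V_def using * that \<theta> by (intro expect_ge_const fin) auto
    show "V \<theta>' s' \<le> H" unfolding V_def using * that \<theta> Suc.prems
      by (intro expect_le_const fin) (force)+
  qed
  have step: "(\<Sum>s'\<in>S. pmf (\<theta>' (h, s, a)) s' * (rew M h s a + V \<theta>' s'))
     - (\<Sum>s'\<in>S. pmf (\<theta> (h, s, a)) s' * (rew M h s a + V \<theta> s'))
     \<le> (\<Sum>s'\<in>S. pmf (\<theta> (h, s, a)) s' * (real H * kernel_dist M \<theta> \<theta>' (h, s, a) + W s'))"
    if a: "a \<in> A" for a
  proof -
    have i: "(h, s, a) \<in> triples M" using a Suc.prems by auto
    have "(\<Sum>s'\<in>S. pmf (\<theta>' (h, s, a)) s' * V \<theta>' s')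
        = (\<Sum>s'\<in>S. (pmf (\<theta>' (h, s, a)) s' - pmf (\<theta> (h, s, a)) s') * V \<theta>' s' + pmf (\<theta> (h, s, a)) s' * V \<theta>' s')"
      by (simp add: algebra_simps)
    also have "\<dots> \<le> (\<Sum>s'\<in>S. \<bar>pmf (\<theta> (h, s, a)) s' - pmf (\<theta>' (h, s, a)) s'\<bar> * H
         + pmf (\<theta> (h, s, a)) s' * (V \<theta> s' + W s'))"
    proof (intro sum_mono add_mono mult_left_mono IH)
      fix s' assume s': "s' \<in> S"
      have "(pmf (\<theta>' (h, s, a)) s' - pmf (\<theta> (h, s, a)) s') * V \<theta>' s'
          \<le> \<bar>pmf (\<theta> (h, s, a)) s' - pmf (\<theta>' (h, s, a)) s'\<bar> * V \<theta>' s'"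
        using V[OF s'] by (intro mult_right_mono) auto
      also have "\<dots> \<le> \<bar>pmf (\<theta> (h, s, a)) s' - pmf (\<theta>' (h, s, a)) s'\<bar> * H"
        using V[OF s'] by (intro mult_left_mono) auto
      finally show "(pmf (\<theta>' (h, s, a)) s' - pmf (\<theta> (h, s, a)) s') * V \<theta>' s'
          \<le> \<bar>pmf (\<theta> (h, s, a)) s' - pmf (\<theta>' (h, s, a)) s'\<bar> * H" .
    qed auto
    also have "\<dots> = real H * kernel_dist M \<theta> \<theta>' (h, s, a)
         + (\<Sum>s'\<in>S. pmf (\<theta> (h, s, a)) s' * V \<theta> s') + (\<Sum>s'\<in>S. pmf (\<theta> (h, s, a)) s' * W s')"
      by (simp add: kernel_dist_def sum.distrib sum_distrib_left distrib_left mult.commute[of _ "real H"])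
    finally show ?thesis
      by (simp add: distrib_left sum.distrib sum_distrib_right[symmetric] sum_kernel[OF _ i] \<theta>)
  qed
  have R: "expect (rollout \<kappa> \<psi> h (Suc n) s) (reward_from M h)
      = (\<Sum>a\<in>A. pmf (\<psi> h s) a * (\<Sum>s'\<in>S. pmf (\<kappa> (h, s, a)) s' * (rew M h s a + V \<kappa> s')))"
    if "\<kappa> \<in> kernels M" for \<kappa>
    using Suc.prems
    by (subst expect_rollout_Suc[OF that \<psi>]) (auto simp: V_def expect_add[OF fin] that)
  have R': "expect (rollout \<theta> \<psi> h (Suc n) s) (\<lambda>\<tau>. real H * step_sum (kernel_dist M \<theta> \<theta>') h (fst \<tau>))
      = (\<Sum>a\<in>A. pmf (\<psi> h s) a * (\<Sum>s'\<in>S. pmf (\<theta> (h, s, a)) s' *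
          (real H * kernel_dist M \<theta> \<theta>' (h, s, a) + W s')))"
    using Suc.prems
    by (subst expect_rollout_Suc[OF \<theta>(1) \<psi>]) (auto simp: W_def distrib_left expect_add[OF fin] \<theta>)
  show ?case
    unfolding R[OF \<theta>(1)] R[OF \<theta>(2)] R'
  proof (subst sum_subtractf[symmetric], rule sum_mono)
    fix a assume "a \<in> A"
    from mult_left_mono[OF step[OF this], of "pmf (\<psi> h s) a"]
    show "pmf (\<psi> h s) a * (\<Sum>s'\<in>S. pmf (\<theta>' (h, s, a)) s' * (rew M h s a + V \<theta>' s'))
        - pmf (\<psi> h s) a * (\<Sum>s'\<in>S. pmf (\<theta> (h, s, a)) s' * (rew M h s a + V \<theta> s'))
        \<le> pmf (\<psi> h s) a * (\<Sum>s'\<in>S. pmf (\<theta> (h, s, a)) s' *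
            (real H * kernel_dist M \<theta> \<theta>' (h, s, a) + W s'))"
      by (simp add: right_diff_distrib)
  qed
qed

section \<open>The exponential supermartingale of one triple\<close>

text \<open>The period is part of \<open>i\<close>, so an episode visits \<open>i\<close> at most
  once and contributes a single factor to the supermartingale of that triple.\<close>

definition mgf_factor :: "kernel \<Rightarrow> nat \<times> nat \<times> nat \<Rightarrow> (nat \<Rightarrow> real) \<Rightarrow> real \<Rightarrow> nat \<Rightarrow> traj \<Rightarrow> real" where
  "mgf_factor \<theta> i g l h0 \<tau> = (if visits h0 i \<tau>
     then exp (l * (g (traj_state \<tau> (Suc (fst i - h0))) - expect (\<theta> i) g) - l\<^sup>2 / 2) else 1)"

lemma visits_Cons:
  "visits h0 i (x # xs, sH) \<longleftrightarrow> (if fst i = h0 then x = snd i else visits (Suc h0) i (xs, sH))"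
proof -
  consider "fst i < h0" | "fst i = h0" | k where "fst i = Suc (h0 + k)"
    by (metis less_iff_Suc_add linorder_neqE_nat)
  then show ?thesis by cases (auto simp: visits_def)
qed

lemma traj_state_Cons: "traj_state (x # xs, sH) (Suc k) = traj_state (xs, sH) k"
  by (simp add: traj_state_def)

lemma mgf_factor_Cons:
  "mgf_factor \<theta> i g l h0 (x # xs, sH) =
    (if fst i = h0 then (if x = snd i then exp (l * (g (traj_state (xs, sH) 0) - expect (\<theta> i) g) - l\<^sup>2 / 2) else 1)
     else mgf_factor \<theta> i g l (Suc h0) (xs, sH))"
proof (cases "fst i = h0")
  case False
  \<comment> \<open>For \<open>fst i < h0\<close> truncated subtraction breaks the index shift, but
    then no visit can occur.\<close>
  then have "fst i - h0 = Suc (fst i - Suc h0) \<or> \<not> visits (Suc h0) i (xs, sH)"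
    by (auto simp: visits_def)
  with False show ?thesis by (auto simp: mgf_factor_def visits_Cons traj_state_Cons)
qed (auto simp: mgf_factor_def visits_Cons traj_state_Cons)

text \<open>Away from the period of \<open>i\<close> the induction hypothesis is averaged. At that
  period the next state is drawn from \<open>\<theta> i\<close> after the action has been chosen, so
  Hoeffding's lemma applies whatever the policy does.\<close>

lemma expect_mgf_factor_rollout:
  assumes \<theta>: "\<theta> \<in> kernels M" and \<psi>: "valid_policy M \<psi>" and i: "i \<in> triples M"
    and g: "\<And>x. x \<in> S \<Longrightarrow> \<bar>g x\<bar> \<le> 1" and l: "0 \<le> l" and "h + n \<le> H" "s \<in> S"
  shows "expect (rollout \<theta> \<psi> h n s) (mgf_factor \<theta> i g l h) \<le> 1"
  using assms(6,7)
proof (induction n arbitrary: h s)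
  case 0
  then show ?case by (simp add: mgf_factor_def visits_def)
next
  case (Suc n)
  have A: "set_pmf (\<psi> h s) \<subseteq> A" using Suc.prems \<psi> by (auto simp: valid_policy_def)
  have "(\<Sum>s'\<in>S. pmf (\<theta> (h, s, a)) s' * expect (rollout \<theta> \<psi> (Suc h) n s')
       (\<lambda>\<tau>. mgf_factor \<theta> i g l h ((s, a) # fst \<tau>, snd \<tau>))) \<le> 1" if a: "a \<in> A" for a
  proof (cases "fst i = h")
    case True
    show ?thesis
    proof (cases "(s, a) = snd i")
      case True
      then have i': "(h, s, a) = i" using \<open>fst i = h\<close> by (cases i) auto
      \<comment> \<open>At the visit the factor depends on the rest of the rollout only through its
        first state.\<close>
      have "expect (rollout \<theta> \<psi> (Suc h) n s') (\<lambda>\<tau>. mgf_factor \<theta> i g l h ((s, a) # fst \<tau>, snd \<tau>))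
          = exp (l * (g s' - expect (\<theta> i) g) - l\<^sup>2 / 2)" for s'
        using True \<open>fst i = h\<close>
        by (subst expect_cong[of _ _ "\<lambda>_. exp (l * (g s' - expect (\<theta> i) g) - l\<^sup>2 / 2)"])
           (auto simp: mgf_factor_Cons traj_state_rollout)
      then have "(\<Sum>s'\<in>S. pmf (\<theta> (h, s, a)) s' * expect (rollout \<theta> \<psi> (Suc h) n s')
           (\<lambda>\<tau>. mgf_factor \<theta> i g l h ((s, a) # fst \<tau>, snd \<tau>)))
         = expect (\<theta> i) (\<lambda>s'. exp (l * (g s' - expect (\<theta> i) g) - l\<^sup>2 / 2))"
        using set_kernel[OF \<theta> i] by (simp add: i' expect_finite[of S])
      also have "\<dots> \<le> 1"
        using set_kernel[OF \<theta> i] g l by (intro Hoeffdings_lemma_pmf) auto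
      finally show ?thesis .
    next
      case False
      then show ?thesis using \<open>fst i = h\<close> sum_kernel[OF \<theta>, of "(h, s, a)"] a Suc.prems
        by (simp add: mgf_factor_Cons)
    qed
  next
    case False
    have "(\<Sum>s'\<in>S. pmf (\<theta> (h, s, a)) s' * expect (rollout \<theta> \<psi> (Suc h) n s')
       (\<lambda>\<tau>. mgf_factor \<theta> i g l h ((s, a) # fst \<tau>, snd \<tau>)))
       \<le> (\<Sum>s'\<in>S. pmf (\<theta> (h, s, a)) s' * 1)"
      using False Suc.IH[of "Suc h"] Suc.prems
      by (intro sum_mono mult_left_mono) (auto simp: mgf_factor_Cons)
    also have "\<dots> = 1" using sum_kernel[OF \<theta>, of "(h, s, a)"] a Suc.prems by simp
    finally show ?thesis .
  qed
  then have "(\<Sum>a\<in>A. pmf (\<psi> h s) a * (\<Sum>s'\<in>S. pmf (\<theta> (h, s, a)) s' *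
       expect (rollout \<theta> \<psi> (Suc h) n s') (\<lambda>\<tau>. mgf_factor \<theta> i g l h ((s, a) # fst \<tau>, snd \<tau>))))
     \<le> (\<Sum>a\<in>A. pmf (\<psi> h s) a * 1)"
    by (intro sum_mono mult_left_mono) auto
  also have "\<dots> = 1" using sum_pmf_eq_1[OF _ A] by simp
  finally show ?case using Suc.prems by (subst expect_rollout_Suc[OF \<theta> \<psi>]) auto
qed

end

subsection \<open>Visit counts and concentration\<close>

definition visit_count :: "traj list \<Rightarrow> nat \<times> nat \<times> nat \<Rightarrow> nat" where
  "visit_count ts i = length (filter (visits 0 i) ts)"

definition trans_count :: "traj list \<Rightarrow> nat \<times> nat \<times> nat \<Rightarrow> nat \<Rightarrow> nat" where
  "trans_count ts i s' = length (filter (\<lambda>\<tau>. visits 0 i \<tau> \<and> traj_state \<tau> (Suc (fst i)) = s') ts)"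

definition emp_dist :: "mdp \<Rightarrow> kernel \<Rightarrow> traj list \<Rightarrow> nat \<times> nat \<times> nat \<Rightarrow> real" where
  "emp_dist M \<theta> ts i =
    (\<Sum>s'\<in>states M. \<bar>real (trans_count ts i s') / real (visit_count ts i) - pmf (\<theta> i) s'\<bar>)"

text \<open>
  With no visits, \<open>emp_dist\<close> measures the distance to \<open>0\<close> (as \<open>0 / 0 = 0\<close>). The value \<open>bonus x 0 = 4\<close>
  bounds any squared distance, so unvisited triples have no excess.
\<close>

definition bonus :: "real \<Rightarrow> nat \<Rightarrow> real" where
  "bonus x n = (if n = 0 then 4 else x / real n)"

definition excess :: "mdp \<Rightarrow> real \<Rightarrow> kernel \<Rightarrow> traj list \<Rightarrow> nat \<times> nat \<times> nat \<Rightarrow> real" where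
  "excess M x \<theta> ts i = max 0 ((emp_dist M \<theta> ts i)\<^sup>2 - bonus x (visit_count ts i))"

text \<open>The vertices of the cube dual to the L1 unit ball: an L1 norm is the maximum of the
  linear functionals with these coefficients.\<close>

definition signs :: "mdp \<Rightarrow> (nat \<Rightarrow> real) set" where
  "signs M = (\<Pi>\<^sub>E s\<in>states M. {-1, 1})"

text \<open>The total of the bonuses met so far, each taken at the count before the visit. It
  depends on the counts alone and so can be bounded on every path.\<close>

definition potential :: "mdp \<Rightarrow> real \<Rightarrow> traj list \<Rightarrow> real" where
  "potential M x ts = (\<Sum>i\<in>triples M. \<Sum>n<visit_count ts i. bonus x n)"

lemma bonus_nonneg: "0 \<le> x \<Longrightarrow> 0 \<le> bonus x n"
  by (simp add: bonus_def)

lemma excess_nonneg: "0 \<le> excess M x \<theta> ts i"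
  by (simp add: excess_def)

text \<open>Triangle inequality through the empirical distribution of the common data
  \<open>ts\<close>, then \<open>(a + b)\<^sup>2 \<le> 2 * a\<^sup>2 + 2 * b\<^sup>2\<close>. A
  squared distance is at most bonus plus excess by the definition of \<open>excess\<close>; the
  bonus is the same for both kernels and so gets the factor 4.\<close>

lemma kernel_dist_sq_le:
  "(kernel_dist M \<theta> \<theta>' i)\<^sup>2
    \<le> 4 * bonus x (visit_count ts i) + 2 * excess M x \<theta> ts i + 2 * excess M x \<theta>' ts i"
proof -
  define p where "p = (\<lambda>s'. real (trans_count ts i s') / real (visit_count ts i))"
  have "kernel_dist M \<theta> \<theta>' i
      \<le> (\<Sum>s'\<in>states M. \<bar>p s' - pmf (\<theta> i) s'\<bar> + \<bar>p s' - pmf (\<theta>' i) s'\<bar>)"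
    unfolding kernel_dist_def by (intro sum_mono) auto
  then have "kernel_dist M \<theta> \<theta>' i \<le> emp_dist M \<theta> ts i + emp_dist M \<theta>' ts i"
    by (simp add: sum.distrib emp_dist_def p_def)
  then have "(kernel_dist M \<theta> \<theta>' i)\<^sup>2 \<le> (emp_dist M \<theta> ts i + emp_dist M \<theta>' ts i)\<^sup>2"
    by (intro power_mono) (auto simp: kernel_dist_def sum_nonneg)
  also have "\<dots> \<le> 2 * (emp_dist M \<theta> ts i)\<^sup>2 + 2 * (emp_dist M \<theta>' ts i)\<^sup>2"
    using zero_le_power2[of "emp_dist M \<theta> ts i - emp_dist M \<theta>' ts i"]
    by (simp add: power2_sum power2_diff)
  also have "\<dots> \<le> 2 * (bonus x (visit_count ts i) + excess M x \<theta> ts i)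
      + 2 * (bonus x (visit_count ts i) + excess M x \<theta>' ts i)"
    unfolding excess_def by (intro add_mono mult_left_mono) auto
  finally show ?thesis by simp
qed

lemma harmonic_sum_le: "1 \<le> T \<Longrightarrow> k \<le> T \<Longrightarrow> (\<Sum>n=1..<k. 1 / real n) \<le> 1 + ln (real T)"
proof -
  assume T: "1 \<le> T" "k \<le> T"
  have "(\<Sum>n=1..<Suc m. 1 / real n) \<le> 1 + ln (real m)" if "1 \<le> m" for m
    using that
  proof (induction m rule: dec_induct)
    case base
    then show ?case by simp
  next
    case (step m)
    have "1 / real (Suc m) \<le> ln (real (Suc m)) - ln (real m)"
      using ln_le_minus_one[of "real m / real (Suc m)"] step
      by (simp add: ln_div field_simps)
    with step show ?case by simp
  qed
  note * = this
  have "(\<Sum>n=1..<k. 1 / real n) \<le> (\<Sum>n=1..<Suc T. 1 / real n)"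
    using T by (intro sum_mono2) auto
  with *[OF T(1)] show ?thesis by linarith
qed

lemma sum_bonus_le:
  assumes "1 \<le> T" "k \<le> T" "0 \<le> x"
  shows "(\<Sum>n<k. bonus x n) \<le> 4 + x * (1 + ln (real T))"
proof (cases k)
  case 0
  then show ?thesis using assms by simp
next
  case (Suc m)
  have "(\<Sum>n<k. bonus x n) = 4 + (\<Sum>n=1..<k. bonus x n)"
    using Suc by (simp add: lessThan_atLeast0 sum.atLeast_Suc_lessThan bonus_def)
  also have "(\<Sum>n=1..<k. bonus x n) = x * (\<Sum>n=1..<k. 1 / real n)"
    by (simp add: sum_distrib_left bonus_def)
  also have "\<dots> \<le> x * (1 + ln (real T))"
    using harmonic_sum_le[OF assms(1,2)] assms(3) by (intro mult_left_mono) auto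
  finally show ?thesis by simp
qed

lemma visit_count_le: "visit_count ts i \<le> length ts"
  by (simp add: visit_count_def)

context finite_mdp
begin

section \<open>Whole episodes, started from the initial distribution\<close>

lemma set_episode:
  assumes "\<theta> \<in> kernels M" "valid_policy M \<psi>"
  shows "set_pmf (episode M \<theta> \<psi>) \<subseteq> trajs M H"
  using set_rollout[OF assms, of 0 H] set_init by (fastforce simp: episode_def set_bind_pmf)

lemma finite_set_episode:
  assumes "\<theta> \<in> kernels M" "valid_policy M \<psi>"
  shows "finite (set_pmf (episode M \<theta> \<psi>))"
  using set_episode[OF assms] finite_subset by blast

lemma expect_episode:
  assumes "\<theta> \<in> kernels M" "valid_policy M \<psi>"
  shows "expect (episode M \<theta> \<psi>) F = (\<Sum>s\<in>S. pmf (init M) s * expect (rollout \<theta> \<psi> 0 H s) F)"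
  unfolding episode_def using finite_set_rollout[OF assms] set_init
  by (subst pmf_expectation_bind[where A = S]) auto

lemma measurable_expect_episode:
  assumes F: "\<And>\<tau>. (\<lambda>x. F x \<tau>) \<in> borel_measurable N"
    and \<theta>: "\<And>x. x \<in> space N \<Longrightarrow> \<theta> x \<in> kernels M"
      "\<And>i s'. i \<in> triples M \<Longrightarrow> (\<lambda>x. pmf (\<theta> x i) s') \<in> borel_measurable N"
    and \<psi>: "\<And>x. x \<in> space N \<Longrightarrow> valid_policy M (\<psi> x)"
      "\<And>h s a. h < H \<Longrightarrow> s \<in> S \<Longrightarrow> a \<in> A \<Longrightarrow> (\<lambda>x. pmf (\<psi> x h s) a) \<in> borel_measurable N"
  shows "(\<lambda>x. expect (episode M (\<theta> x) (\<psi> x)) (F x)) \<in> borel_measurable N"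
proof -
  have [measurable]: "(\<lambda>x. expect (rollout (\<theta> x) (\<psi> x) 0 H s) (F x)) \<in> borel_measurable N" if "s \<in> S" for s
    using that by (intro measurable_expect_rollout F \<theta> \<psi>) auto
  show ?thesis by (subst measurable_cong[OF expect_episode[OF \<theta>(1) \<psi>(1)]]) auto
qed

lemma expect_mgf_factor_episode:
  assumes "\<theta> \<in> kernels M" "valid_policy M \<psi>" "i \<in> triples M"
    "\<And>x. x \<in> S \<Longrightarrow> \<bar>g x\<bar> \<le> 1" "0 \<le> l"
  shows "expect (episode M \<theta> \<psi>) (mgf_factor \<theta> i g l 0) \<le> 1"
proof -
  have "expect (episode M \<theta> \<psi>) (mgf_factor \<theta> i g l 0) \<le> (\<Sum>s\<in>S. pmf (init M) s * 1)"
    unfolding expect_episode[OF assms(1,2)]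
    by (intro sum_mono mult_left_mono expect_mgf_factor_rollout assms) auto
  then show ?thesis using sum_pmf_eq_1[OF _ set_init] by simp
qed

lemma total_reward_eq: "\<tau> \<in> trajs M H \<Longrightarrow> total_reward M \<tau> = reward_from M 0 \<tau>"
  by (auto simp: total_reward_def reward_from_def step_sum_def trajs_def case_prod_beta)

lemma init_state_eq: "\<tau> \<in> trajs M H \<Longrightarrow> init_state \<tau> = traj_state \<tau> 0"
  using horizon_pos by (auto simp: init_state_def traj_state_def trajs_def simp del: horizon_pos)

lemma expect_regret_episode:
  assumes "\<theta> \<in> kernels M" "\<pi> \<in> policies M"
  shows "expect (episode M \<theta> (det_policy \<pi>)) (\<lambda>\<tau>. V (init_state \<tau>) - total_reward M \<tau>)
    = (\<Sum>s\<in>S. pmf (init M) s * (V s - policy_value M \<theta> \<pi> s))"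
proof -
  note v = valid_det_policy[OF assms(2)]
  have "expect (rollout \<theta> (det_policy \<pi>) 0 H s) (\<lambda>\<tau>. V (init_state \<tau>) - total_reward M \<tau>)
      = V s - policy_value M \<theta> \<pi> s" if "s \<in> S" for s
  proof -
    have "expect (rollout \<theta> (det_policy \<pi>) 0 H s) (\<lambda>\<tau>. V (init_state \<tau>) - total_reward M \<tau>)
      = expect (rollout \<theta> (det_policy \<pi>) 0 H s) (\<lambda>\<tau>. V s - total_reward M \<tau>)"
      using set_rollout[OF assms(1) v, of 0 H s] that
      by (intro expect_cong) (auto simp: init_state_eq traj_state_rollout)
    also have "\<dots> = V s - policy_value M \<theta> \<pi> s"
      using finite_set_rollout[OF assms(1) v, of 0 H s] that
      by (simp add: expect_diff policy_value_def)
    finally show ?thesis .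
  qed
  then show ?thesis by (simp add: expect_episode[OF assms(1) v])
qed

lemma policy_value_difference:
  assumes \<theta>: "\<theta> \<in> kernels M" "\<theta>' \<in> kernels M" and \<pi>: "\<pi> \<in> policies M"
  shows "(\<Sum>s\<in>S. pmf (init M) s * policy_value M \<theta>' \<pi> s)
      - (\<Sum>s\<in>S. pmf (init M) s * policy_value M \<theta> \<pi> s)
    \<le> expect (episode M \<theta> (det_policy \<pi>)) (\<lambda>\<tau>. real H * step_sum (kernel_dist M \<theta> \<theta>') 0 (fst \<tau>))"
proof -
  note v = valid_det_policy[OF \<pi>]
  have pv: "policy_value M \<kappa> \<pi> s = expect (rollout \<kappa> (det_policy \<pi>) 0 H s) (reward_from M 0)"
    if "\<kappa> \<in> kernels M" "s \<in> S" for \<kappa> s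
    unfolding policy_value_def using set_rollout[OF that(1) v, of 0 H s] that(2)
    by (intro expect_cong) (auto intro!: total_reward_eq)
  show ?thesis
    unfolding expect_episode[OF \<theta>(1) v] sum_subtractf[symmetric] right_diff_distrib[symmetric]
    using value_difference[OF \<theta> v, of 0 H] \<theta>
    by (intro sum_mono mult_left_mono) (simp_all add: pv)
qed

text \<open>Exactly one triple is visited per period. The sum over triples is the form that can be
  compared with visit counts.\<close>

lemma step_sum_eq_sum_visits:
  assumes "\<tau> \<in> trajs M H"
  shows "step_sum f 0 (fst \<tau>) = (\<Sum>i\<in>triples M. if visits 0 i \<tau> then f i else 0)"
proof -
  have len: "length (fst \<tau>) = H" and set: "set (fst \<tau>) \<subseteq> S \<times> A"
    using assms by (auto simp: trajs_def)
  have "(\<Sum>i\<in>triples M. if visits 0 i \<tau> then f i else 0)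
      = (\<Sum>h<H. \<Sum>p\<in>S \<times> A. if visits 0 (h, p) \<tau> then f (h, p) else 0)"
    unfolding triples_def by (simp add: sum.cartesian_product)
  also have "\<dots> = (\<Sum>h<H. f (h, fst \<tau> ! h))"
  proof (intro sum.cong refl)
    fix h assume "h \<in> {..<H}"
    then have h: "h < length (fst \<tau>)" using len by simp
    have "(\<Sum>p\<in>S \<times> A. if visits 0 (h, p) \<tau> then f (h, p) else 0)
        = (\<Sum>p\<in>S \<times> A. if p = fst \<tau> ! h then f (h, p) else 0)"
      using h by (intro sum.cong) (auto simp: visits_def)
    also have "\<dots> = f (h, fst \<tau> ! h)"
      using nth_mem[OF h] set by (subst sum.delta) auto
    finally show "(\<Sum>p\<in>S \<times> A. if visits 0 (h, p) \<tau> then f (h, p) else 0) = f (h, fst \<tau> ! h)" .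
  qed
  finally show ?thesis by (simp add: step_sum_def len)
qed

lemma step_sum_le_sum:
  assumes "\<tau> \<in> trajs M H" "\<And>i. 0 \<le> f i"
  shows "step_sum f 0 (fst \<tau>) \<le> (\<Sum>i\<in>triples M. f i)"
  unfolding step_sum_eq_sum_visits[OF assms(1)] using assms(2) by (intro sum_mono) auto

text \<open>Cauchy-Schwarz over the \<open>H\<close> periods.\<close>

lemma step_sum_squared:
  assumes "\<tau> \<in> trajs M H"
  shows "(step_sum f 0 (fst \<tau>))\<^sup>2 \<le> real H * step_sum (\<lambda>i. (f i)\<^sup>2) 0 (fst \<tau>)"
proof -
  have len: "length (fst \<tau>) = H" using assms by (auto simp: trajs_def)
  show ?thesis
    using sum_squared_le_sum_of_squares[of "\<lambda>j. f (0 + j, fst (fst \<tau> ! j), snd (fst \<tau> ! j))" "{..<H}"]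
    by (simp add: step_sum_def len mult.commute)
qed

text \<open>A triple is visited at most once in an episode, so each inner sum gains at most one
  term, and this term is the bonus at the count before the episode. Hence nothing is lost by
  updating the counts only between episodes.\<close>

lemma potential_append:
  assumes "\<tau> \<in> trajs M H"
  shows "potential M x (ts @ [\<tau>]) = potential M x ts + step_sum (\<lambda>i. bonus x (visit_count ts i)) 0 (fst \<tau>)"
  unfolding step_sum_eq_sum_visits[OF assms] potential_def sum.distrib[symmetric]
  by (intro sum.cong) (auto simp: visit_count_def)

lemma potential_le:
  assumes "1 \<le> T" "length ts \<le> T" "0 \<le> x"
  shows "potential M x ts \<le> real (card (triples M)) * (4 + x * (1 + ln (real T)))"
proof -
  have "visit_count ts i \<le> T" for i using visit_count_le[of ts i] assms(2) by linarith
  then have "potential M x ts \<le> (\<Sum>i\<in>triples M. 4 + x * (1 + ln (real T)))"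
    unfolding potential_def by (intro sum_mono sum_bonus_le assms) auto
  then show ?thesis by simp
qed

lemma traj_state_in:
  assumes "\<tau> \<in> trajs M H"
  shows "traj_state \<tau> k \<in> S"
proof -
  have "fst (fst \<tau> ! k) \<in> S" if "k < length (fst \<tau>)"
    using nth_mem[OF that] assms by (auto simp: trajs_def)
  then show ?thesis using assms by (auto simp: traj_state_def trajs_def)
qed

section \<open>Empirical counts and the pathwise deviation bound\<close>

lemma trans_count_Cons:
  "trans_count (\<tau> # ts) i s' =
    (if visits 0 i \<tau> then of_bool (s' = traj_state \<tau> (Suc (fst i))) else 0) + trans_count ts i s'"
  by (auto simp: trans_count_def)

lemma visit_count_Cons: "visit_count (\<tau> # ts) i = of_bool (visits 0 i \<tau>) + visit_count ts i"
  by (simp add: visit_count_def)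

lemma sum_trans_count:
  assumes "set ts \<subseteq> trajs M H"
  shows "(\<Sum>s'\<in>S. g s' * real (trans_count ts i s'))
    = (\<Sum>\<tau>\<leftarrow>filter (visits 0 i) ts. g (traj_state \<tau> (Suc (fst i))))"
  using assms
proof (induction ts)
  case Nil
  then show ?case by (simp add: trans_count_def)
next
  case (Cons \<tau> ts)
  then show ?case
    by (auto simp: trans_count_Cons distrib_left sum.distrib traj_state_in of_bool_def
        if_distrib[of "\<lambda>y. _ * real y"] cong: if_cong)
qed

text \<open>Trajectories without a visit contribute the factor 1, so the product is a function of
  the counts. This links the supermartingale to the empirical distribution.\<close>

lemma prod_mgf_factor:
  assumes "set ts \<subseteq> trajs M H"
  shows "prod_list (map (mgf_factor \<theta> i g l 0) ts)
    = exp (l * ((\<Sum>s'\<in>S. g s' * real (trans_count ts i s')) - real (visit_count ts i) * expect (\<theta> i) g)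
         - real (visit_count ts i) * (l\<^sup>2 / 2))"
  unfolding sum_trans_count[OF assms]
proof (induction ts)
  case Nil
  then show ?case by (simp add: visit_count_def)
next
  case (Cons \<tau> ts)
  show ?case
    unfolding list.map prod_list.Cons Cons.IH
    by (auto simp: mgf_factor_def visit_count_Cons exp_add[symmetric] algebra_simps)
qed

lemma emp_dist_le_2:
  assumes "\<theta> \<in> kernels M" "i \<in> triples M" "set ts \<subseteq> trajs M H"
  shows "emp_dist M \<theta> ts i \<le> 2"
proof -
  have "(\<Sum>s'\<in>S. real (trans_count ts i s')) = real (visit_count ts i)"
    using sum_trans_count[OF assms(3), of "\<lambda>_. 1" i] by (simp add: sum_list_triv visit_count_def)
  \<comment> \<open>Not an equality: without visits all the quotients are 0.\<close>
  then have 1: "(\<Sum>s'\<in>S. real (trans_count ts i s') / real (visit_count ts i)) \<le> 1"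
    by (simp add: sum_divide_distrib[symmetric])
  have "emp_dist M \<theta> ts i
      \<le> (\<Sum>s'\<in>S. real (trans_count ts i s') / real (visit_count ts i) + pmf (\<theta> i) s')"
    unfolding emp_dist_def by (intro sum_mono) (auto simp: abs_le_iff add_increasing add_increasing2)
  also have "\<dots> \<le> 1 + 1"
    unfolding sum.distrib using 1 sum_kernel[OF assms(1,2)] by (intro add_mono) auto
  finally show ?thesis by simp
qed

lemma card_signs: "card (signs M) = 2 ^ card S" and finite_signs [simp, intro]: "finite (signs M)"
  unfolding signs_def by (auto simp: card_PiE numeral_2_eq_2 intro!: finite_PiE)

text \<open>The signs of the deviations turn the L1 distance into a linear functional, for which
  exponential moments are available. They depend on the data, so all of \<open>signs M\<close> has
  to be covered later.\<close>

lemma emp_dist_eq_sign: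
  assumes "\<theta> \<in> kernels M" "i \<in> triples M" "visit_count ts i > 0"
  obtains \<sigma> where "\<sigma> \<in> signs M"
    "(\<Sum>s'\<in>S. \<sigma> s' * real (trans_count ts i s')) - real (visit_count ts i) * expect (\<theta> i) \<sigma>
      = real (visit_count ts i) * emp_dist M \<theta> ts i"
proof -
  define N where "N = real (visit_count ts i)"
  define d where "d = (\<lambda>s'. real (trans_count ts i s') / N - pmf (\<theta> i) s')"
  define \<sigma> where "\<sigma> = (\<lambda>s'\<in>S. if 0 \<le> d s' then 1 else -1 :: real)"
  have N: "N > 0" using assms by (simp add: N_def)
  have "(\<Sum>s'\<in>S. \<sigma> s' * real (trans_count ts i s')) - N * expect (\<theta> i) \<sigma>
      = (\<Sum>s'\<in>S. N * (\<sigma> s' * d s'))"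
    using N set_kernel[OF assms(1,2)]
    by (simp add: expect_finite[of S] sum_distrib_left sum_subtractf[symmetric] d_def algebra_simps)
  also have "\<dots> = N * emp_dist M \<theta> ts i"
    unfolding emp_dist_def sum_distrib_left N_def[symmetric]
    by (intro sum.cong) (auto simp: \<sigma>_def d_def)
  finally show thesis
    by (intro that[of \<sigma>]) (auto simp: \<sigma>_def signs_def N_def)
qed

text \<open>Markov's inequality on each path: the excess is at most 4, and when it is positive one
  of the products is at least \<open>exp (x / 2)\<close>. The visit count and the sign vector are
  random, whereas each product in the sum has a fixed sign vector and a fixed \<open>l\<close>;
  hence the sum over all \<open>T * 2 ^ card S\<close> candidates.\<close>

lemma excess_le:
  assumes \<theta>: "\<theta> \<in> kernels M" and i: "i \<in> triples M" and ts: "set ts \<subseteq> trajs M H" "length ts \<le> T"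
    and x: "0 \<le> x"
  shows "excess M x \<theta> ts i \<le> 4 * exp (- x / 2) *
    (\<Sum>n=1..T. \<Sum>\<sigma>\<in>signs M. prod_list (map (mgf_factor \<theta> i \<sigma> (sqrt (x / real n)) 0) ts))"
    (is "_ \<le> 4 * _ * ?R")
proof -
  have mgf_pos: "0 \<le> mgf_factor \<theta> i \<sigma> l 0 \<tau>" for \<sigma> l \<tau>
    by (simp add: mgf_factor_def)
  then have prod_pos: "0 \<le> prod_list (map (mgf_factor \<theta> i \<sigma> l 0) ts)" for \<sigma> l
    by (intro prod_list_nonneg) auto
  then have R: "0 \<le> ?R" by (intro sum_nonneg)
  have d: "0 \<le> emp_dist M \<theta> ts i" by (simp add: emp_dist_def sum_nonneg)
  have d2: "(emp_dist M \<theta> ts i)\<^sup>2 \<le> 4"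
    using power_mono[OF emp_dist_le_2[OF \<theta> i ts(1)] d, of 2] by simp
  show ?thesis
  proof (cases "(emp_dist M \<theta> ts i)\<^sup>2 \<le> bonus x (visit_count ts i)")
    case True
    with R show ?thesis by (simp add: excess_def)
  next
    case False
    define n where "n = visit_count ts i"
    \<comment> \<open>A squared distance is at most 4, the value of \<open>bonus x 0\<close>, so a
      positive excess needs a visit.\<close>
    have n: "n > 0" using False d2 by (auto simp: bonus_def n_def split: if_splits)
    have nT: "n \<le> T" using visit_count_le[of ts i] ts(2) by (simp add: n_def)
    obtain \<sigma> where \<sigma>: "\<sigma> \<in> signs M"
      "(\<Sum>s'\<in>S. \<sigma> s' * real (trans_count ts i s')) - real n * expect (\<theta> i) \<sigma> = real n * emp_dist M \<theta> ts i"
      using emp_dist_eq_sign[OF \<theta> i] n unfolding n_def by metis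
    \<comment> \<open>For a deviation \<open>d\<close> equal to the threshold
      \<open>sqrt (x / real n)\<close> this \<open>l\<close> maximises the exponent
      \<open>real n * (l * d - l\<^sup>2 / 2)\<close>, with value \<open>x / 2\<close>.\<close>
    define l where "l = sqrt (x / real n)"
    have l: "0 \<le> l" "l\<^sup>2 = x / real n" using x by (auto simp: l_def)
    have "l\<^sup>2 \<le> (emp_dist M \<theta> ts i)\<^sup>2" using False n by (simp add: bonus_def l n_def)
    then have "l \<le> emp_dist M \<theta> ts i" using d by (rule power2_le_imp_le)
    then have "l * (real n * l) \<le> l * (real n * emp_dist M \<theta> ts i)"
      using l by (intro mult_left_mono) auto
    moreover have "l * (real n * l) = x" using l n by (simp add: power2_eq_square field_simps)
    ultimately have "x / 2 \<le> l * (real n * emp_dist M \<theta> ts i) - real n * (l\<^sup>2 / 2)"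
      using n by (simp add: l)
    then have "exp (x / 2) \<le> prod_list (map (mgf_factor \<theta> i \<sigma> l 0) ts)"
      by (simp add: prod_mgf_factor[OF ts(1)] \<sigma>(2)[unfolded n_def] n_def)
    also have "\<dots> \<le> (\<Sum>\<sigma>\<in>signs M. prod_list (map (mgf_factor \<theta> i \<sigma> l 0) ts))"
      using \<sigma>(1) prod_pos by (intro member_le_sum) auto
    also have "\<dots> \<le> ?R"
      unfolding l_def using n nT prod_pos
      by (intro member_le_sum[where f = "\<lambda>n. \<Sum>\<sigma>\<in>signs M. prod_list (map (mgf_factor \<theta> i \<sigma> (sqrt (x / real n)) 0) ts)"])
         (auto intro!: sum_nonneg)
    finally have "1 \<le> exp (- x / 2) * ?R"
      by (simp add: exp_minus field_simps)
    moreover have "excess M x \<theta> ts i \<le> 4"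
      using d2 bonus_nonneg[OF x, of "visit_count ts i"] by (simp add: excess_def)
    ultimately show ?thesis by simp
  qed
qed

end

subsection \<open>Measurability and posteriors\<close>

type_synonym observation = "traj list \<times> traj list"

text \<open>With a fixed finite support, measurability into the space of measures comes down to
  finitely many point masses.\<close>

lemma measurable_pmf_kernel:
  assumes F: "finite F" "\<And>x. x \<in> space N \<Longrightarrow> set_pmf (K x) \<subseteq> F"
    and K: "\<And>y. y \<in> F \<Longrightarrow> (\<lambda>x. pmf (K x) y) \<in> borel_measurable N"
  shows "(\<lambda>x. measure_pmf (K x)) \<in> measurable N (subprob_algebra (count_space UNIV))"
proof (rule measurable_subprob_algebra)
  fix B
  have eq: "emeasure (measure_pmf (K x)) B = (\<Sum>y\<in>F. indicator B y * ennreal (pmf (K x) y))"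
    if "x \<in> space N" for x
    using F(2)[OF that] nn_integral_measure_pmf_support[OF F(1), of "indicator B" "K x"] by auto
  have [measurable]: "(\<lambda>x. ennreal (pmf (K x) y)) \<in> borel_measurable N" if "y \<in> F" for y
    using K[OF that] by measurable
  have "(\<lambda>x. \<Sum>y\<in>F. indicator B y * ennreal (pmf (K x) y)) \<in> borel_measurable N"
    by (intro borel_measurable_sum borel_measurable_times_ennreal borel_measurable_const
        measurable_compose[OF K measurable_ennreal])
  then show "(\<lambda>x. emeasure (measure_pmf (K x)) B) \<in> borel_measurable N"
    by (subst measurable_cong[OF eq])
qed (auto simp: subprob_space_measure_pmf)

text \<open>Used from right to left: point masses become expectations, so that the measurability of
  expectations covers them.\<close>

lemma expect_indicator: "expect p (indicator {x}) = pmf p x"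
  by (simp add: measure_pmf_single)

lemma measurable_pmf_pmf_space: "(\<lambda>p. pmf p x) \<in> borel_measurable pmf_space"
proof -
  have 1: "measure_pmf \<in> measurable pmf_space (subprob_algebra (count_space UNIV))"
    unfolding pmf_space_def
    by (intro measurable_vimage_algebra1) (auto simp: space_subprob_algebra subprob_space_measure_pmf)
  have 2: "(\<lambda>N. measure N {x}) \<in> borel_measurable (subprob_algebra (count_space UNIV))"
    by (rule measurable_measure_subprob_algebra) simp
  show ?thesis
    using measurable_compose[OF 1 2] by (simp add: measure_pmf_single)
qed

lemma replicate_pmf_Suc_pair: "replicate_pmf (Suc n) p = map_pmf (\<lambda>(x, xs). x # xs) (pair_pmf p (replicate_pmf n p))"
  by (simp add: pair_pmf_def map_bind_pmf bind_assoc_pmf bind_return_pmf map_pmf_def)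

lemma pmf_replicate_pmf:
  "pmf (replicate_pmf n p) xs = (if length xs = n then prod_list (map (pmf p) xs) else 0)"
proof (induction n arbitrary: xs)
  case 0
  then show ?case by (auto simp: indicator_def)
next
  case (Suc n)
  show ?case
  proof (cases xs)
    case Nil
    have "[] \<notin> set_pmf (replicate_pmf (Suc n) p)" unfolding set_replicate_pmf by simp
    then show ?thesis using Nil by (simp add: set_pmf_iff del: replicate_pmf.simps)
  next
    case (Cons y ys)
    have "pmf (replicate_pmf (Suc n) p) (case (y, ys) of (x, xs) \<Rightarrow> x # xs)
        = pmf (pair_pmf p (replicate_pmf n p)) (y, ys)"
      unfolding replicate_pmf_Suc_pair by (intro pmf_map_inj') (auto simp: inj_def)
    then show ?thesis by (simp add: Cons Suc.IH pmf_pair del: replicate_pmf.simps)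
  qed
qed

locale bayes_mdp = finite_mdp M for M +
  fixes \<Theta> :: "kernel set" and \<mu>0 :: "kernel measure" and pistar :: "kernel \<Rightarrow> policy"
    and \<beta> :: real and L :: nat
  assumes \<Theta>: "\<Theta> \<subseteq> kernels M"
    and prior: "is_prior M \<Theta> \<mu>0"
    and measurable_pistar [measurable]: "pistar \<in> measurable \<mu>0 (count_space (policies M))"
    and optimal: "\<And>\<theta>. \<theta> \<in> \<Theta> \<Longrightarrow> optimal_policy M \<theta> (pistar \<theta>)"
begin

sublocale prior: prob_space \<mu>0
  using prior by (simp add: is_prior_def)

lemma sets_prior: "sets \<mu>0 = sets (restrict_space (kernel_space M) \<Theta>)"
  using prior by (simp add: is_prior_def)

lemma space_prior [simp]: "space \<mu>0 = \<Theta>"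
proof -
  have "space (kernel_space M) = (\<Pi>\<^sub>E i\<in>triples M. UNIV)"
    by (simp add: kernel_space_def space_PiM pmf_space_def)
  moreover have "\<Theta> \<subseteq> (\<Pi>\<^sub>E i\<in>triples M. UNIV)"
    using \<Theta> by (auto simp: kernels_def PiE_iff)
  ultimately show ?thesis
    using sets_eq_imp_space_eq[OF sets_prior] by (auto simp: space_restrict_space)
qed

lemma in_kernels [simp]: "\<theta> \<in> \<Theta> \<Longrightarrow> \<theta> \<in> kernels M"
  using \<Theta> by auto

lemma pistar_in [simp]: "\<theta> \<in> \<Theta> \<Longrightarrow> pistar \<theta> \<in> policies M"
  using measurable_space[OF measurable_pistar, of \<theta>] by simp

lemma measurable_kernel [measurable]: "(\<lambda>\<theta>. pmf (\<theta> i) s') \<in> borel_measurable \<mu>0"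
proof (cases "i \<in> triples M")
  case True
  then have "(\<lambda>\<theta>. \<theta> i) \<in> measurable (kernel_space M) pmf_space"
    unfolding kernel_space_def by (rule measurable_component_singleton)
  from measurable_restrict_space1[OF measurable_compose[OF this measurable_pmf_pmf_space]]
  show ?thesis unfolding measurable_cong_sets[OF sets_prior refl] .
next
  case False
  \<comment> \<open>Kernels are extensional, hence constant in \<open>\<theta>\<close> outside the
    triples; this frees the lemma from a side condition on \<open>i\<close>.\<close>
  have "pmf (\<theta> i) s' = pmf undefined s'" if "\<theta> \<in> space \<mu>0" for \<theta>
    using that False PiE_arb[of \<theta> "triples M"] in_kernels[of \<theta>] by (simp add: kernels_def)
  then have "(\<lambda>\<theta>. pmf (\<theta> i) s') \<in> borel_measurable \<mu>0 \<longleftrightarrow> (\<lambda>_. pmf undefined s') \<in> borel_measurable \<mu>0"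
    by (rule measurable_cong)
  then show ?thesis by simp
qed

section \<open>Measurability in the kernel of optimal values, expert and offline data\<close>

lemma measurable_opt_V [measurable]: "(\<lambda>\<theta>. opt_V M \<theta> h s) \<in> borel_measurable \<mu>0"
  and measurable_opt_Q [measurable]: "(\<lambda>\<theta>. opt_Q M \<theta> h s a) \<in> borel_measurable \<mu>0"
proof -
  have Q: "(\<lambda>\<theta>. opt_Q M \<theta> h s a) \<in> borel_measurable \<mu>0"
    if "\<And>s. (\<lambda>\<theta>. opt_V M \<theta> (Suc h) s) \<in> borel_measurable \<mu>0" for h s a
    unfolding opt_Q.simps by (intro borel_measurable_add borel_measurable_sum borel_measurable_times
        measurable_kernel that borel_measurable_const)
  have V: "(\<lambda>\<theta>. opt_V M \<theta> h s) \<in> borel_measurable \<mu>0" for h s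
  proof (induction "H - h" arbitrary: h s)
    case 0
    then show ?case by (simp add: opt_V.simps)
  next
    case (Suc n)
    then have "(\<lambda>\<theta>. Max ((\<lambda>a. opt_Q M \<theta> h s a) ` A)) \<in> borel_measurable \<mu>0"
      by (intro borel_measurable_Max Q Suc.hyps(1)) auto
    then show ?case using Suc by (simp add: opt_V.simps)
  qed
  show "(\<lambda>\<theta>. opt_V M \<theta> h s) \<in> borel_measurable \<mu>0" by (rule V)
  show "(\<lambda>\<theta>. opt_Q M \<theta> h s a) \<in> borel_measurable \<mu>0" by (intro Q V)
qed

lemma pmf_expert:
  "pmf (expert M \<beta> \<theta> h s) a = (if a \<in> A
     then exp (\<beta> * opt_Q M \<theta> h s a) / (\<Sum>b\<in>A. exp (\<beta> * opt_Q M \<theta> h s b)) else 0)"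
  (is "_ = ?w a")
proof -
  have pos: "0 < (\<Sum>b\<in>A. exp (\<beta> * opt_Q M \<theta> h s b))"
    by (intro sum_pos) auto
  have nn: "0 \<le> ?w a" for a using pos by (auto intro!: divide_nonneg_pos)
  have "(\<integral>\<^sup>+a. ennreal (?w a) \<partial>count_space UNIV) = (\<integral>\<^sup>+a. ennreal (?w a) \<partial>count_space A)"
    by (subst nn_integral_count_space_indicator[of A])
       (auto intro!: nn_integral_cong simp: indicator_def)
  also have "\<dots> = (\<Sum>a\<in>A. ennreal (?w a))"
    by (rule nn_integral_count_space_finite) simp
  also have "\<dots> = ennreal (\<Sum>a\<in>A. ?w a)"
    by (rule sum_ennreal) (rule nn)
  also have "(\<Sum>a\<in>A. ?w a) = 1"
    using pos by (simp add: sum_divide_distrib[symmetric])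
  finally show ?thesis
    unfolding expert_def using nn by (subst pmf_embed_pmf) auto
qed

lemma valid_expert: "valid_policy M (expert M \<beta> \<theta>)"
  by (auto simp: valid_policy_def set_pmf_iff pmf_expert split: if_splits)

lemma measurable_expert: "(\<lambda>\<theta>. pmf (expert M \<beta> \<theta> h s) a) \<in> borel_measurable \<mu>0"
  unfolding pmf_expert by measurable

lemma measurable_expect_policy_episode:
  assumes "\<pi> \<in> policies M" "\<And>\<tau>. (\<lambda>\<theta>. F \<theta> \<tau>) \<in> borel_measurable \<mu>0"
  shows "(\<lambda>\<theta>. expect (episode M \<theta> (det_policy \<pi>)) (F \<theta>)) \<in> borel_measurable \<mu>0"
  by (intro measurable_expect_episode measurable_kernel valid_det_policy assms) auto

lemma measurable_policy_episode:
  assumes "\<pi> \<in> policies M"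
  shows "(\<lambda>\<theta>. pmf (episode M \<theta> (det_policy \<pi>)) \<tau>) \<in> borel_measurable \<mu>0"
  unfolding expect_indicator[symmetric] by (intro measurable_expect_policy_episode assms) auto

definition datasets :: "nat \<Rightarrow> traj list set" where
  "datasets n = {ts. set ts \<subseteq> trajs M H \<and> length ts = n}"

lemma finite_datasets [simp, intro]: "finite (datasets n)"
  unfolding datasets_def by (intro finite_lists_length_eq) auto

lemma set_offline: "\<theta> \<in> \<Theta> \<Longrightarrow> set_pmf (offline M \<beta> L \<theta>) \<subseteq> datasets L"
  using set_episode[OF in_kernels valid_expert, of \<theta> \<theta>]
  by (auto simp: offline_def set_replicate_pmf datasets_def)

lemma measurable_offline: "(\<lambda>\<theta>. pmf (offline M \<beta> L \<theta>) D) \<in> borel_measurable \<mu>0"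
proof -
  have *: "(\<lambda>\<theta>. pmf (episode M \<theta> (expert M \<beta> \<theta>)) \<tau>) \<in> borel_measurable \<mu>0" for \<tau>
    unfolding expect_indicator[symmetric]
    by (intro measurable_expect_episode measurable_kernel valid_expert measurable_expert) auto
  have "(\<lambda>\<theta>. prod_list (map (pmf (episode M \<theta> (expert M \<beta> \<theta>))) D)) \<in> borel_measurable \<mu>0"
    by (induction D) (auto intro!: borel_measurable_times *)
  then show ?thesis by (simp add: offline_def pmf_replicate_pmf)
qed

section \<open>Bayes' rule for an abstract likelihood\<close>

text \<open>The normalising constant of Bayes' rule. The likelihood \<open>K\<close> is a parameter
  because the law of the observations will itself be defined by recursion through
  \<open>post_policy\<close>.\<close>

definition evidence :: "(kernel \<Rightarrow> observation pmf) \<Rightarrow> observation \<Rightarrow> real" where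
  "evidence K y = (LINT \<theta>|\<mu>0. pmf (K \<theta>) y)"

definition post :: "(kernel \<Rightarrow> observation pmf) \<Rightarrow> observation \<Rightarrow> kernel measure" where
  "post K y = density \<mu>0 (\<lambda>\<theta>. ennreal (pmf (K \<theta>) y / evidence K y))"

text \<open>The law of the policy that a posterior sample selects. For data of evidence zero it is a
  fixed policy, which keeps the support inside \<open>policies M\<close>.\<close>

definition post_policy :: "(kernel \<Rightarrow> observation pmf) \<Rightarrow> observation \<Rightarrow> policy pmf" where
  "post_policy K y = (if 0 < evidence K y
     then embed_pmf (\<lambda>\<pi>. measure (post K y) {\<theta> \<in> \<Theta>. pistar \<theta> = \<pi>})
     else return_pmf (SOME \<pi>. \<pi> \<in> policies M))"

lemma evidence_nonneg: "0 \<le> evidence K y"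
  by (simp add: evidence_def)

lemma sets_post [measurable_cong, simp]: "sets (post K y) = sets \<mu>0"
  and space_post [simp]: "space (post K y) = \<Theta>"
  by (simp_all add: post_def)

lemma no_pistar: "\<pi> \<notin> policies M \<Longrightarrow> {\<theta> \<in> \<Theta>. pistar \<theta> = \<pi>} = {}"
  by auto

lemma policies_nonempty: "policies M \<noteq> {}"
  unfolding policies_def PiE_eq_empty_iff by simp

text \<open>With finitely many policies a function of \<open>pistar \<theta>\<close> is a simple
  function. The type of values is left general because both \<open>real\<close> and
  \<open>ennreal\<close> occur.\<close>

lemma pistar_expand:
  fixes g :: "policy \<Rightarrow> 'b :: semiring_1"
  assumes "\<theta> \<in> \<Theta>"
  shows "g (pistar \<theta>) = (\<Sum>\<pi>\<in>policies M. g \<pi> * indicator {\<theta> \<in> \<Theta>. pistar \<theta> = \<pi>} \<theta>)"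
proof -
  have "(\<Sum>\<pi>\<in>policies M. g \<pi> * indicator {\<theta> \<in> \<Theta>. pistar \<theta> = \<pi>} \<theta>)
      = (\<Sum>\<pi>\<in>policies M. if pistar \<theta> = \<pi> then g \<pi> else 0)"
    using assms by (intro sum.cong) (auto simp: indicator_def)
  then show ?thesis using assms by simp
qed

lemma measurable_pistar_eq [measurable]: "{\<theta> \<in> \<Theta>. pistar \<theta> = \<pi>} \<in> sets \<mu>0"
  by (simp flip: space_prior)

context
  fixes K :: "kernel \<Rightarrow> observation pmf"
  assumes K [measurable]: "\<And>y. (\<lambda>\<theta>. pmf (K \<theta>) y) \<in> borel_measurable \<mu>0"
begin

lemma integrable_likelihood: "integrable \<mu>0 (\<lambda>\<theta>. pmf (K \<theta>) y)"
  by (rule prior.integrable_const_bound[where B = 1]) (auto simp: pmf_le_1)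

lemma prob_space_post: "0 < evidence K y \<Longrightarrow> prob_space (post K y)"
proof
  assume pos: "0 < evidence K y"
  have "emeasure (post K y) (space (post K y)) = (\<integral>\<^sup>+\<theta>. ennreal (pmf (K \<theta>) y / evidence K y) \<partial>\<mu>0)"
    by (simp add: post_def emeasure_density flip: space_prior cong: nn_integral_cong)
  also have "\<dots> = ennreal (LINT \<theta>|\<mu>0. pmf (K \<theta>) y / evidence K y)"
    using pos integrable_likelihood by (intro nn_integral_eq_integral) auto
  also have "(LINT \<theta>|\<mu>0. pmf (K \<theta>) y / evidence K y) = 1"
    using pos by (simp add: evidence_def)
  finally show "emeasure (post K y) (space (post K y)) = 1" by simp
qed

lemma pmf_post_policy:
  assumes "0 < evidence K y"
  shows "pmf (post_policy K y) \<pi> = measure (post K y) {\<theta> \<in> \<Theta>. pistar \<theta> = \<pi>}"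
proof -
  interpret post: prob_space "post K y" by (rule prob_space_post[OF assms])
  have "(\<integral>\<^sup>+\<pi>. ennreal (measure (post K y) {\<theta> \<in> \<Theta>. pistar \<theta> = \<pi>}) \<partial>count_space UNIV)
      = (\<integral>\<^sup>+\<pi>. ennreal (measure (post K y) {\<theta> \<in> \<Theta>. pistar \<theta> = \<pi>}) \<partial>count_space (policies M))"
    by (subst nn_integral_count_space_indicator[of "policies M"])
       (auto intro!: nn_integral_cong simp: indicator_def no_pistar)
  also have "\<dots> = ennreal (\<Sum>\<pi>\<in>policies M. measure (post K y) {\<theta> \<in> \<Theta>. pistar \<theta> = \<pi>})"
    by (subst nn_integral_count_space_finite) (auto intro!: sum_ennreal)
  also have "(\<Sum>\<pi>\<in>policies M. measure (post K y) {\<theta> \<in> \<Theta>. pistar \<theta> = \<pi>})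
      = measure (post K y) (\<Union>\<pi>\<in>policies M. {\<theta> \<in> \<Theta>. pistar \<theta> = \<pi>})"
    by (intro post.finite_measure_finite_Union[symmetric])
       (auto simp: disjoint_family_on_def simp flip: space_prior)
  also have "(\<Union>\<pi>\<in>policies M. {\<theta> \<in> \<Theta>. pistar \<theta> = \<pi>}) = space (post K y)"
    by auto
  finally show ?thesis
    unfolding post_policy_def post.prob_space using assms by (simp add: pmf_embed_pmf)
qed

lemma set_post_policy: "set_pmf (post_policy K y) \<subseteq> policies M"
proof (cases "0 < evidence K y")
  case True
  have "pmf (post_policy K y) \<pi> = 0" if "\<pi> \<notin> policies M" for \<pi>
    using True that by (simp add: pmf_post_policy no_pistar)
  then show ?thesis unfolding set_pmf_iff subset_iff by blast
next
  case False
  then show ?thesis using some_in_eq[of "policies M"] policies_nonempty by (simp add: post_policy_def)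
qed

lemma nn_integral_post_policy:
  assumes "0 < evidence K y"
  shows "(\<integral>\<^sup>+\<theta>. g (pistar \<theta>) \<partial>post K y) = (\<integral>\<^sup>+\<pi>. g \<pi> \<partial>post_policy K y)"
proof -
  interpret post: prob_space "post K y" by (rule prob_space_post[OF assms])
  have "(\<integral>\<^sup>+\<theta>. g (pistar \<theta>) \<partial>post K y)
      = (\<integral>\<^sup>+\<theta>. (\<Sum>\<pi>\<in>policies M. g \<pi> * indicator {\<theta> \<in> \<Theta>. pistar \<theta> = \<pi>} \<theta>) \<partial>post K y)"
    by (intro nn_integral_cong pistar_expand) simp
  also have "\<dots> = (\<Sum>\<pi>\<in>policies M. g \<pi> * emeasure (post K y) {\<theta> \<in> \<Theta>. pistar \<theta> = \<pi>})"
    by (subst nn_integral_sum) (auto simp: nn_integral_cmult_indicator)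
  also have "\<dots> = (\<integral>\<^sup>+\<pi>. g \<pi> \<partial>post_policy K y)"
    using set_post_policy[of y]
    by (subst nn_integral_measure_pmf_support[where A = "policies M"])
       (auto simp: pmf_post_policy[OF assms] post.emeasure_eq_measure)
  finally show ?thesis .
qed

lemma expect_post_policy:
  assumes "0 < evidence K y"
  shows "(LINT \<theta>|post K y. g (pistar \<theta>)) = expect (post_policy K y) g"
proof -
  interpret post: prob_space "post K y" by (rule prob_space_post[OF assms])
  have "(LINT \<theta>|post K y. g (pistar \<theta>))
      = (LINT \<theta>|post K y. (\<Sum>\<pi>\<in>policies M. g \<pi> * indicator {\<theta> \<in> \<Theta>. pistar \<theta> = \<pi>} \<theta>))"
    by (intro Bochner_Integration.integral_cong pistar_expand) auto
  also have "\<dots> = (\<Sum>\<pi>\<in>policies M. g \<pi> * measure (post K y) {\<theta> \<in> \<Theta>. pistar \<theta> = \<pi>})"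
    by (subst Bochner_Integration.integral_sum)
       (auto intro!: integrable_mult_right integrable_real_indicator sum.cong arg_cong[where f = "measure (post K y)"]
         simp: post.emeasure_eq_measure)
  also have "\<dots> = expect (post_policy K y) g"
    using set_post_policy[of y]
    by (subst expect_finite[where A = "policies M"]) (auto simp: pmf_post_policy[OF assms] mult.commute)
  finally show ?thesis .
qed

text \<open>A nonnegative likelihood with integral zero vanishes almost everywhere, and there are
  only countably many observations. So neither the default case of \<open>post_policy\<close> nor
  the null posterior matters in any integral over the prior.\<close>

lemma AE_evidence_pos: "AE \<theta> in \<mu>0. \<forall>y\<in>set_pmf (K \<theta>). 0 < evidence K y"
proof -
  have "AE \<theta> in \<mu>0. y \<in> set_pmf (K \<theta>) \<longrightarrow> 0 < evidence K y" for y
  proof (cases "0 < evidence K y")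
    case False
    then have "(LINT \<theta>|\<mu>0. pmf (K \<theta>) y) = 0"
      using evidence_nonneg[of K y] by (simp only: evidence_def)
    then have "AE \<theta> in \<mu>0. pmf (K \<theta>) y = 0"
      using integrable_likelihood by (subst (asm) integral_nonneg_eq_0_iff_AE) auto
    then show ?thesis by eventually_elim (simp add: set_pmf_iff)
  qed simp
  then have "AE \<theta> in \<mu>0. \<forall>y. y \<in> set_pmf (K \<theta>) \<longrightarrow> 0 < evidence K y"
    by (subst AE_all_countable) auto
  then show ?thesis by eventually_elim auto
qed

end

end

subsection \<open>The law of the observations\<close>

context bayes_mdp
begin

text \<open>The law of the data given the true kernel. A sampled kernel acts only through its
  policy, and the posterior sees only the data; so the data satisfy a closed recursion in which
  sampled kernels and policies are integrated out.\<close>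

primrec obs_law :: "nat \<Rightarrow> kernel \<Rightarrow> observation pmf" where
  "obs_law 0 = (\<lambda>\<theta>. map_pmf (\<lambda>D. (D, [])) (offline M \<beta> L \<theta>))"
| "obs_law (Suc t) = (\<lambda>\<theta>. do {
     y \<leftarrow> obs_law t \<theta>;
     \<pi> \<leftarrow> post_policy (obs_law t) y;
     map_pmf (\<lambda>\<tau>. (fst y, snd y @ [\<tau>])) (episode M \<theta> (det_policy \<pi>))
   })"

definition obs :: "nat \<Rightarrow> observation set" where
  "obs t = datasets L \<times> datasets t"

lemma finite_obs [simp, intro]: "finite (obs t)"
  by (simp add: obs_def)

text \<open>Both parts go through one induction: measurability at \<open>t\<close> is what
  \<open>set_post_policy\<close> asks of a likelihood, and the finite supports turn the next law
  into finite sums, which are measurable.\<close>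

lemma obs_law_aux:
  "(\<forall>y. (\<lambda>\<theta>. pmf (obs_law t \<theta>) y) \<in> borel_measurable \<mu>0) \<and> (\<forall>\<theta>\<in>\<Theta>. set_pmf (obs_law t \<theta>) \<subseteq> obs t)"
proof (induction t)
  case 0
  have "pmf (map_pmf (\<lambda>D. (D, [])) (offline M \<beta> L \<theta>)) y
      = (if snd y = [] then pmf (offline M \<beta> L \<theta>) (fst y) else 0)" for \<theta> and y :: observation
  proof (cases "snd y = []")
    case True
    then have y: "y = (fst y, [])" by (cases y) auto
    have "inj (\<lambda>D :: traj list. (D, [] :: traj list))" by (auto simp: inj_def)
    from pmf_map_inj'[OF this, of "offline M \<beta> L \<theta>" "fst y"] show ?thesis
      using True by (subst y) simp
  next
    case False
    then have "y \<notin> set_pmf (map_pmf (\<lambda>D. (D, [])) (offline M \<beta> L \<theta>))" by auto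
    then have "pmf (map_pmf (\<lambda>D. (D, [])) (offline M \<beta> L \<theta>)) y = 0" by (simp only: set_pmf_iff not_not)
    then show ?thesis using False by simp
  qed
  then have "(\<lambda>\<theta>. pmf (obs_law 0 \<theta>) y) \<in> borel_measurable \<mu>0" for y
    using measurable_offline by simp
  moreover have "set_pmf (obs_law 0 \<theta>) \<subseteq> obs 0" if "\<theta> \<in> \<Theta>" for \<theta>
    using set_offline[OF that] by (auto simp: obs_def datasets_def)
  ultimately show ?case by blast
next
  case (Suc t)
  then have K: "(\<lambda>\<theta>. pmf (obs_law t \<theta>) y) \<in> borel_measurable \<mu>0"
    and set: "\<theta> \<in> \<Theta> \<Longrightarrow> set_pmf (obs_law t \<theta>) \<subseteq> obs t" for y \<theta>
    by blast+
  note pp = set_post_policy[of "obs_law t", OF K]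
  have set': "set_pmf (obs_law (Suc t) \<theta>) \<subseteq> obs (Suc t)" if "\<theta> \<in> \<Theta>" for \<theta>
  proof
    fix z assume "z \<in> set_pmf (obs_law (Suc t) \<theta>)"
    then obtain y \<pi> \<tau> where *: "y \<in> set_pmf (obs_law t \<theta>)" "\<pi> \<in> set_pmf (post_policy (obs_law t) y)"
      "\<tau> \<in> set_pmf (episode M \<theta> (det_policy \<pi>))" "z = (fst y, snd y @ [\<tau>])"
      by (auto simp: set_bind_pmf)
    have "\<pi> \<in> policies M" using pp *(2) by blast
    then have "\<tau> \<in> trajs M H"
      using set_episode[OF in_kernels[OF that] valid_det_policy[of \<pi>]] *(3) by auto
    moreover have "y \<in> obs t" using set[OF that] *(1) by blast
    ultimately show "z \<in> obs (Suc t)" using *(4) by (auto simp: obs_def datasets_def)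
  qed
  have "(\<lambda>\<theta>. pmf (obs_law (Suc t) \<theta>) z) \<in> borel_measurable \<mu>0" for z
  proof -
    have eq: "pmf (obs_law (Suc t) \<theta>) z = (\<Sum>y\<in>obs t. pmf (obs_law t \<theta>) y *
        (\<Sum>\<pi>\<in>policies M. pmf (post_policy (obs_law t) y) \<pi> *
          expect (episode M \<theta> (det_policy \<pi>)) (\<lambda>\<tau>. indicator {z} (fst y, snd y @ [\<tau>]))))" if "\<theta> \<in> \<Theta>" for \<theta>
    proof -
      have "pmf (map_pmf f p) z = expect p (\<lambda>\<tau>. indicator {z} (f \<tau>))" for f :: "traj \<Rightarrow> observation" and p
        by (simp only: expect_indicator[symmetric] integral_map_pmf)
      then show ?thesis
        using set[OF that] pp by (simp add: pmf_bind expect_finite[of "obs t"] expect_finite[of "policies M"])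
    qed
    have "(\<lambda>\<theta>. \<Sum>y\<in>obs t. pmf (obs_law t \<theta>) y *
        (\<Sum>\<pi>\<in>policies M. pmf (post_policy (obs_law t) y) \<pi> *
          expect (episode M \<theta> (det_policy \<pi>)) (\<lambda>\<tau>. indicator {z} (fst y, snd y @ [\<tau>])))) \<in> borel_measurable \<mu>0"
      by (intro borel_measurable_sum borel_measurable_times K measurable_expect_policy_episode) auto
    then show ?thesis by (subst measurable_cong[OF eq]) auto
  qed
  with set' show ?case by blast
qed

lemma measurable_obs_law [measurable]: "(\<lambda>\<theta>. pmf (obs_law t \<theta>) y) \<in> borel_measurable \<mu>0"
  and set_obs_law: "\<theta> \<in> \<Theta> \<Longrightarrow> set_pmf (obs_law t \<theta>) \<subseteq> obs t"
  using obs_law_aux[of t] by blast+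

lemma finite_set_obs_law: "\<theta> \<in> \<Theta> \<Longrightarrow> finite (set_pmf (obs_law t \<theta>))"
  using set_obs_law finite_subset by blast

lemma set_obs_policy: "set_pmf (post_policy (obs_law t) y) \<subseteq> policies M"
  by (rule set_post_policy) (rule measurable_obs_law)

lemma expect_obs_law_Suc:
  assumes \<theta>: "\<theta> \<in> \<Theta>"
  shows "expect (obs_law (Suc t) \<theta>) F = expect (obs_law t \<theta>) (\<lambda>y. expect (post_policy (obs_law t) y)
    (\<lambda>\<pi>. expect (episode M \<theta> (det_policy \<pi>)) (\<lambda>\<tau>. F (fst y, snd y @ [\<tau>]))))"
proof -
  have e: "finite (set_pmf (episode M \<theta> (det_policy \<pi>)))" if "\<pi> \<in> set_pmf (post_policy (obs_law t) y)" for y \<pi>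
    using finite_set_episode[OF in_kernels[OF \<theta>] valid_det_policy] set_obs_policy that by blast
  have p: "finite (set_pmf (post_policy (obs_law t) y))" for y
    using set_obs_policy finite_subset by blast
  have "expect (post_policy (obs_law t) y \<bind> (\<lambda>\<pi>. map_pmf (\<lambda>\<tau>. (fst y, snd y @ [\<tau>])) (episode M \<theta> (det_policy \<pi>)))) F
      = expect (post_policy (obs_law t) y) (\<lambda>\<pi>. expect (episode M \<theta> (det_policy \<pi>)) (\<lambda>\<tau>. F (fst y, snd y @ [\<tau>])))" for y
    by (subst expect_bind) (use e p in auto)
  then show ?thesis
    unfolding obs_law.simps using finite_set_obs_law[OF \<theta>]
    by (subst expect_bind) (use e p in \<open>auto simp: set_bind_pmf\<close>)
qed

section \<open>Outcomes and the measurability of one run\<close>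

abbreviation "OS \<equiv> outcome_space M \<mu>0"
abbreviation "RS \<equiv> (UNIV :: traj list set) \<times> lists (policies M \<times> (UNIV :: traj set))"

text \<open>Since the recorded part of an outcome takes countably many values, measurability in the
  outcome can be checked in the kernel for each fixed record.\<close>

lemma countable_RS: "countable RS"
  by (intro countable_SIGMA countable_lists) (auto simp: countable_finite)

lemma space_OS: "space OS = \<Theta> \<times> RS"
  by (simp add: outcome_space_def space_pair_measure)

lemma measurable_fst_OS [measurable]: "fst \<in> measurable OS \<mu>0"
  and measurable_snd_OS: "snd \<in> measurable OS (count_space RS)"
  by (simp_all add: outcome_space_def)

lemma measurable_observed [measurable]: "observed \<in> measurable OS (count_space UNIV)"
proof -
  have "(\<lambda>z. (fst z, map snd (snd z))) \<in> measurable (count_space RS) (count_space UNIV)"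
    by simp
  from measurable_compose[OF measurable_snd_OS this] show ?thesis
    by (simp add: observed_def case_prod_beta)
qed

lemma measurable_fst_observed: "(\<lambda>\<omega>. (fst \<omega>, observed \<omega>)) \<in> measurable OS (\<mu>0 \<Otimes>\<^sub>M count_space UNIV)"
  by measurable

lemma measurable_offline_kernel:
  "(\<lambda>\<theta>. measure_pmf (offline M \<beta> L \<theta>)) \<in> measurable \<mu>0 (subprob_algebra (count_space UNIV))"
  by (rule measurable_pmf_kernel[where F = "datasets L"]) (auto intro: measurable_offline set_offline[THEN subsetD])

lemma measurable_episode_kernel:
  assumes "\<pi> \<in> policies M"
  shows "(\<lambda>\<theta>. measure_pmf (episode M \<theta> (det_policy \<pi>))) \<in> measurable \<mu>0 (subprob_algebra (count_space UNIV))"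
  using set_episode[OF in_kernels valid_det_policy[OF assms]]
  by (intro measurable_pmf_kernel[where F = "trajs M H"] measurable_policy_episode assms) auto

lemma measurable_initial:
  "(\<lambda>\<theta>. distr (measure_pmf (offline M \<beta> L \<theta>)) OS (\<lambda>D. (\<theta>, D, []))) \<in> measurable \<mu>0 (subprob_algebra OS)"
proof (rule measurable_distr2[OF _ measurable_offline_kernel])
  have "(\<lambda>x. (snd x, [])) \<in> measurable (\<mu>0 \<Otimes>\<^sub>M count_space (UNIV :: traj list set)) (count_space RS)"
    by (rule measurable_compose[OF measurable_snd]) simp
  then show "(\<lambda>(\<theta>, D). (\<theta>, D, [])) \<in> measurable (\<mu>0 \<Otimes>\<^sub>M count_space UNIV) OS"
    unfolding outcome_space_def case_prod_beta by (intro measurable_Pair measurable_fst)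
qed

lemma measurable_run:
  assumes "\<pi> \<in> policies M" "(D, es) \<in> RS"
  shows "(\<lambda>\<theta>. distr (measure_pmf (episode M \<theta> (det_policy \<pi>))) OS (\<lambda>\<tau>. (\<theta>, D, es @ [(\<pi>, \<tau>)])))
    \<in> measurable \<mu>0 (subprob_algebra OS)"
proof (rule measurable_distr2[OF _ measurable_episode_kernel[OF assms(1)]])
  have "(\<lambda>x. (D, es @ [(\<pi>, snd x)])) \<in> measurable (\<mu>0 \<Otimes>\<^sub>M count_space (UNIV :: traj set)) (count_space RS)"
    by (rule measurable_compose[OF measurable_snd]) (use assms in auto)
  then show "(\<lambda>(\<theta>, \<tau>). (\<theta>, D, es @ [(\<pi>, \<tau>)])) \<in> measurable (\<mu>0 \<Otimes>\<^sub>M count_space UNIV) OS"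
    unfolding outcome_space_def case_prod_beta by (intro measurable_Pair measurable_fst)
qed

abbreviation run :: "kernel \<times> traj list \<times> (policy \<times> traj) list \<Rightarrow> kernel \<Rightarrow> outcome measure" where
  "run \<omega> \<theta>' \<equiv> (case \<omega> of (\<theta>, D, es) \<Rightarrow> distr (measure_pmf (episode M \<theta> (det_policy (pistar \<theta>')))) OS
     (\<lambda>\<tau>. (\<theta>, D, es @ [(pistar \<theta>', \<tau>)])))"

lemma measurable_run_pistar:
  assumes "(D, es) \<in> RS"
  shows "(\<lambda>x. run (fst x, D, es) (snd x)) \<in> measurable (\<mu>0 \<Otimes>\<^sub>M \<mu>0) (subprob_algebra OS)"
proof -
  define k where "k = (\<lambda>\<pi> \<theta>. distr (measure_pmf (episode M \<theta> (det_policy \<pi>))) OS (\<lambda>\<tau>. (\<theta>, D, es @ [(\<pi>, \<tau>)])))"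
  have "(\<lambda>x. k (pistar (snd x)) (fst x)) \<in> measurable (\<mu>0 \<Otimes>\<^sub>M \<mu>0) (subprob_algebra OS)"
  proof (rule measurable_compose_countable'[where I = "policies M" and g = "\<lambda>x. pistar (snd x)"
        and f = "\<lambda>\<pi> x. k \<pi> (fst x)"])
    show "(\<lambda>x. k \<pi> (fst x)) \<in> measurable (\<mu>0 \<Otimes>\<^sub>M \<mu>0) (subprob_algebra OS)" if "\<pi> \<in> policies M" for \<pi>
      unfolding k_def by (rule measurable_compose[OF measurable_fst measurable_run[OF that assms]])
    show "(\<lambda>x. pistar (snd x)) \<in> measurable (\<mu>0 \<Otimes>\<^sub>M \<mu>0) (count_space (policies M))"
      by (rule measurable_compose[OF measurable_snd measurable_pistar])
  qed (simp add: countable_finite)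
  then show ?thesis by (simp add: k_def)
qed

section \<open>One step of \<open>ipsrl\<close>, from a law \<open>J\<close> that agrees with
  \<open>obs_law t\<close>\<close>

context
  fixes t :: nat and J :: "outcome measure"
  assumes sets_J: "sets J = sets OS"
    and J: "\<And>f. f \<in> borel_measurable (\<mu>0 \<Otimes>\<^sub>M count_space UNIV) \<Longrightarrow>
      (\<integral>\<^sup>+\<omega>. f (fst \<omega>, observed \<omega>) \<partial>J) = (\<integral>\<^sup>+\<theta>. \<integral>\<^sup>+y. f (\<theta>, y) \<partial>obs_law t \<theta> \<partial>\<mu>0)"
begin

lemmas [measurable_cong] = sets_J

lemma space_J: "space J = \<Theta> \<times> RS"
  using sets_eq_imp_space_eq[OF sets_J] by (simp add: space_OS)

lemma measurable_fst_J [measurable]: "fst \<in> measurable J \<mu>0"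
  and measurable_observed_J [measurable]: "observed \<in> measurable J (count_space UNIV)"
  using measurable_fst_OS measurable_observed by (simp_all add: measurable_cong_sets[OF sets_J refl])

lemma emeasure_J_obs:
  assumes [measurable]: "B \<in> sets \<mu>0"
  shows "emeasure J {\<omega> \<in> space J. observed \<omega> = y \<and> fst \<omega> \<in> B}
    = (\<integral>\<^sup>+\<theta>. ennreal (pmf (obs_law t \<theta>) y) * indicator B \<theta> \<partial>\<mu>0)"
proof -
  have "emeasure J {\<omega> \<in> space J. observed \<omega> = y \<and> fst \<omega> \<in> B}
      = (\<integral>\<^sup>+\<omega>. indicator {\<omega> \<in> space J. observed \<omega> = y \<and> fst \<omega> \<in> B} \<omega> \<partial>J)"
    by (rule nn_integral_indicator[symmetric]) measurable
  also have "\<dots> = (\<integral>\<^sup>+\<omega>. indicator (B \<times> {y}) (fst \<omega>, observed \<omega>) \<partial>J)"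
    by (rule nn_integral_cong) (auto simp: indicator_def)
  also have "\<dots> = (\<integral>\<^sup>+\<theta>. \<integral>\<^sup>+z. indicator (B \<times> {y}) (\<theta>, z) \<partial>obs_law t \<theta> \<partial>\<mu>0)"
    by (rule J) measurable
  also have "\<dots> = (\<integral>\<^sup>+\<theta>. ennreal (pmf (obs_law t \<theta>) y) * indicator B \<theta> \<partial>\<mu>0)"
  proof (rule nn_integral_cong)
    fix \<theta>
    have "(\<integral>\<^sup>+z. indicator (B \<times> {y}) (\<theta>, z) \<partial>obs_law t \<theta>) = (\<integral>\<^sup>+z. indicator B \<theta> * indicator {y} z \<partial>obs_law t \<theta>)"
      by (auto intro!: nn_integral_cong simp: indicator_def)
    also have "\<dots> = ennreal (pmf (obs_law t \<theta>) y) * indicator B \<theta>"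
      by (subst nn_integral_cmult) (auto simp: emeasure_pmf_single mult.commute)
    finally show "(\<integral>\<^sup>+z. indicator (B \<times> {y}) (\<theta>, z) \<partial>obs_law t \<theta>) = ennreal (pmf (obs_law t \<theta>) y) * indicator B \<theta>" .
  qed
  finally show ?thesis .
qed

lemma prob_space_J: "prob_space J"
proof
  have "emeasure J (space J) = (\<integral>\<^sup>+\<omega>. (\<lambda>_. 1) (fst \<omega>, observed \<omega>) \<partial>J)" by simp
  also have "\<dots> = (\<integral>\<^sup>+\<theta>. \<integral>\<^sup>+y. (\<lambda>_. 1) (\<theta>, y) \<partial>obs_law t \<theta> \<partial>\<mu>0)" by (rule J) simp
  finally show "emeasure J (space J) = 1"
    using prior.emeasure_space_1 by (simp add: measure_pmf.emeasure_space_1)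
qed

lemma emeasure_J_observed: "emeasure J {\<omega> \<in> space J. observed \<omega> = y} = ennreal (evidence (obs_law t) y)"
proof -
  have "emeasure J {\<omega> \<in> space J. observed \<omega> = y} = emeasure J {\<omega> \<in> space J. observed \<omega> = y \<and> fst \<omega> \<in> \<Theta>}"
    by (intro arg_cong[where f = "emeasure J"]) (auto simp: space_J)
  also have "\<dots> = (\<integral>\<^sup>+\<theta>. ennreal (pmf (obs_law t \<theta>) y) \<partial>\<mu>0)"
    using sets.top[of \<mu>0] by (subst emeasure_J_obs) (auto intro!: nn_integral_cong)
  also have "\<dots> = ennreal (evidence (obs_law t) y)"
    unfolding evidence_def by (intro nn_integral_eq_integral integrable_likelihood) auto
  finally show ?thesis .
qed

lemma emeasure_posterior:
  assumes [measurable]: "B \<in> sets \<mu>0"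
  shows "emeasure (posterior \<mu>0 J y) B
    = (\<integral>\<^sup>+\<theta>. ennreal (pmf (obs_law t \<theta>) y) * indicator B \<theta> \<partial>\<mu>0) / ennreal (evidence (obs_law t) y)"
proof -
  have "emeasure (posterior \<mu>0 J y) B
      = emeasure (uniform_measure J {\<omega> \<in> space J. observed \<omega> = y}) (fst -` B \<inter> space J)"
    unfolding posterior_def by (subst emeasure_distr) auto
  also have "\<dots> = emeasure J {\<omega> \<in> space J. observed \<omega> = y \<and> fst \<omega> \<in> B} / emeasure J {\<omega> \<in> space J. observed \<omega> = y}"
    by (subst emeasure_uniform_measure) (auto intro!: arg_cong2[where f = "(/)"] arg_cong[where f = "emeasure J"])
  finally show ?thesis by (simp only: emeasure_J_obs[OF assms] emeasure_J_observed)
qed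

text \<open>Bayes' rule: conditioning the joint law on the data reweights the prior by the
  likelihood.\<close>

lemma posterior_eq_post:
  assumes "0 < evidence (obs_law t) y"
  shows "posterior \<mu>0 J y = post (obs_law t) y"
proof (rule measure_eqI)
  show "sets (posterior \<mu>0 J y) = sets (post (obs_law t) y)" by (simp add: posterior_def)
  fix B assume "B \<in> sets (posterior \<mu>0 J y)"
  then have B [measurable]: "B \<in> sets \<mu>0" by (simp add: posterior_def)
  have "emeasure (post (obs_law t) y) B
      = (\<integral>\<^sup>+\<theta>. ennreal (pmf (obs_law t \<theta>) y) * indicator B \<theta> / ennreal (evidence (obs_law t) y) \<partial>\<mu>0)"
    unfolding post_def using assms
    by (subst emeasure_density) (auto intro!: nn_integral_cong simp: divide_ennreal[symmetric] indicator_def)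
  also have "\<dots> = emeasure (posterior \<mu>0 J y) B"
    by (subst nn_integral_divide) (auto simp: emeasure_posterior)
  finally show "emeasure (posterior \<mu>0 J y) B = emeasure (post (obs_law t) y) B" by simp
qed

text \<open>Data of probability zero are included: there the mass is \<open>0 / 0 = 0\<close> in
  \<open>ennreal\<close>.\<close>

lemma posterior_in_subprob: "posterior \<mu>0 J y \<in> space (subprob_algebra \<mu>0)"
proof -
  have "emeasure (posterior \<mu>0 J y) \<Theta> = ennreal (evidence (obs_law t) y) / ennreal (evidence (obs_law t) y)"
    using sets.top[of \<mu>0] integrable_likelihood[of "obs_law t", OF measurable_obs_law]
    by (simp add: emeasure_posterior evidence_def nn_integral_eq_integral flip: space_prior cong: nn_integral_cong)
  also have "\<dots> \<le> 1"
    using evidence_nonneg[of "obs_law t" y] by (cases "evidence (obs_law t) y = 0") (auto simp: divide_ennreal)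
  finally have "subprob_space (posterior \<mu>0 J y)"
    using prior.not_empty by (intro subprob_spaceI) (auto simp: posterior_def)
  then show ?thesis by (simp add: space_subprob_algebra posterior_def)
qed

abbreviation next_law :: "outcome \<Rightarrow> outcome measure" where
  "next_law \<omega> \<equiv> posterior \<mu>0 J (observed \<omega>) \<bind> (\<lambda>\<theta>'. run \<omega> \<theta>')"

lemma measurable_next_law: "next_law \<in> measurable J (subprob_algebra OS)"
proof -
  have "(\<lambda>\<omega>. next_law (fst \<omega>, snd \<omega>)) \<in> measurable OS (subprob_algebra OS)"
  proof (rule measurable_compose_countable'[OF _ measurable_snd_OS countable_RS,
        where f = "\<lambda>x \<omega>. next_law (fst \<omega>, x)"])
    fix x assume x: "x \<in> RS"
    obtain D es where x_eq: "x = (D, es)" by (cases x)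
    have obs_eq: "observed (\<theta>, x) = (D, map snd es)" for \<theta> by (simp add: observed_def x_eq)
    have "(\<lambda>\<theta>. posterior \<mu>0 J (D, map snd es) \<bind> (\<lambda>\<theta>'. run (\<theta>, D, es) \<theta>')) \<in> measurable \<mu>0 (subprob_algebra OS)"
      by (rule measurable_bind[where N = \<mu>0, OF measurable_const[OF posterior_in_subprob]])
         (rule measurable_run_pistar, use x x_eq in auto)
    then have "(\<lambda>\<theta>. next_law (\<theta>, x)) \<in> measurable \<mu>0 (subprob_algebra OS)"
      by (simp only: obs_eq) (simp only: x_eq)
    from measurable_compose[OF measurable_fst_OS this]
    show "(\<lambda>\<omega>. next_law (fst \<omega>, x)) \<in> measurable OS (subprob_algebra OS)" .
  qed
  then show ?thesis using measurable_cong_sets[OF sets_J refl] by simp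
qed

lemma nn_integral_next_law:
  assumes f: "f \<in> borel_measurable OS" and \<omega>: "(\<theta>, D, es) \<in> space OS"
  shows "(\<integral>\<^sup>+\<omega>'. f \<omega>' \<partial>next_law (\<theta>, D, es)) = (\<integral>\<^sup>+\<theta>'. \<integral>\<^sup>+\<tau>. f (\<theta>, D, es @ [(pistar \<theta>', \<tau>)])
     \<partial>episode M \<theta> (det_policy (pistar \<theta>')) \<partial>posterior \<mu>0 J (D, map snd es))"
proof -
  have "\<theta> \<in> space \<mu>0" "(D, es) \<in> RS" using \<omega> by (auto simp: space_OS)
  from measurable_compose[OF measurable_Pair1'[OF this(1)] measurable_run_pistar[OF this(2)]]
  have run: "(\<lambda>\<theta>'. run (\<theta>, D, es) \<theta>') \<in> measurable \<mu>0 (subprob_algebra OS)" by simp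
  have "(\<integral>\<^sup>+\<omega>'. f \<omega>' \<partial>next_law (\<theta>, D, es))
      = (\<integral>\<^sup>+\<theta>'. \<integral>\<^sup>+\<omega>'. f \<omega>' \<partial>run (\<theta>, D, es) \<theta>' \<partial>posterior \<mu>0 J (observed (\<theta>, D, es)))"
    using run by (intro nn_integral_bind[OF f]) (simp add: posterior_def)
  also have "\<dots> = (\<integral>\<^sup>+\<theta>'. \<integral>\<^sup>+\<tau>. f (\<theta>, D, es @ [(pistar \<theta>', \<tau>)])
     \<partial>episode M \<theta> (det_policy (pistar \<theta>')) \<partial>posterior \<mu>0 J (D, map snd es))"
  proof -
    have "(\<integral>\<^sup>+\<omega>'. f \<omega>' \<partial>run (\<theta>, D, es) \<theta>') = (\<integral>\<^sup>+\<tau>. f (\<theta>, D, es @ [(pistar \<theta>', \<tau>)])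
       \<partial>episode M \<theta> (det_policy (pistar \<theta>')))" if "\<theta>' \<in> \<Theta>" for \<theta>'
      using f \<open>\<theta> \<in> space \<mu>0\<close> \<open>(D, es) \<in> RS\<close> that
      by (simp only: case_prod_conv, subst nn_integral_distr) (auto simp: space_OS)
    note run_eq = this
    have obs_eq: "observed (\<theta>, D, es) = (D, map snd es)" by (simp add: observed_def)
    show ?thesis
      unfolding obs_eq by (rule nn_integral_cong, rule run_eq) (simp add: posterior_def)
  qed
  finally show ?thesis .
qed

lemma sets_next: "sets (J \<bind> next_law) = sets OS"
  by (rule sets_bind[OF sets_kernel[OF measurable_next_law]]) (use prior.not_empty in \<open>auto simp: space_J\<close>)

text \<open>Records with another number of episodes belong to the space but carry no mass, so later
  steps may assume \<open>length es = t\<close>.\<close>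

lemma AE_observed_J: "AE \<omega> in J. observed \<omega> \<in> obs t"
proof -
  define B where "B = {\<omega> \<in> space J. \<not> observed \<omega> \<in> obs t}"
  have B [measurable]: "B \<in> sets J" unfolding B_def by measurable
  have "emeasure J B = (\<integral>\<^sup>+\<omega>. indicator B \<omega> \<partial>J)"
    by (rule nn_integral_indicator[symmetric]) measurable
  also have "\<dots> = (\<integral>\<^sup>+\<omega>. indicator (UNIV \<times> - obs t) (fst \<omega>, observed \<omega>) \<partial>J)"
    by (rule nn_integral_cong) (auto simp: B_def indicator_def)
  also have "\<dots> = (\<integral>\<^sup>+\<theta>. \<integral>\<^sup>+y. indicator (UNIV \<times> - obs t) (\<theta>, y) \<partial>obs_law t \<theta> \<partial>\<mu>0)"
  proof (rule J)
    have "(\<lambda>x. indicator (- obs t) (snd x) :: ennreal) \<in> borel_measurable (\<mu>0 \<Otimes>\<^sub>M count_space UNIV)"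
      by (rule measurable_compose[OF measurable_snd]) simp
    then show "(indicator (UNIV \<times> - obs t) :: _ \<Rightarrow> ennreal) \<in> borel_measurable (\<mu>0 \<Otimes>\<^sub>M count_space UNIV)"
      by (subst measurable_cong[where g = "\<lambda>x. indicator (- obs t) (snd x)"]) (auto simp: indicator_def)
  qed
  also have "\<dots> = (\<integral>\<^sup>+\<theta>. 0 \<partial>\<mu>0)"
  proof (rule nn_integral_cong)
    fix \<theta> assume "\<theta> \<in> space \<mu>0"
    then have "AE y in obs_law t \<theta>. indicator (UNIV \<times> - obs t) (\<theta>, y) = (0 :: ennreal)"
      using set_obs_law[of \<theta> t] by (auto simp: AE_measure_pmf_iff indicator_def)
    then show "(\<integral>\<^sup>+y. indicator (UNIV \<times> - obs t) (\<theta>, y) \<partial>obs_law t \<theta>) = 0"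
      by (subst nn_integral_0_iff_AE) auto
  qed
  finally show ?thesis by (intro AE_I[where N = B]) (auto simp: B_def)
qed

text \<open>This reaches functionals of the policy just run, which is not part of the observed data;
  \<open>first_error\<close> needs that. Once the sampled kernel and the new trajectory are
  integrated out, a function \<open>\<Psi>\<close> of kernel and data is left, and the assumption on
  \<open>J\<close> applies to it.\<close>

lemma nn_integral_next:
  assumes F: "F \<in> borel_measurable OS"
    and f: "\<And>y \<pi> \<tau>. \<pi> \<in> policies M \<Longrightarrow> (\<lambda>\<theta>. f \<theta> y \<pi> \<tau>) \<in> borel_measurable \<mu>0"
    and eq: "\<And>\<theta> D es \<pi> \<tau>. \<theta> \<in> \<Theta> \<Longrightarrow> (D, es) \<in> RS \<Longrightarrow> length es = t \<Longrightarrow> \<pi> \<in> policies M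
      \<Longrightarrow> F (\<theta>, D, es @ [(\<pi>, \<tau>)]) = f \<theta> (D, map snd es) \<pi> \<tau>"
  shows "(\<integral>\<^sup>+\<omega>. F \<omega> \<partial>(J \<bind> next_law)) = (\<integral>\<^sup>+\<theta>. \<integral>\<^sup>+y. \<integral>\<^sup>+\<pi>. \<integral>\<^sup>+\<tau>. f \<theta> y \<pi> \<tau>
     \<partial>episode M \<theta> (det_policy \<pi>) \<partial>post_policy (obs_law t) y \<partial>obs_law t \<theta> \<partial>\<mu>0)"
proof -
  define g where "g = (\<lambda>\<theta> y \<pi>. \<integral>\<^sup>+\<tau>. f \<theta> y \<pi> \<tau> \<partial>episode M \<theta> (det_policy \<pi>))"
  define \<Psi> where "\<Psi> = (\<lambda>(\<theta>, y). \<integral>\<^sup>+\<theta>'. g \<theta> y (pistar \<theta>') \<partial>posterior \<mu>0 J y)"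
  have g: "(\<lambda>\<theta>. g \<theta> y \<pi>) \<in> borel_measurable \<mu>0" if "\<pi> \<in> policies M" for y \<pi>
  proof -
    have "g \<theta> y \<pi> = (\<Sum>\<tau>\<in>trajs M H. f \<theta> y \<pi> \<tau> * ennreal (pmf (episode M \<theta> (det_policy \<pi>)) \<tau>))"
      if "\<theta> \<in> space \<mu>0" for \<theta>
      unfolding g_def using set_episode[OF in_kernels valid_det_policy[OF \<open>\<pi> \<in> policies M\<close>], of \<theta>] that
      by (intro nn_integral_measure_pmf_support) auto
    moreover have "(\<lambda>\<theta>. \<Sum>\<tau>\<in>trajs M H. f \<theta> y \<pi> \<tau> * ennreal (pmf (episode M \<theta> (det_policy \<pi>)) \<tau>))
        \<in> borel_measurable \<mu>0"
      by (intro borel_measurable_sum borel_measurable_times_ennreal f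
          measurable_compose[OF measurable_policy_episode measurable_ennreal] that)
    ultimately show ?thesis by (subst measurable_cong) auto
  qed
  have \<Psi>: "\<Psi> \<in> borel_measurable (\<mu>0 \<Otimes>\<^sub>M count_space UNIV)"
  proof -
    have "(\<lambda>x. \<Psi> (fst x, snd x)) \<in> borel_measurable (\<mu>0 \<Otimes>\<^sub>M count_space UNIV)"
    proof (rule measurable_compose_countable'[where I = UNIV and g = snd and f = "\<lambda>y x. \<Psi> (fst x, y)"])
      fix y :: observation
      have "(\<lambda>x. g (fst x) y (pistar (snd x))) \<in> borel_measurable (\<mu>0 \<Otimes>\<^sub>M \<mu>0)"
      proof (rule measurable_compose_countable'[where I = "policies M" and g = "\<lambda>x. pistar (snd x)"
            and f = "\<lambda>\<pi> x. g (fst x) y \<pi>"])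
        show "(\<lambda>x. g (fst x) y \<pi>) \<in> borel_measurable (\<mu>0 \<Otimes>\<^sub>M \<mu>0)" if "\<pi> \<in> policies M" for \<pi>
          by (rule measurable_compose[OF measurable_fst g[OF that]])
        show "(\<lambda>x. pistar (snd x)) \<in> measurable (\<mu>0 \<Otimes>\<^sub>M \<mu>0) (count_space (policies M))"
          by (rule measurable_compose[OF measurable_snd measurable_pistar])
      qed (simp add: countable_finite)
      then have "(\<lambda>\<theta>. \<integral>\<^sup>+\<theta>'. g \<theta> y (pistar \<theta>') \<partial>posterior \<mu>0 J y) \<in> borel_measurable \<mu>0"
        by (intro nn_integral_measurable_subprob_algebra2[where N = \<mu>0] measurable_const posterior_in_subprob)
           (simp add: case_prod_beta)
      from measurable_compose[OF measurable_fst this]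
      show "(\<lambda>x. \<Psi> (fst x, y)) \<in> borel_measurable (\<mu>0 \<Otimes>\<^sub>M count_space UNIV)"
        by (simp add: \<Psi>_def)
    qed auto
    then show ?thesis by simp
  qed
  have "(\<integral>\<^sup>+\<omega>. F \<omega> \<partial>(J \<bind> next_law)) = (\<integral>\<^sup>+\<omega>. \<integral>\<^sup>+\<omega>'. F \<omega>' \<partial>next_law \<omega> \<partial>J)"
    by (rule nn_integral_bind[OF F measurable_next_law])
  also have "\<dots> = (\<integral>\<^sup>+\<omega>. \<Psi> (fst \<omega>, observed \<omega>) \<partial>J)"
  proof (rule nn_integral_cong_AE)
    show "AE \<omega> in J. (\<integral>\<^sup>+\<omega>'. F \<omega>' \<partial>next_law \<omega>) = \<Psi> (fst \<omega>, observed \<omega>)"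
      using AE_observed_J AE_space
    proof eventually_elim
      fix \<omega> assume t: "observed \<omega> \<in> obs t" and "\<omega> \<in> space J"
      moreover obtain \<theta> D es where \<omega>: "\<omega> = (\<theta>, D, es)" by (cases \<omega>) auto
      ultimately have "(\<theta>, D, es) \<in> space OS" and J: "\<theta> \<in> \<Theta>" "(D, es) \<in> RS"
        by (auto simp: space_J space_OS)
      have len: "length es = t" using t by (auto simp: \<omega> observed_def obs_def datasets_def)
      have "(\<integral>\<^sup>+\<omega>'. F \<omega>' \<partial>next_law (\<theta>, D, es)) = (\<integral>\<^sup>+\<theta>'. g \<theta> (D, map snd es) (pistar \<theta>')
          \<partial>posterior \<mu>0 J (D, map snd es))"
        unfolding nn_integral_next_law[OF F \<open>(\<theta>, D, es) \<in> space OS\<close>]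
      proof (rule nn_integral_cong)
        fix \<theta>' assume "\<theta>' \<in> space (posterior \<mu>0 J (D, map snd es))"
        then have "pistar \<theta>' \<in> policies M" by (simp add: posterior_def)
        from eq[OF J len this]
        show "(\<integral>\<^sup>+\<tau>. F (\<theta>, D, es @ [(pistar \<theta>', \<tau>)]) \<partial>episode M \<theta> (det_policy (pistar \<theta>')))
            = g \<theta> (D, map snd es) (pistar \<theta>')"
          by (simp add: g_def)
      qed
      moreover have "observed (\<theta>, D, es) = (D, map snd es)" by (simp add: observed_def)
      ultimately show "(\<integral>\<^sup>+\<omega>'. F \<omega>' \<partial>next_law \<omega>) = \<Psi> (fst \<omega>, observed \<omega>)"
        unfolding \<omega> \<Psi>_def by (simp only: fst_conv case_prod_conv)
    qed
  qed
  also have "\<dots> = (\<integral>\<^sup>+\<theta>. \<integral>\<^sup>+y. \<Psi> (\<theta>, y) \<partial>obs_law t \<theta> \<partial>\<mu>0)"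
    by (rule J[OF \<Psi>])
  also have "\<dots> = (\<integral>\<^sup>+\<theta>. \<integral>\<^sup>+y. \<integral>\<^sup>+\<pi>. g \<theta> y \<pi> \<partial>post_policy (obs_law t) y \<partial>obs_law t \<theta> \<partial>\<mu>0)"
  proof (rule nn_integral_cong_AE)
    \<comment> \<open>Off a null set of kernels every possible observation has positive evidence, so
      \<open>posterior\<close> is \<open>post\<close> and the selected policy has law
      \<open>post_policy\<close>.\<close>
    show "AE \<theta> in \<mu>0. (\<integral>\<^sup>+y. \<Psi> (\<theta>, y) \<partial>obs_law t \<theta>)
        = (\<integral>\<^sup>+y. \<integral>\<^sup>+\<pi>. g \<theta> y \<pi> \<partial>post_policy (obs_law t) y \<partial>obs_law t \<theta>)"
      using AE_evidence_pos[of "obs_law t", OF measurable_obs_law]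
    proof eventually_elim
      fix \<theta> assume pos: "\<forall>y\<in>set_pmf (obs_law t \<theta>). 0 < evidence (obs_law t) y"
      then show "(\<integral>\<^sup>+y. \<Psi> (\<theta>, y) \<partial>obs_law t \<theta>)
          = (\<integral>\<^sup>+y. \<integral>\<^sup>+\<pi>. g \<theta> y \<pi> \<partial>post_policy (obs_law t) y \<partial>obs_law t \<theta>)"
        by (intro nn_integral_cong_AE)
           (simp add: AE_measure_pmf_iff \<Psi>_def posterior_eq_post
             nn_integral_post_policy[of "obs_law t", OF measurable_obs_law])
    qed
  qed
  finally show ?thesis by (simp add: g_def)
qed

lemma nn_integral_next_observed:
  assumes f: "f \<in> borel_measurable (\<mu>0 \<Otimes>\<^sub>M count_space UNIV)"
  shows "(\<integral>\<^sup>+\<omega>. f (fst \<omega>, observed \<omega>) \<partial>(J \<bind> next_law)) = (\<integral>\<^sup>+\<theta>. \<integral>\<^sup>+y. f (\<theta>, y) \<partial>obs_law (Suc t) \<theta> \<partial>\<mu>0)"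
proof -
  have "(\<integral>\<^sup>+\<omega>. f (fst \<omega>, observed \<omega>) \<partial>(J \<bind> next_law)) = (\<integral>\<^sup>+\<theta>. \<integral>\<^sup>+y. \<integral>\<^sup>+\<pi>. \<integral>\<^sup>+\<tau>. f (\<theta>, fst y, snd y @ [\<tau>])
     \<partial>episode M \<theta> (det_policy \<pi>) \<partial>post_policy (obs_law t) y \<partial>obs_law t \<theta> \<partial>\<mu>0)"
  proof (rule nn_integral_next)
    show "(\<lambda>\<omega>. f (fst \<omega>, observed \<omega>)) \<in> borel_measurable OS"
      by (rule measurable_compose[OF measurable_fst_observed f])
    show "(\<lambda>\<theta>. f (\<theta>, fst y, snd y @ [\<tau>])) \<in> borel_measurable \<mu>0" for y \<tau>
      by (rule measurable_compose[OF measurable_Pair2' f]) simp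
  qed (simp add: observed_def)
  then show ?thesis by simp
qed

end

abbreviation "J t \<equiv> ipsrl M \<beta> L \<mu>0 pistar t"

text \<open>The joint law of kernel and data determines the posterior of \<open>J t\<close>, and
  with it the law of the next episode; so the two statements together are strong enough to be
  inductive.\<close>

lemma ipsrl_law_aux:
  "sets (J t) = sets OS \<and> (\<forall>f. f \<in> borel_measurable (\<mu>0 \<Otimes>\<^sub>M count_space UNIV) \<longrightarrow>
      (\<integral>\<^sup>+\<omega>. f (fst \<omega>, observed \<omega>) \<partial>J t) = (\<integral>\<^sup>+\<theta>. \<integral>\<^sup>+y. f (\<theta>, y) \<partial>obs_law t \<theta> \<partial>\<mu>0))"
proof (induction t)
  case 0
  have sets: "sets (J 0) = sets OS"
    using prior.not_empty by simp
  have "(\<integral>\<^sup>+\<omega>. f (fst \<omega>, observed \<omega>) \<partial>J 0) = (\<integral>\<^sup>+\<theta>. \<integral>\<^sup>+y. f (\<theta>, y) \<partial>obs_law 0 \<theta> \<partial>\<mu>0)"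
    if f: "f \<in> borel_measurable (\<mu>0 \<Otimes>\<^sub>M count_space UNIV)" for f
  proof -
    have f': "(\<lambda>\<omega>. f (fst \<omega>, observed \<omega>)) \<in> borel_measurable OS"
      by (rule measurable_compose[OF measurable_fst_observed f])
    have "(\<integral>\<^sup>+\<omega>. f (fst \<omega>, observed \<omega>) \<partial>J 0) = (\<integral>\<^sup>+\<theta>. \<integral>\<^sup>+\<omega>. f (fst \<omega>, observed \<omega>)
        \<partial>distr (measure_pmf (offline M \<beta> L \<theta>)) OS (\<lambda>D. (\<theta>, D, [])) \<partial>\<mu>0)"
      unfolding ipsrl.simps by (rule nn_integral_bind[OF f' measurable_initial])
    also have "\<dots> = (\<integral>\<^sup>+\<theta>. \<integral>\<^sup>+y. f (\<theta>, y) \<partial>obs_law 0 \<theta> \<partial>\<mu>0)"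
    proof (rule nn_integral_cong)
      fix \<theta> assume "\<theta> \<in> space \<mu>0"
      have "(\<integral>\<^sup>+\<omega>. g \<omega> \<partial>distr (measure_pmf (offline M \<beta> L \<theta>)) OS (\<lambda>D. (\<theta>, D, [])))
          = (\<integral>\<^sup>+D. g (\<theta>, D, []) \<partial>offline M \<beta> L \<theta>)" if "g \<in> borel_measurable OS" for g
      proof (rule nn_integral_distr)
        show "(\<lambda>D. (\<theta>, D, [])) \<in> measurable (measure_pmf (offline M \<beta> L \<theta>)) OS"
          using \<open>\<theta> \<in> space \<mu>0\<close> by (simp add: space_OS)
        show "g \<in> borel_measurable (distr (measure_pmf (offline M \<beta> L \<theta>)) OS (\<lambda>D. (\<theta>, D, [])))"
          unfolding measurable_distr_eq1 by (rule that)
      qed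
      from this[OF f']
      show "(\<integral>\<^sup>+\<omega>. f (fst \<omega>, observed \<omega>) \<partial>distr (measure_pmf (offline M \<beta> L \<theta>)) OS (\<lambda>D. (\<theta>, D, [])))
          = (\<integral>\<^sup>+y. f (\<theta>, y) \<partial>obs_law 0 \<theta>)"
        by (simp add: observed_def)
    qed
    finally show ?thesis .
  qed
  with sets show ?case by blast
next
  case (Suc t)
  then have sets: "sets (J t) = sets OS"
    and IH: "f \<in> borel_measurable (\<mu>0 \<Otimes>\<^sub>M count_space UNIV) \<Longrightarrow>
      (\<integral>\<^sup>+\<omega>. f (fst \<omega>, observed \<omega>) \<partial>J t) = (\<integral>\<^sup>+\<theta>. \<integral>\<^sup>+y. f (\<theta>, y) \<partial>obs_law t \<theta> \<partial>\<mu>0)" for f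
    by blast+
  have eq: "J (Suc t) = J t \<bind> (\<lambda>\<omega>. posterior \<mu>0 (J t) (observed \<omega>) \<bind> (\<lambda>\<theta>'. run \<omega> \<theta>'))"
    by simp
  show ?case
    unfolding eq using sets_next[OF sets IH] nn_integral_next_observed[OF sets IH] by blast
qed

lemma sets_ipsrl: "sets (J t) = sets OS"
  and nn_integral_ipsrl: "f \<in> borel_measurable (\<mu>0 \<Otimes>\<^sub>M count_space UNIV) \<Longrightarrow>
      (\<integral>\<^sup>+\<omega>. f (fst \<omega>, observed \<omega>) \<partial>J t) = (\<integral>\<^sup>+\<theta>. \<integral>\<^sup>+y. f (\<theta>, y) \<partial>obs_law t \<theta> \<partial>\<mu>0)"
  using ipsrl_law_aux by blast+

end

subsection \<open>The regret of one episode\<close>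

context finite_mdp
begin

lemma excess_le_4:
  assumes "\<theta> \<in> kernels M" "i \<in> triples M" "set ts \<subseteq> trajs M H" "0 \<le> x"
  shows "excess M x \<theta> ts i \<le> 4"
proof -
  have "(emp_dist M \<theta> ts i)\<^sup>2 \<le> 2\<^sup>2"
    using emp_dist_le_2[OF assms(1-3)] by (intro power_mono) (auto simp: emp_dist_def sum_nonneg)
  then show ?thesis using bonus_nonneg[OF assms(4), of "visit_count ts i"] by (simp add: excess_def)
qed

definition init_value :: "kernel \<Rightarrow> policy \<Rightarrow> real" where
  "init_value \<theta> \<pi> = (\<Sum>s\<in>S. pmf (init M) s * policy_value M \<theta> \<pi> s)"

lemma init_value_eq:
  assumes "\<theta> \<in> kernels M" "\<pi> \<in> policies M"
  shows "init_value \<theta> \<pi> = expect (episode M \<theta> (det_policy \<pi>)) (total_reward M)"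
  by (simp add: init_value_def policy_value_def expect_episode[OF assms(1) valid_det_policy[OF assms(2)]])

lemma total_reward_bounds: "\<tau> \<in> trajs M H \<Longrightarrow> 0 \<le> total_reward M \<tau> \<and> total_reward M \<tau> \<le> real H + 1"
  using reward_from_bounds[of \<tau> H 0] by (simp add: total_reward_eq)

lemma init_value_bounds:
  assumes "\<theta> \<in> kernels M" "\<pi> \<in> policies M"
  shows "0 \<le> init_value \<theta> \<pi> \<and> init_value \<theta> \<pi> \<le> real H + 1"
proof -
  note v = valid_det_policy[OF assms(2)]
  have "\<tau> \<in> trajs M H" if "\<tau> \<in> set_pmf (episode M \<theta> (det_policy \<pi>))" for \<tau>
    using set_episode[OF assms(1) v] that by blast
  then show ?thesis
    unfolding init_value_eq[OF assms] using finite_set_episode[OF assms(1) v] total_reward_bounds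
    by (auto intro!: expect_ge_const expect_le_const)
qed

text \<open>
  The weight \<open>c\<close> is free: optimising it in the end gives the same bound as the Cauchy-Schwarz
  inequality, while all expectations enter linearly.
\<close>

lemma init_value_diff_le:
  assumes \<theta>: "\<theta> \<in> kernels M" "\<theta>' \<in> kernels M" and \<pi>: "\<pi> \<in> policies M" and c: "0 < c"
  shows "init_value \<theta>' \<pi> - init_value \<theta> \<pi> \<le> c / 2 + real H ^ 3 / (2 * c) *
    (4 * expect (episode M \<theta> (det_policy \<pi>)) (\<lambda>\<tau>. step_sum (\<lambda>i. bonus x (visit_count ts i)) 0 (fst \<tau>))
      + 2 * (\<Sum>i\<in>triples M. excess M x \<theta> ts i) + 2 * (\<Sum>i\<in>triples M. excess M x \<theta>' ts i))"
proof -
  note v = valid_det_policy[OF \<pi>]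
  note fin = finite_set_episode[OF \<theta>(1) v]
  define e where "e = (\<lambda>i. 2 * excess M x \<theta> ts i + 2 * excess M x \<theta>' ts i)"
  have "real H * step_sum (kernel_dist M \<theta> \<theta>') 0 (fst \<tau>)
      \<le> c / 2 + real H ^ 3 / (2 * c) *
        (4 * step_sum (\<lambda>i. bonus x (visit_count ts i)) 0 (fst \<tau>) + (\<Sum>i\<in>triples M. e i))"
    if \<tau>: "\<tau> \<in> trajs M H" for \<tau>
  proof -
    define d where "d = real H * step_sum (kernel_dist M \<theta> \<theta>') 0 (fst \<tau>)"
    \<comment> \<open>\<open>H\<^sup>2\<close> comes from the range of the values, one more
      \<open>H\<close> from Cauchy-Schwarz over the periods.\<close>
    have "d\<^sup>2 \<le> real H ^ 2 * (real H * step_sum (\<lambda>i. (kernel_dist M \<theta> \<theta>' i)\<^sup>2) 0 (fst \<tau>))"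
      unfolding d_def power_mult_distrib by (intro mult_left_mono step_sum_squared \<tau>) auto
    also have "\<dots> = real H ^ 3 * step_sum (\<lambda>i. (kernel_dist M \<theta> \<theta>' i)\<^sup>2) 0 (fst \<tau>)"
      by (simp add: power2_eq_square power3_eq_cube)
    also have "\<dots> \<le> real H ^ 3 * (4 * step_sum (\<lambda>i. bonus x (visit_count ts i)) 0 (fst \<tau>) + (\<Sum>i\<in>triples M. e i))"
    proof (rule mult_left_mono)
      have "step_sum (\<lambda>i. (kernel_dist M \<theta> \<theta>' i)\<^sup>2) 0 (fst \<tau>)
          \<le> step_sum (\<lambda>i. 4 * bonus x (visit_count ts i) + e i) 0 (fst \<tau>)"
        unfolding step_sum_def e_def
        by (intro sum_mono order_trans[OF kernel_dist_sq_le[where x = x and ts = ts]]) simp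
      also have "\<dots> = 4 * step_sum (\<lambda>i. bonus x (visit_count ts i)) 0 (fst \<tau>) + step_sum e 0 (fst \<tau>)"
        by (simp add: step_sum_def sum.distrib sum_distrib_left)
      \<comment> \<open>Enlarged from the visited triples to all of them, the excess is constant
        along the episode.\<close>
      also have "step_sum e 0 (fst \<tau>) \<le> (\<Sum>i\<in>triples M. e i)"
        by (rule step_sum_le_sum[OF \<tau>]) (simp add: e_def excess_nonneg)
      finally show "step_sum (\<lambda>i. (kernel_dist M \<theta> \<theta>' i)\<^sup>2) 0 (fst \<tau>)
          \<le> 4 * step_sum (\<lambda>i. bonus x (visit_count ts i)) 0 (fst \<tau>) + (\<Sum>i\<in>triples M. e i)" by simp
    qed simp
    finally have d2: "d\<^sup>2 / (2 * c) \<le> real H ^ 3 / (2 * c) *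
        (4 * step_sum (\<lambda>i. bonus x (visit_count ts i)) 0 (fst \<tau>) + (\<Sum>i\<in>triples M. e i))"
      using c by (simp add: divide_right_mono)
    have "0 \<le> (d - c)\<^sup>2 / (2 * c)" using c by simp
    also have "\<dots> = d\<^sup>2 / (2 * c) - d + c / 2"
      using c by (simp add: power2_diff field_simps power2_eq_square)
    finally show ?thesis using d2 unfolding d_def by linarith
  qed
  then have "expect (episode M \<theta> (det_policy \<pi>)) (\<lambda>\<tau>. real H * step_sum (kernel_dist M \<theta> \<theta>') 0 (fst \<tau>))
      \<le> expect (episode M \<theta> (det_policy \<pi>)) (\<lambda>\<tau>. c / 2 + real H ^ 3 / (2 * c) *
        (4 * step_sum (\<lambda>i. bonus x (visit_count ts i)) 0 (fst \<tau>) + (\<Sum>i\<in>triples M. e i)))"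
    using set_episode[OF \<theta>(1) v] by (intro expect_mono fin) blast
  also have "\<dots> = c / 2 + real H ^ 3 / (2 * c) *
      (4 * expect (episode M \<theta> (det_policy \<pi>)) (\<lambda>\<tau>. step_sum (\<lambda>i. bonus x (visit_count ts i)) 0 (fst \<tau>))
       + (\<Sum>i\<in>triples M. e i))"
    by (simp only: expect_add[OF fin] integral_mult_right_zero) simp
  finally show ?thesis
    using policy_value_difference[OF \<theta> \<pi>]
    by (simp add: init_value_def e_def sum.distrib sum_distrib_left add.assoc)
qed

end

context bayes_mdp
begin

section \<open>Prior averages as evidence-weighted posterior averages\<close>

abbreviation "Z t y \<equiv> evidence (obs_law t) y"
abbreviation "\<rho> t y \<equiv> post (obs_law t) y"
abbreviation "\<rho>2 t y \<equiv> post (obs_law t) y \<Otimes>\<^sub>M post (obs_law t) y"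

definition pos_obs :: "nat \<Rightarrow> observation set" where
  "pos_obs t = {y \<in> obs t. 0 < Z t y}"

lemma finite_pos_obs [simp, intro]: "finite (pos_obs t)"
  by (simp add: pos_obs_def)

lemma prob_space_rho: "y \<in> pos_obs t \<Longrightarrow> prob_space (\<rho> t y)"
  by (auto simp: pos_obs_def intro!: prob_space_post measurable_obs_law)

lemma pair_prob_space_rho: "y \<in> pos_obs t \<Longrightarrow> pair_prob_space (\<rho> t y) (\<rho> t y)"
  using prob_space_rho by (simp add: pair_prob_space_def pair_sigma_finite_def prob_space_imp_sigma_finite)

lemma space_rho2: "space (\<rho>2 t y) = \<Theta> \<times> \<Theta>"
  by (simp add: space_pair_measure)

lemma measurable_rho2: "f \<in> borel_measurable (\<mu>0 \<Otimes>\<^sub>M \<mu>0) \<Longrightarrow> f \<in> borel_measurable (\<rho>2 t y)"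
  by (simp add: measurable_cong_sets[OF sets_pair_measure_cong[OF sets_post sets_post] refl])

lemma measurable_pistar_snd:
  assumes "\<And>\<pi>. \<pi> \<in> policies M \<Longrightarrow> (\<lambda>\<theta>. g \<theta> \<pi>) \<in> borel_measurable \<mu>0"
  shows "(\<lambda>x. g (fst x) (pistar (snd x))) \<in> borel_measurable (\<mu>0 \<Otimes>\<^sub>M \<mu>0)"
proof (rule measurable_compose_countable'[where I = "policies M" and g = "\<lambda>x. pistar (snd x)"
      and f = "\<lambda>\<pi> x. g (fst x) \<pi>"])
  show "(\<lambda>x. g (fst x) \<pi>) \<in> borel_measurable (\<mu>0 \<Otimes>\<^sub>M \<mu>0)" if "\<pi> \<in> policies M" for \<pi>
    by (rule measurable_compose[OF measurable_fst assms[OF that]])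
  show "(\<lambda>x. pistar (snd x)) \<in> measurable (\<mu>0 \<Otimes>\<^sub>M \<mu>0) (count_space (policies M))"
    by (rule measurable_compose[OF measurable_snd measurable_pistar])
qed (simp add: countable_finite)

lemma integrable_rho2:
  assumes "y \<in> pos_obs t" "f \<in> borel_measurable (\<mu>0 \<Otimes>\<^sub>M \<mu>0)"
    and "\<And>\<theta> \<theta>'. \<theta> \<in> \<Theta> \<Longrightarrow> \<theta>' \<in> \<Theta> \<Longrightarrow> \<bar>f (\<theta>, \<theta>') :: real\<bar> \<le> B"
  shows "integrable (\<rho>2 t y) f"
proof -
  interpret pair_prob_space "\<rho> t y" "\<rho> t y" by (rule pair_prob_space_rho[OF assms(1)])
  interpret P: prob_space "\<rho>2 t y" by (rule prob_space_axioms)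
  show ?thesis
    by (rule P.integrable_const_bound[where B = B])
       (use assms(3) in \<open>auto intro!: AE_I2 measurable_rho2[OF assms(2)] simp: space_rho2\<close>)
qed

text \<open>Exchangeability of the true and the sampled kernel, given the data.\<close>

lemma integral_rho2_swap:
  assumes "y \<in> pos_obs t" "f \<in> borel_measurable (\<mu>0 \<Otimes>\<^sub>M \<mu>0)"
  shows "(LINT x|\<rho>2 t y. f (snd x, fst x)) = (LINT x|\<rho>2 t y. f x :: real)"
proof -
  interpret pair_prob_space "\<rho> t y" "\<rho> t y" by (rule pair_prob_space_rho[OF assms(1)])
  show ?thesis
    using integral_product_swap[OF measurable_rho2[OF assms(2)]] by (simp add: case_prod_unfold)
qed

lemma integral_rho2:
  assumes "y \<in> pos_obs t" "integrable (\<rho>2 t y) f"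
  shows "(LINT x|\<rho>2 t y. f x :: real) = (LINT \<theta>|\<rho> t y. LINT \<theta>'|\<rho> t y. f (\<theta>, \<theta>'))"
proof -
  interpret pair_prob_space "\<rho> t y" "\<rho> t y" by (rule pair_prob_space_rho[OF assms(1)])
  show ?thesis using integral_fst'[OF assms(2)] by simp
qed

lemma integral_rho2_fst:
  assumes "y \<in> pos_obs t" "f \<in> borel_measurable \<mu>0" "\<And>\<theta>. \<theta> \<in> \<Theta> \<Longrightarrow> \<bar>f \<theta> :: real\<bar> \<le> B"
  shows "(LINT x|\<rho>2 t y. f (fst x)) = (LINT \<theta>|\<rho> t y. f \<theta>)"
proof -
  interpret prob_space "\<rho> t y" by (rule prob_space_rho[OF assms(1)])
  have "integrable (\<rho>2 t y) (\<lambda>x. f (fst x))"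
    by (rule integrable_rho2[OF assms(1) measurable_compose[OF measurable_fst assms(2)], of B])
       (use assms(3) in auto)
  then show ?thesis by (simp only: integral_rho2[OF assms(1)] fst_conv) (simp add: prob_space[unfolded space_post])
qed

lemma integrable_obs_law:
  assumes "\<And>y. y \<in> obs t \<Longrightarrow> (\<lambda>\<theta>. g \<theta> y) \<in> borel_measurable \<mu>0"
    and "\<And>\<theta> y. \<theta> \<in> \<Theta> \<Longrightarrow> y \<in> obs t \<Longrightarrow> \<bar>g \<theta> y\<bar> \<le> B y"
  shows "integrable \<mu>0 (\<lambda>\<theta>. expect (obs_law t \<theta>) (g \<theta>))"
    and "(LINT \<theta>|\<mu>0. expect (obs_law t \<theta>) (g \<theta>))
      = (\<Sum>y\<in>obs t. LINT \<theta>|\<mu>0. pmf (obs_law t \<theta>) y * g \<theta> y)"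
    and "y \<in> obs t \<Longrightarrow> integrable \<mu>0 (\<lambda>\<theta>. pmf (obs_law t \<theta>) y * g \<theta> y)"
proof -
  have eq: "expect (obs_law t \<theta>) (g \<theta>) = (\<Sum>y\<in>obs t. pmf (obs_law t \<theta>) y * g \<theta> y)" if "\<theta> \<in> space \<mu>0" for \<theta>
    using that by (intro expect_finite set_obs_law) auto
  show int: "integrable \<mu>0 (\<lambda>\<theta>. pmf (obs_law t \<theta>) y * g \<theta> y)" if "y \<in> obs t" for y
  proof (rule prior.integrable_const_bound[where B = "B y"])
    have "\<bar>pmf (obs_law t \<theta>) y * g \<theta> y\<bar> \<le> 1 * B y" if "\<theta> \<in> \<Theta>" for \<theta>
      unfolding abs_mult using assms(2)[OF that \<open>y \<in> obs t\<close>] by (intro mult_mono) (auto simp: pmf_le_1)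
    then show "AE \<theta> in \<mu>0. norm (pmf (obs_law t \<theta>) y * g \<theta> y) \<le> B y" by auto
    show "(\<lambda>\<theta>. pmf (obs_law t \<theta>) y * g \<theta> y) \<in> borel_measurable \<mu>0"
      by (intro borel_measurable_times measurable_obs_law assms that)
  qed
  then show "integrable \<mu>0 (\<lambda>\<theta>. expect (obs_law t \<theta>) (g \<theta>))"
    by (subst Bochner_Integration.integrable_cong[OF refl eq]) auto
  show "(LINT \<theta>|\<mu>0. expect (obs_law t \<theta>) (g \<theta>)) = (\<Sum>y\<in>obs t. LINT \<theta>|\<mu>0. pmf (obs_law t \<theta>) y * g \<theta> y)"
    using int by (subst Bochner_Integration.integral_cong[OF refl eq]) auto
qed

text \<open>Prior times likelihood is evidence times posterior; data without evidence contribute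
  nothing.\<close>

lemma integral_obs_law:
  assumes "\<And>y. y \<in> obs t \<Longrightarrow> (\<lambda>\<theta>. g \<theta> y) \<in> borel_measurable \<mu>0"
    and "\<And>\<theta> y. \<theta> \<in> \<Theta> \<Longrightarrow> y \<in> obs t \<Longrightarrow> \<bar>g \<theta> y\<bar> \<le> B y"
  shows "(LINT \<theta>|\<mu>0. expect (obs_law t \<theta>) (g \<theta>)) = (\<Sum>y\<in>pos_obs t. Z t y * (LINT \<theta>|\<rho> t y. g \<theta> y))"
proof -
  have zero: "(LINT \<theta>|\<mu>0. pmf (obs_law t \<theta>) y * g \<theta> y) = 0" if "y \<in> obs t - pos_obs t" for y
  proof -
    have "AE \<theta> in \<mu>0. pmf (obs_law t \<theta>) y * g \<theta> y = 0"
      using AE_evidence_pos[of "obs_law t", OF measurable_obs_law]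
      by eventually_elim (use that in \<open>auto simp: pos_obs_def set_pmf_iff\<close>)
    then show ?thesis by (rule integral_eq_zero_AE)
  qed
  have pos: "(LINT \<theta>|\<mu>0. pmf (obs_law t \<theta>) y * g \<theta> y) = Z t y * (LINT \<theta>|\<rho> t y. g \<theta> y)" if y: "y \<in> pos_obs t" for y
  proof -
    have "(LINT \<theta>|\<rho> t y. g \<theta> y) = (LINT \<theta>|\<mu>0. (pmf (obs_law t \<theta>) y / Z t y) *\<^sub>R g \<theta> y)"
      unfolding post_def using y assms(1)[of y]
      by (intro integral_density) (auto simp: pos_obs_def)
    then show ?thesis using y by (simp add: pos_obs_def)
  qed
  have "(LINT \<theta>|\<mu>0. expect (obs_law t \<theta>) (g \<theta>)) = (\<Sum>y\<in>obs t. LINT \<theta>|\<mu>0. pmf (obs_law t \<theta>) y * g \<theta> y)"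
    by (rule integrable_obs_law(2)[OF assms])
  also have "\<dots> = (\<Sum>y\<in>pos_obs t. LINT \<theta>|\<mu>0. pmf (obs_law t \<theta>) y * g \<theta> y)"
    using zero by (intro sum.mono_neutral_right) (auto simp: pos_obs_def)
  finally show ?thesis using pos by simp
qed

context
  fixes t :: nat and g :: "kernel \<Rightarrow> observation \<Rightarrow> policy \<Rightarrow> real" and B :: "observation \<Rightarrow> real"
  assumes g: "\<And>y \<pi>. y \<in> obs t \<Longrightarrow> \<pi> \<in> policies M \<Longrightarrow> (\<lambda>\<theta>. g \<theta> y \<pi>) \<in> borel_measurable \<mu>0"
    and bound: "\<And>\<theta> y \<pi>. \<theta> \<in> \<Theta> \<Longrightarrow> y \<in> obs t \<Longrightarrow> \<pi> \<in> policies M \<Longrightarrow> \<bar>g \<theta> y \<pi>\<bar> \<le> B y"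
begin

lemma measurable_obs_policy:
  assumes "y \<in> obs t"
  shows "(\<lambda>\<theta>. expect (post_policy (obs_law t) y) (g \<theta> y)) \<in> borel_measurable \<mu>0"
  unfolding expect_finite[OF finite_policies set_obs_policy]
  by (intro borel_measurable_sum borel_measurable_times borel_measurable_const g assms)

lemma bound_obs_policy:
  assumes "\<theta> \<in> \<Theta>" "y \<in> obs t"
  shows "\<bar>expect (post_policy (obs_law t) y) (g \<theta> y)\<bar> \<le> B y"
proof -
  have "\<bar>g \<theta> y \<pi>\<bar> \<le> B y" if "\<pi> \<in> set_pmf (post_policy (obs_law t) y)" for \<pi>
    using bound[OF assms] set_obs_policy that by blast
  then show ?thesis
    using finite_subset[OF set_obs_policy[of t y] finite_policies]
    by (auto simp: abs_le_iff minus_le_iff intro!: expect_le_const expect_ge_const)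
qed

lemma integrable_obs_policy: "integrable \<mu>0 (\<lambda>\<theta>. expect (obs_law t \<theta>) (\<lambda>y. expect (post_policy (obs_law t) y) (g \<theta> y)))"
  by (rule integrable_obs_law(1)[where B = B]) (auto intro: measurable_obs_policy bound_obs_policy)

text \<open>The policy run is \<open>pistar\<close> of a posterior sample that, given the data, is
  independent of the true kernel. So kernel and policy can be read off from a pair under the product
  of two posteriors.\<close>

lemma integral_obs_policy:
  "(LINT \<theta>|\<mu>0. expect (obs_law t \<theta>) (\<lambda>y. expect (post_policy (obs_law t) y) (g \<theta> y)))
    = (\<Sum>y\<in>pos_obs t. Z t y * (LINT x|\<rho>2 t y. g (fst x) y (pistar (snd x))))"
proof -
  have "(LINT \<theta>|\<rho> t y. expect (post_policy (obs_law t) y) (g \<theta> y))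
      = (LINT x|\<rho>2 t y. g (fst x) y (pistar (snd x)))" if y: "y \<in> pos_obs t" for y
  proof -
    have y': "y \<in> obs t" "0 < Z t y" using y by (auto simp: pos_obs_def)
    have "integrable (\<rho>2 t y) (\<lambda>x. g (fst x) y (pistar (snd x)))"
      using g bound y'(1)
      by (intro integrable_rho2[OF y, where B = "B y"] measurable_pistar_snd) auto
    from integral_rho2[OF y this] show ?thesis
      by (simp add: expect_post_policy[of "obs_law t", OF measurable_obs_law y'(2)])
  qed
  then show ?thesis
    by (subst integral_obs_law[where B = B]) (auto intro: measurable_obs_policy bound_obs_policy)
qed

end

lemma optimal_value: "\<theta> \<in> \<Theta> \<Longrightarrow> (\<Sum>s\<in>S. pmf (init M) s * opt_V M \<theta> 0 s) = init_value \<theta> (pistar \<theta>)"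
  using optimal by (auto simp: optimal_policy_def init_value_def intro!: sum.cong)

lemma measurable_init_value:
  assumes "\<pi> \<in> policies M"
  shows "(\<lambda>\<theta>. init_value \<theta> \<pi>) \<in> borel_measurable \<mu>0"
proof -
  have "(\<lambda>\<theta>. expect (episode M \<theta> (det_policy \<pi>)) (total_reward M)) \<in> borel_measurable \<mu>0"
    by (intro measurable_expect_policy_episode assms) auto
  moreover have "init_value \<theta> \<pi> = expect (episode M \<theta> (det_policy \<pi>)) (total_reward M)" if "\<theta> \<in> space \<mu>0" for \<theta>
    using that assms by (intro init_value_eq) auto
  ultimately show ?thesis by (subst measurable_cong)
qed

text \<open>Here the kernel also selects the policy. Passing to \<open>opt_V\<close> avoids joint
  measurability in the two.\<close>

lemma measurable_optimal_value: "(\<lambda>\<theta>. init_value \<theta> (pistar \<theta>)) \<in> borel_measurable \<mu>0"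
proof -
  have "(\<lambda>\<theta>. \<Sum>s\<in>S. pmf (init M) s * opt_V M \<theta> 0 s) \<in> borel_measurable \<mu>0" by measurable
  moreover have "init_value \<theta> (pistar \<theta>) = (\<Sum>s\<in>S. pmf (init M) s * opt_V M \<theta> 0 s)" if "\<theta> \<in> space \<mu>0" for \<theta>
    using that optimal_value by simp
  ultimately show ?thesis by (subst measurable_cong)
qed

lemma measurable_excess [measurable]: "(\<lambda>\<theta>. excess M x \<theta> ts i) \<in> borel_measurable \<mu>0"
  unfolding excess_def emp_dist_def by measurable

section \<open>Regret, mismatch, bonus and excess of one episode, given the kernel\<close>

definition round_regret :: "nat \<Rightarrow> kernel \<Rightarrow> real" where
  "round_regret t \<theta> = expect (obs_law t \<theta>) (\<lambda>y. expect (post_policy (obs_law t) y) (\<lambda>\<pi>.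
     expect (episode M \<theta> (det_policy \<pi>)) (\<lambda>\<tau>. opt_V M \<theta> 0 (init_state \<tau>) - total_reward M \<tau>)))"

definition mismatch :: "nat \<Rightarrow> kernel \<Rightarrow> real" where
  "mismatch t \<theta> = expect (obs_law t \<theta>) (\<lambda>y. expect (post_policy (obs_law t) y) (\<lambda>\<pi>. of_bool (\<pi> \<noteq> pistar \<theta>)))"

definition bonus_cost :: "real \<Rightarrow> nat \<Rightarrow> kernel \<Rightarrow> real" where
  "bonus_cost x t \<theta> = expect (obs_law t \<theta>) (\<lambda>y. expect (post_policy (obs_law t) y) (\<lambda>\<pi>.
     expect (episode M \<theta> (det_policy \<pi>)) (\<lambda>\<tau>. step_sum (\<lambda>i. bonus x (visit_count (snd y) i)) 0 (fst \<tau>))))"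

definition excess_cost :: "real \<Rightarrow> nat \<Rightarrow> kernel \<Rightarrow> real" where
  "excess_cost x t \<theta> = expect (obs_law t \<theta>) (\<lambda>y. \<Sum>i\<in>triples M. excess M x \<theta> (snd y) i)"

lemma regret_episode:
  assumes "\<theta> \<in> \<Theta>" "\<pi> \<in> policies M"
  shows "expect (episode M \<theta> (det_policy \<pi>)) (\<lambda>\<tau>. opt_V M \<theta> 0 (init_state \<tau>) - total_reward M \<tau>)
    = init_value \<theta> (pistar \<theta>) - init_value \<theta> \<pi>"
  using assms
  by (simp add: expect_regret_episode right_diff_distrib sum_subtractf optimal_value[symmetric] init_value_def[of \<theta> \<pi>])

lemma measurable_policy_mismatch: "(\<lambda>\<theta>. of_bool (\<pi> \<noteq> pistar \<theta>) :: real) \<in> borel_measurable \<mu>0"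
proof -
  have "(\<lambda>\<pi>'. of_bool (\<pi> \<noteq> \<pi>') :: real) \<in> measurable (count_space (policies M)) borel" by simp
  from measurable_compose[OF measurable_pistar this] show ?thesis .
qed

lemma init_value_gap_le:
  assumes "\<theta> \<in> \<Theta>" "\<pi> \<in> policies M"
  shows "\<bar>init_value \<theta> (pistar \<theta>) - init_value \<theta> \<pi>\<bar> \<le> real H + 1"
  using init_value_bounds[of \<theta> \<pi>] init_value_bounds[of \<theta> "pistar \<theta>"] assms by (auto simp: abs_le_iff)

lemma round_regret_eq:
  assumes "\<theta> \<in> \<Theta>"
  shows "round_regret t \<theta> = expect (obs_law t \<theta>) (\<lambda>y. expect (post_policy (obs_law t) y)
     (\<lambda>\<pi>. init_value \<theta> (pistar \<theta>) - init_value \<theta> \<pi>))"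
  unfolding round_regret_def using set_obs_policy assms
  by (intro expect_cong regret_episode) blast+

lemma integrable_round_regret: "integrable \<mu>0 (round_regret t)"
  and integral_round_regret: "(LINT \<theta>|\<mu>0. round_regret t \<theta>)
    = (\<Sum>y\<in>pos_obs t. Z t y * (LINT x|\<rho>2 t y. init_value (fst x) (pistar (fst x)) - init_value (fst x) (pistar (snd x))))"
proof -
  let ?g = "\<lambda>\<theta> (y :: observation) \<pi>. init_value \<theta> (pistar \<theta>) - init_value \<theta> \<pi>"
  have g: "(\<lambda>\<theta>. ?g \<theta> y \<pi>) \<in> borel_measurable \<mu>0" if "\<pi> \<in> policies M" for y \<pi>
    by (intro borel_measurable_diff measurable_optimal_value measurable_init_value that)
  have eq: "round_regret t \<theta> = expect (obs_law t \<theta>) (\<lambda>y. expect (post_policy (obs_law t) y) (?g \<theta> y))"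
    if "\<theta> \<in> space \<mu>0" for \<theta>
    using that by (simp add: round_regret_eq)
  show "integrable \<mu>0 (round_regret t)"
    by (subst Bochner_Integration.integrable_cong[OF refl eq], assumption)
       (rule integrable_obs_policy[of t ?g "\<lambda>_. real H + 1"], auto intro: g init_value_gap_le)
  show "(LINT \<theta>|\<mu>0. round_regret t \<theta>)
    = (\<Sum>y\<in>pos_obs t. Z t y * (LINT x|\<rho>2 t y. init_value (fst x) (pistar (fst x)) - init_value (fst x) (pistar (snd x))))"
    by (subst Bochner_Integration.integral_cong[OF refl eq], assumption)
       (rule integral_obs_policy[of t ?g "\<lambda>_. real H + 1"], auto intro: g init_value_gap_le)
qed

lemma integrable_mismatch: "integrable \<mu>0 (mismatch t)"
  and integral_mismatch: "(LINT \<theta>|\<mu>0. mismatch t \<theta>)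
    = (\<Sum>y\<in>pos_obs t. Z t y * (LINT x|\<rho>2 t y. of_bool (pistar (snd x) \<noteq> pistar (fst x))))"
  unfolding mismatch_def
  by (rule integrable_obs_policy[where B = "\<lambda>_. 1"], auto intro: measurable_policy_mismatch)
     (rule integral_obs_policy[where B = "\<lambda>_. 1"], auto intro: measurable_policy_mismatch)

lemma bonus_episode_bound:
  assumes "\<theta> \<in> \<Theta>" "\<pi> \<in> policies M" "0 \<le> x"
  shows "\<bar>expect (episode M \<theta> (det_policy \<pi>)) (\<lambda>\<tau>. step_sum (\<lambda>i. bonus x (visit_count ts i)) 0 (fst \<tau>))\<bar>
    \<le> (\<Sum>i\<in>triples M. bonus x (visit_count ts i))"
proof -
  note v = valid_det_policy[OF assms(2)]
  note b = bonus_nonneg[OF assms(3)]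
  have \<tau>: "\<tau> \<in> trajs M H" if "\<tau> \<in> set_pmf (episode M \<theta> (det_policy \<pi>))" for \<tau>
    using set_episode[OF in_kernels[OF assms(1)] v] that by blast
  have "0 \<le> expect (episode M \<theta> (det_policy \<pi>)) (\<lambda>\<tau>. step_sum (\<lambda>i. bonus x (visit_count ts i)) 0 (fst \<tau>))"
    using finite_set_episode[OF in_kernels[OF assms(1)] v] b
    by (intro expect_ge_const) (auto simp: step_sum_def intro!: sum_nonneg)
  moreover have "expect (episode M \<theta> (det_policy \<pi>)) (\<lambda>\<tau>. step_sum (\<lambda>i. bonus x (visit_count ts i)) 0 (fst \<tau>))
      \<le> (\<Sum>i\<in>triples M. bonus x (visit_count ts i))"
    using finite_set_episode[OF in_kernels[OF assms(1)] v] b \<tau>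
    by (intro expect_le_const step_sum_le_sum) auto
  ultimately show ?thesis by simp
qed

lemma integrable_bonus_cost: "0 \<le> x \<Longrightarrow> integrable \<mu>0 (bonus_cost x t)"
  and integral_bonus_cost: "0 \<le> x \<Longrightarrow> (LINT \<theta>|\<mu>0. bonus_cost x t \<theta>)
    = (\<Sum>y\<in>pos_obs t. Z t y * (LINT p|\<rho>2 t y. expect (episode M (fst p) (det_policy (pistar (snd p))))
        (\<lambda>\<tau>. step_sum (\<lambda>i. bonus x (visit_count (snd y) i)) 0 (fst \<tau>))))"
  unfolding bonus_cost_def
  by (rule integrable_obs_policy[where B = "\<lambda>y. \<Sum>i\<in>triples M. bonus x (visit_count (snd y) i)"],
      auto intro: measurable_expect_policy_episode bonus_episode_bound)
     (rule integral_obs_policy[where B = "\<lambda>y. \<Sum>i\<in>triples M. bonus x (visit_count (snd y) i)"],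
      auto intro: measurable_expect_policy_episode bonus_episode_bound)

lemma set_obs: "y \<in> obs t \<Longrightarrow> set (snd y) \<subseteq> trajs M H" and length_obs: "y \<in> obs t \<Longrightarrow> length (snd y) = t"
  by (auto simp: obs_def datasets_def)

lemma sum_excess_bound:
  assumes "\<theta> \<in> \<Theta>" "y \<in> obs t" "0 \<le> x"
  shows "\<bar>\<Sum>i\<in>triples M. excess M x \<theta> (snd y) i\<bar> \<le> (\<Sum>i\<in>triples M. 4)"
proof -
  have "(\<Sum>i\<in>triples M. excess M x \<theta> (snd y) i) \<le> (\<Sum>i\<in>triples M. 4)"
    using assms set_obs by (intro sum_mono excess_le_4) auto
  then show ?thesis by (simp add: sum_nonneg excess_nonneg)
qed

lemma integrable_excess_cost: "0 \<le> x \<Longrightarrow> integrable \<mu>0 (excess_cost x t)"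
  and integral_excess_cost: "0 \<le> x \<Longrightarrow> (LINT \<theta>|\<mu>0. excess_cost x t \<theta>)
    = (\<Sum>y\<in>pos_obs t. Z t y * (LINT \<theta>|\<rho> t y. (\<Sum>i\<in>triples M. excess M x \<theta> (snd y) i)))"
  unfolding excess_cost_def
  by (rule integrable_obs_law(1)[where B = "\<lambda>y. \<Sum>i\<in>triples M. 4"], measurable, rule sum_excess_bound)
     (auto intro!: integral_obs_law[where B = "\<lambda>y. \<Sum>i\<in>triples M. 4"] sum_excess_bound)

text \<open>
  Given the data, the true and the sampled kernel are independent with the same law, so they may be
  exchanged. On the event that the policies agree the regret vanishes, and this event is symmetric;
  so \<open>V\<^sub>0(\<theta>; \<theta>)\<close> may be replaced by \<open>V\<^sub>0(\<theta>'; \<theta>')\<close> on its complement.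
\<close>

lemma round_regret_le:
  assumes c: "0 < c" and x: "0 \<le> x"
  shows "(LINT \<theta>|\<mu>0. round_regret t \<theta>) \<le> c / 2 * (LINT \<theta>|\<mu>0. mismatch t \<theta>)
    + real H ^ 3 / (2 * c) * (4 * (LINT \<theta>|\<mu>0. bonus_cost x t \<theta>) + 4 * (LINT \<theta>|\<mu>0. excess_cost x t \<theta>))"
proof -
  define k where "k = real H ^ 3 / (2 * c)"
  have k: "0 \<le> k" using c by (simp add: k_def)
  define N :: "kernel \<times> kernel \<Rightarrow> real" where "N = (\<lambda>p. of_bool (pistar (snd p) \<noteq> pistar (fst p)))"
  define w where "w = (\<lambda>\<theta>. init_value \<theta> (pistar \<theta>))"
  define u where "u = (\<lambda>p. init_value (fst p) (pistar (snd p)))"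
  have mN: "N \<in> borel_measurable (\<mu>0 \<Otimes>\<^sub>M \<mu>0)"
    unfolding N_def by (rule measurable_pistar_snd) (rule measurable_policy_mismatch)
  have mw: "w \<in> borel_measurable \<mu>0" unfolding w_def by (rule measurable_optimal_value)
  have mu: "u \<in> borel_measurable (\<mu>0 \<Otimes>\<^sub>M \<mu>0)"
    unfolding u_def by (rule measurable_pistar_snd) (rule measurable_init_value)
  have wb: "\<bar>w \<theta>\<bar> \<le> real H + 1" if "\<theta> \<in> \<Theta>" for \<theta>
    using init_value_bounds[of \<theta> "pistar \<theta>"] that by (simp add: w_def)
  have ub: "\<bar>u (\<theta>, \<theta>')\<bar> \<le> real H + 1" if "\<theta> \<in> \<Theta>" "\<theta>' \<in> \<Theta>" for \<theta> \<theta>'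
    using init_value_bounds[of \<theta> "pistar \<theta>'"] that by (simp add: u_def)
  have N01: "0 \<le> N p" "N p \<le> 1" for p by (auto simp: N_def)
  have "(LINT p|\<rho>2 t y. w (fst p) - u p) \<le> c / 2 * (LINT p|\<rho>2 t y. N p)
      + k * (4 * (LINT p|\<rho>2 t y. expect (episode M (fst p) (det_policy (pistar (snd p))))
          (\<lambda>\<tau>. step_sum (\<lambda>i. bonus x (visit_count (snd y) i)) 0 (fst \<tau>)))
        + 4 * (LINT \<theta>|\<rho> t y. (\<Sum>i\<in>triples M. excess M x \<theta> (snd y) i)))"
    if y: "y \<in> pos_obs t" for y
  proof -
    have y': "y \<in> obs t" using y by (simp add: pos_obs_def)
    define b where "b = (\<lambda>p. expect (episode M (fst p) (det_policy (pistar (snd p))))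
          (\<lambda>\<tau>. step_sum (\<lambda>i. bonus x (visit_count (snd y) i)) 0 (fst \<tau>)))"
    define e where "e = (\<lambda>\<theta>. \<Sum>i\<in>triples M. excess M x \<theta> (snd y) i)"
    have mb: "b \<in> borel_measurable (\<mu>0 \<Otimes>\<^sub>M \<mu>0)"
      unfolding b_def by (rule measurable_pistar_snd) (auto intro: measurable_expect_policy_episode)
    have me: "e \<in> borel_measurable \<mu>0" unfolding e_def by measurable
    have eb: "\<bar>e \<theta>\<bar> \<le> (\<Sum>i\<in>triples M. 4)" if "\<theta> \<in> \<Theta>" for \<theta>
      unfolding e_def by (rule sum_excess_bound[OF that y' x])
    have ib: "integrable (\<rho>2 t y) b"
      by (rule integrable_rho2[OF y mb]) (auto simp: b_def intro!: bonus_episode_bound x)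
    have iN: "integrable (\<rho>2 t y) N"
      by (rule integrable_rho2[OF y mN, of 1]) (use N01 in auto)
    have me1: "(\<lambda>p. e (fst p)) \<in> borel_measurable (\<mu>0 \<Otimes>\<^sub>M \<mu>0)" by (rule measurable_compose[OF measurable_fst me])
    have me2: "(\<lambda>p. e (snd p)) \<in> borel_measurable (\<mu>0 \<Otimes>\<^sub>M \<mu>0)" by (rule measurable_compose[OF measurable_snd me])
    have ie1: "integrable (\<rho>2 t y) (\<lambda>p. e (fst p))"
      by (rule integrable_rho2[OF y me1]) (use eb in auto)
    have ie2: "integrable (\<rho>2 t y) (\<lambda>p. e (snd p))"
      by (rule integrable_rho2[OF y me2]) (use eb in auto)
    have e1: "(LINT p|\<rho>2 t y. e (fst p)) = (LINT \<theta>|\<rho> t y. e \<theta>)"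
      by (rule integral_rho2_fst[OF y me eb])
    \<comment> \<open>The excess of the sampled kernel costs on average as much as that of the true
      one. Only for the latter were the data generated by the kernel in question, as the
      supermartingale bound requires.\<close>
    have e2: "(LINT p|\<rho>2 t y. e (snd p)) = (LINT \<theta>|\<rho> t y. e \<theta>)"
      using integral_rho2_swap[OF y me1] e1 by simp
    have mNw1: "(\<lambda>p. N p * w (fst p)) \<in> borel_measurable (\<mu>0 \<Otimes>\<^sub>M \<mu>0)"
      by (intro borel_measurable_times mN measurable_compose[OF measurable_fst mw])
    have mNw2: "(\<lambda>p. N p * w (snd p)) \<in> borel_measurable (\<mu>0 \<Otimes>\<^sub>M \<mu>0)"
      by (intro borel_measurable_times mN measurable_compose[OF measurable_snd mw])
    have mNu: "(\<lambda>p. N p * u p) \<in> borel_measurable (\<mu>0 \<Otimes>\<^sub>M \<mu>0)"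
      by (intro borel_measurable_times mN mu)
    have Nle: "\<bar>N p * r\<bar> \<le> real H + 1" if "\<bar>r\<bar> \<le> real H + 1" for p r
      using that by (auto simp: N_def)
    have iNw1: "integrable (\<rho>2 t y) (\<lambda>p. N p * w (fst p))"
      by (rule integrable_rho2[OF y mNw1]) (auto intro!: Nle wb)
    have iNw2: "integrable (\<rho>2 t y) (\<lambda>p. N p * w (snd p))"
      by (rule integrable_rho2[OF y mNw2]) (auto intro!: Nle wb)
    have iNu: "integrable (\<rho>2 t y) (\<lambda>p. N p * u p)"
      by (rule integrable_rho2[OF y mNu]) (auto intro!: Nle ub)
    have "(LINT p|\<rho>2 t y. w (fst p) - u p) = (LINT p|\<rho>2 t y. N p * w (fst p) - N p * u p)"
      by (intro Bochner_Integration.integral_cong refl) (auto simp: N_def w_def u_def)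
    also have "\<dots> = (LINT p|\<rho>2 t y. N p * w (fst p)) - (LINT p|\<rho>2 t y. N p * u p)"
      by (rule Bochner_Integration.integral_diff[OF iNw1 iNu])
    also have "(LINT p|\<rho>2 t y. N p * w (fst p)) = (LINT p|\<rho>2 t y. N p * w (snd p))"
      using integral_rho2_swap[OF y mNw1] by (simp add: N_def eq_commute)
    also have "(LINT p|\<rho>2 t y. N p * w (snd p)) - (LINT p|\<rho>2 t y. N p * u p)
        = (LINT p|\<rho>2 t y. N p * w (snd p) - N p * u p)"
      by (rule Bochner_Integration.integral_diff[OF iNw2 iNu, symmetric])
    also have "\<dots> \<le> (LINT p|\<rho>2 t y. c / 2 * N p + k * (4 * b p + 2 * e (fst p) + 2 * e (snd p)))"
    proof (rule integral_mono)
      show "integrable (\<rho>2 t y) (\<lambda>p. c / 2 * N p + k * (4 * b p + 2 * e (fst p) + 2 * e (snd p)))"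
        by (intro Bochner_Integration.integrable_add integrable_mult_right iN ib ie1 ie2)
      fix p assume "p \<in> space (\<rho>2 t y)"
      then obtain \<theta> \<theta>' where p: "p = (\<theta>, \<theta>')" "\<theta> \<in> \<Theta>" "\<theta>' \<in> \<Theta>" by (auto simp: space_rho2)
      have e0: "0 \<le> e \<theta>" for \<theta> by (simp add: e_def sum_nonneg excess_nonneg)
      have b0: "0 \<le> b p"
        unfolding b_def using finite_set_episode[OF in_kernels[OF p(2)] valid_det_policy[OF pistar_in[OF p(3)]]]
        by (intro expect_ge_const) (auto simp: p step_sum_def intro!: sum_nonneg bonus_nonneg x)
      show "N p * w (snd p) - N p * u p \<le> c / 2 * N p + k * (4 * b p + 2 * e (fst p) + 2 * e (snd p))"
      proof (cases "pistar \<theta>' = pistar \<theta>")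
        case True
        then show ?thesis using e0 b0 k by (simp add: N_def p)
      next
        case False
        then show ?thesis
          using init_value_diff_le[of \<theta> \<theta>' "pistar \<theta>'" c x "snd y"] p c
          by (simp add: N_def w_def u_def k_def b_def e_def)
      qed
    qed (intro Bochner_Integration.integrable_diff iNw2 iNu)
    also have "\<dots> = c / 2 * (LINT p|\<rho>2 t y. N p) + k * (4 * (LINT p|\<rho>2 t y. b p)
        + 2 * (LINT p|\<rho>2 t y. e (fst p)) + 2 * (LINT p|\<rho>2 t y. e (snd p)))"
      by (simp add: iN ib ie1 ie2)
    also have "\<dots> = c / 2 * (LINT p|\<rho>2 t y. N p) + k * (4 * (LINT p|\<rho>2 t y. b p) + 4 * (LINT \<theta>|\<rho> t y. e \<theta>))"
      unfolding e1 e2 by simp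
    finally show ?thesis unfolding b_def e_def .
  qed
  then have "(LINT \<theta>|\<mu>0. round_regret t \<theta>) \<le> (\<Sum>y\<in>pos_obs t. Z t y * (c / 2 * (LINT p|\<rho>2 t y. N p)
      + k * (4 * (LINT p|\<rho>2 t y. expect (episode M (fst p) (det_policy (pistar (snd p))))
          (\<lambda>\<tau>. step_sum (\<lambda>i. bonus x (visit_count (snd y) i)) 0 (fst \<tau>)))
        + 4 * (LINT \<theta>|\<rho> t y. (\<Sum>i\<in>triples M. excess M x \<theta> (snd y) i)))))"
    unfolding integral_round_regret by (intro sum_mono mult_left_mono) (auto simp: w_def u_def evidence_nonneg)
  also have "\<dots> = c / 2 * (LINT \<theta>|\<mu>0. mismatch t \<theta>)
    + k * (4 * (LINT \<theta>|\<mu>0. bonus_cost x t \<theta>) + 4 * (LINT \<theta>|\<mu>0. excess_cost x t \<theta>))"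
    unfolding integral_mismatch integral_bonus_cost[OF x] integral_excess_cost[OF x] N_def
    by (simp add: distrib_left sum.distrib sum_distrib_left mult_ac)
  finally show ?thesis unfolding k_def .
qed

end

subsection \<open>Summing over the episodes\<close>

text \<open>Convexity of \<open>f\<^sup>2 / w\<close> in the pair, the Engel form of Cauchy-Schwarz:
  each term lies above its tangent \<open>2 * m * f i - m\<^sup>2 * w i\<close>, with
  \<open>m\<close> the ratio of the totals. The second assumption makes
  \<open>f\<^sup>2 / 0 = 0\<close> the right value.\<close>

lemma sum_sq_divide_ge:
  fixes f w :: "'a \<Rightarrow> real"
  assumes "\<And>i. i \<in> I \<Longrightarrow> 0 \<le> w i" "\<And>i. i \<in> I \<Longrightarrow> w i = 0 \<Longrightarrow> f i = 0"
  shows "(\<Sum>i\<in>I. f i)\<^sup>2 / (\<Sum>i\<in>I. w i) \<le> (\<Sum>i\<in>I. (f i)\<^sup>2 / w i)"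
proof (cases "(\<Sum>i\<in>I. w i) = 0")
  case True
  then show ?thesis using assms(1) by (auto intro!: sum_nonneg)
next
  case False
  define m where "m = (\<Sum>i\<in>I. f i) / (\<Sum>i\<in>I. w i)"
  have "2 * m * f i - m\<^sup>2 * w i \<le> (f i)\<^sup>2 / w i" if i: "i \<in> I" for i
  proof (cases "w i = 0")
    case False
    then have "0 < w i" using assms(1)[OF i] by simp
    moreover have "0 \<le> (f i - m * w i)\<^sup>2" by simp
    ultimately show ?thesis by (simp add: field_simps power2_eq_square)
  qed (use assms(2)[OF i] in simp)
  then have "(\<Sum>i\<in>I. 2 * m * f i - m\<^sup>2 * w i) \<le> (\<Sum>i\<in>I. (f i)\<^sup>2 / w i)"
    by (rule sum_mono)
  also have "(\<Sum>i\<in>I. 2 * m * f i - m\<^sup>2 * w i) = 2 * m * (\<Sum>i\<in>I. f i) - m\<^sup>2 * (\<Sum>i\<in>I. w i)"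
    by (simp add: sum_subtractf sum_distrib_left)
  also have "\<dots> = (\<Sum>i\<in>I. f i)\<^sup>2 / (\<Sum>i\<in>I. w i)"
    using False by (simp add: m_def field_simps power2_eq_square)
  finally show ?thesis .
qed

context bayes_mdp
begin

text \<open>The expectation of a functional that is additive over episodes splits into increments
  \<open>G y\<close>, taken at the data before each episode. It is applied to the regret and to the
  potential.\<close>

lemma expect_telescope:
  assumes \<theta>: "\<theta> \<in> \<Theta>"
    and step: "\<And>t y \<tau>. y \<in> obs t \<Longrightarrow> \<tau> \<in> trajs M H \<Longrightarrow> F (fst y, snd y @ [\<tau>]) = F y + G y \<tau>"
    and zero: "\<And>y. y \<in> obs 0 \<Longrightarrow> F y = 0"
  shows "expect (obs_law T \<theta>) F = (\<Sum>t<T. expect (obs_law t \<theta>) (\<lambda>y. expect (post_policy (obs_law t) y)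
    (\<lambda>\<pi>. expect (episode M \<theta> (det_policy \<pi>)) (G y))))"
proof (induction T)
  case 0
  have "expect (obs_law 0 \<theta>) F = expect (obs_law 0 \<theta>) (\<lambda>_. 0)"
    using set_obs_law[OF \<theta>, of 0] zero by (intro expect_cong) blast
  then show ?case by simp
next
  case (Suc T)
  have e: "expect (episode M \<theta> (det_policy \<pi>)) (\<lambda>\<tau>. F (fst y, snd y @ [\<tau>]))
      = F y + expect (episode M \<theta> (det_policy \<pi>)) (G y)"
    if "y \<in> obs T" "\<pi> \<in> policies M" for y \<pi>
  proof -
    note v = valid_det_policy[OF that(2)]
    have "expect (episode M \<theta> (det_policy \<pi>)) (\<lambda>\<tau>. F (fst y, snd y @ [\<tau>]))
        = expect (episode M \<theta> (det_policy \<pi>)) (\<lambda>\<tau>. F y + G y \<tau>)"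
      using set_episode[OF in_kernels[OF \<theta>] v] step[OF that(1)] by (intro expect_cong) blast
    then show ?thesis by (simp add: expect_add[OF finite_set_episode[OF in_kernels[OF \<theta>] v]])
  qed
  have "expect (obs_law (Suc T) \<theta>) F = expect (obs_law T \<theta>) (\<lambda>y. expect (post_policy (obs_law T) y)
      (\<lambda>\<pi>. F y + expect (episode M \<theta> (det_policy \<pi>)) (G y)))"
    unfolding expect_obs_law_Suc[OF \<theta>] using set_obs_law[OF \<theta>, of T] set_obs_policy[of T]
    by (intro expect_cong e) blast+
  also have "\<dots> = expect (obs_law T \<theta>) F + expect (obs_law T \<theta>) (\<lambda>y. expect (post_policy (obs_law T) y)
      (\<lambda>\<pi>. expect (episode M \<theta> (det_policy \<pi>)) (G y)))"
    by (simp add: expect_add[OF finite_set_obs_law[OF \<theta>]]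
        expect_add[OF finite_subset[OF set_obs_policy finite_policies]])
  finally show ?case by (simp add: Suc.IH)
qed

lemma expect_total_regret:
  assumes "\<theta> \<in> \<Theta>"
  shows "expect (obs_law T \<theta>) (\<lambda>y. \<Sum>t<length (snd y). opt_V M \<theta> 0 (init_state (snd y ! t)) - total_reward M (snd y ! t))
    = (\<Sum>t<T. round_regret t \<theta>)"
  unfolding round_regret_def
  by (rule expect_telescope[OF assms]) (auto simp: nth_append obs_def datasets_def)

text \<open>The bonuses along the episodes add up to the final potential, which is bounded on every
  path; no probabilistic argument is involved.\<close>

lemma sum_bonus_cost:
  assumes "\<theta> \<in> \<Theta>" "1 \<le> T" "0 \<le> x"
  shows "(\<Sum>t<T. bonus_cost x t \<theta>) \<le> real (card (triples M)) * (4 + x * (1 + ln (real T)))"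
proof -
  have "(\<Sum>t<T. bonus_cost x t \<theta>) = expect (obs_law T \<theta>) (\<lambda>y. potential M x (snd y))"
    unfolding bonus_cost_def
    by (rule expect_telescope[OF assms(1), symmetric])
       (auto simp: potential_append obs_def datasets_def, simp add: potential_def visit_count_def)
  also have "\<dots> \<le> real (card (triples M)) * (4 + x * (1 + ln (real T)))"
    using set_obs_law[OF assms(1), of T] length_obs
    by (intro expect_le_const finite_set_obs_law potential_le assms) (auto dest!: subsetD)
  finally show ?thesis .
qed

text \<open>The supermartingale property: the next policy is drawn using past data only, and the
  bound for one episode holds for every policy.\<close>

lemma expect_mgf_factors:
  assumes \<theta>: "\<theta> \<in> \<Theta>" and i: "i \<in> triples M" and \<sigma>: "\<And>s. s \<in> S \<Longrightarrow> \<bar>\<sigma> s\<bar> \<le> 1" and l: "0 \<le> l"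
  shows "expect (obs_law t \<theta>) (\<lambda>y. prod_list (map (mgf_factor \<theta> i \<sigma> l 0) (snd y))) \<le> 1"
proof (induction t)
  case 0
  then show ?case by simp
next
  case (Suc t)
  define P where "P = (\<lambda>y :: observation. prod_list (map (mgf_factor \<theta> i \<sigma> l 0) (snd y)))"
  have P: "0 \<le> P y" for y
    unfolding P_def by (intro prod_list_nonneg) (auto simp: mgf_factor_def)
  have "expect (obs_law (Suc t) \<theta>) P = expect (obs_law t \<theta>) (\<lambda>y. expect (post_policy (obs_law t) y)
      (\<lambda>\<pi>. P y * expect (episode M \<theta> (det_policy \<pi>)) (mgf_factor \<theta> i \<sigma> l 0)))"
    unfolding expect_obs_law_Suc[OF \<theta>] by (simp add: P_def)
  also have "\<dots> \<le> expect (obs_law t \<theta>) P"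
  proof (intro expect_mono finite_set_obs_law[OF \<theta>] expect_le_const finite_subset[OF set_obs_policy finite_policies])
    fix y \<pi> assume "\<pi> \<in> set_pmf (post_policy (obs_law t) y)"
    then have "\<pi> \<in> policies M" using set_obs_policy by blast
    then have "expect (episode M \<theta> (det_policy \<pi>)) (mgf_factor \<theta> i \<sigma> l 0) \<le> 1"
      using \<theta> by (intro expect_mgf_factor_episode valid_det_policy i \<sigma> l) auto
    from mult_left_mono[OF this P] show "P y * expect (episode M \<theta> (det_policy \<pi>)) (mgf_factor \<theta> i \<sigma> l 0) \<le> P y"
      by simp
  qed
  finally show ?case using Suc.IH unfolding P_def by linarith
qed

text \<open>Each of the \<open>T * 2 ^ card S\<close> products in \<open>excess_le\<close> has
  expectation at most 1. This holds for every single kernel, before averaging over the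
  prior.\<close>

lemma excess_cost_le:
  assumes \<theta>: "\<theta> \<in> \<Theta>" and "t \<le> T" "0 \<le> x"
  shows "excess_cost x t \<theta> \<le> real (card (triples M)) * (4 * exp (- x / 2) * (real T * 2 ^ card S))"
proof -
  note fin = finite_set_obs_law[OF \<theta>, of t]
  have "expect (obs_law t \<theta>) (\<lambda>y. excess M x \<theta> (snd y) i) \<le> 4 * exp (- x / 2) * (real T * 2 ^ card S)"
    if i: "i \<in> triples M" for i
  proof -
    have "expect (obs_law t \<theta>) (\<lambda>y. excess M x \<theta> (snd y) i)
        \<le> expect (obs_law t \<theta>) (\<lambda>y. 4 * exp (- x / 2) *
          (\<Sum>n=1..T. \<Sum>\<sigma>\<in>signs M. prod_list (map (mgf_factor \<theta> i \<sigma> (sqrt (x / real n)) 0) (snd y))))"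
      using set_obs_law[OF \<theta>, of t] set_obs length_obs assms i
      by (intro expect_mono fin excess_le) (auto dest!: subsetD)
    also have "\<dots> = 4 * exp (- x / 2) * (\<Sum>n=1..T. \<Sum>\<sigma>\<in>signs M.
        expect (obs_law t \<theta>) (\<lambda>y. prod_list (map (mgf_factor \<theta> i \<sigma> (sqrt (x / real n)) 0) (snd y))))"
      by (simp add: expect_sum[OF fin])
    also have "\<dots> \<le> 4 * exp (- x / 2) * (\<Sum>n=1..T. \<Sum>\<sigma>\<in>signs M. 1)"
      using assms i
      by (intro mult_left_mono sum_mono expect_mgf_factors) (auto simp: signs_def PiE_iff)
    also have "(\<Sum>n=1..T. \<Sum>\<sigma>\<in>signs M. 1) = real T * 2 ^ card S"
      by (simp add: card_signs)
    finally show ?thesis .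
  qed
  then have "(\<Sum>i\<in>triples M. expect (obs_law t \<theta>) (\<lambda>y. excess M x \<theta> (snd y) i))
      \<le> (\<Sum>i\<in>triples M. 4 * exp (- x / 2) * (real T * 2 ^ card S))"
    by (rule sum_mono)
  then show ?thesis by (simp add: excess_cost_def expect_sum[OF fin])
qed

section \<open>The mismatch probability does not increase\<close>

text \<open>Forgetting the last episode gives back the earlier law; the martingale property of the
  posterior rests on this.\<close>

lemma obs_law_marginal:
  "map_pmf (\<lambda>z. (fst z, butlast (snd z))) (obs_law (Suc t) \<theta>) = obs_law t \<theta>"
proof -
  have "map_pmf (\<lambda>z. (fst z, butlast (snd z))) (obs_law (Suc t) \<theta>) = bind_pmf (obs_law t \<theta>) return_pmf"
    by (simp add: map_bind_pmf pmf.map_comp o_def)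
  then show ?thesis by (simp add: bind_return_pmf')
qed

lemma sum_obs_Suc: "(\<Sum>z\<in>obs (Suc t). f z) = (\<Sum>y\<in>obs t. \<Sum>\<tau>\<in>trajs M H. f (fst y, snd y @ [\<tau>]))"
proof -
  have "bij_betw (\<lambda>(y, \<tau>). (fst y, snd y @ [\<tau>])) (obs t \<times> trajs M H) (obs (Suc t))"
  proof (rule bij_betwI')
    fix p p'
    show "((case p of (y, \<tau>) \<Rightarrow> (fst y, snd y @ [\<tau>])) = (case p' of (y, \<tau>) \<Rightarrow> (fst y, snd y @ [\<tau>]))) = (p = p')"
      by (cases p; cases p'; cases "fst p"; cases "fst p'") simp
  next
    fix p assume "p \<in> obs t \<times> trajs M H"
    then obtain D es \<tau> where "p = ((D, es), \<tau>)" "(D, es) \<in> obs t" "\<tau> \<in> trajs M H"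
      by (metis mem_Times_iff prod.collapse)
    then show "(case p of (y, \<tau>) \<Rightarrow> (fst y, snd y @ [\<tau>])) \<in> obs (Suc t)"
      by (simp add: obs_def datasets_def)
  next
    fix z assume z: "z \<in> obs (Suc t)"
    then have D: "fst z \<in> datasets L" and es: "set (snd z) \<subseteq> trajs M H" "length (snd z) = Suc t"
      by (auto simp: obs_def datasets_def)
    have ne: "snd z \<noteq> []" using es(2) by auto
    have "set (butlast (snd z)) \<subseteq> trajs M H" "last (snd z) \<in> trajs M H"
      using es(1) in_set_butlastD[of _ "snd z"] last_in_set[OF ne] by blast+
    then have mem: "((fst z, butlast (snd z)), last (snd z)) \<in> obs t \<times> trajs M H"
      using D es(2) by (simp add: obs_def datasets_def)
    show "\<exists>p\<in>obs t \<times> trajs M H. z = (case p of (y, \<tau>) \<Rightarrow> (fst y, snd y @ [\<tau>]))"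
      by (rule bexI[OF _ mem]) (simp add: ne)
  qed
  from sum.reindex_bij_betw[OF this, of f] show ?thesis
    by (simp add: sum.cartesian_product case_prod_unfold)
qed

lemma sum_likelihood_Suc:
  assumes "\<theta> \<in> \<Theta>" "y \<in> obs t"
  shows "(\<Sum>\<tau>\<in>trajs M H. pmf (obs_law (Suc t) \<theta>) (fst y, snd y @ [\<tau>])) = pmf (obs_law t \<theta>) y"
proof -
  have "pmf (obs_law t \<theta>) y = expect (map_pmf (\<lambda>z. (fst z, butlast (snd z))) (obs_law (Suc t) \<theta>)) (indicator {y})"
    unfolding obs_law_marginal expect_indicator ..
  also have "\<dots> = (\<Sum>z\<in>obs (Suc t). pmf (obs_law (Suc t) \<theta>) z * indicator {y} (fst z, butlast (snd z)))"
    unfolding integral_map_pmf by (rule expect_finite[OF finite_obs set_obs_law[OF assms(1)]])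
  also have "\<dots> = (\<Sum>y'\<in>obs t. if y = y' then (\<Sum>\<tau>\<in>trajs M H. pmf (obs_law (Suc t) \<theta>) (fst y', snd y' @ [\<tau>])) else 0)"
    unfolding sum_obs_Suc by (intro sum.cong) (auto simp: indicator_def)
  finally show ?thesis using assms(2) by simp
qed

text \<open>The joint probability of the data \<open>y\<close> and of the event that
  \<open>pistar\<close> selects \<open>\<pi>\<close>, that is, the posterior mass before
  normalisation. Such masses simply add up over the continuations of \<open>y\<close>, so no
  conditional expectations are needed.\<close>

definition policy_evidence :: "nat \<Rightarrow> policy \<Rightarrow> observation \<Rightarrow> real" where
  "policy_evidence t \<pi> y = (LINT \<theta>|\<mu>0. pmf (obs_law t \<theta>) y * indicator {\<theta> \<in> \<Theta>. pistar \<theta> = \<pi>} \<theta>)"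

lemma integrable_policy_evidence:
  "integrable \<mu>0 (\<lambda>\<theta>. pmf (obs_law t \<theta>) y * indicator {\<theta> \<in> \<Theta>. pistar \<theta> = \<pi>} \<theta>)"
  by (rule integrable_real_mult_indicator[OF measurable_pistar_eq
        integrable_likelihood[of "obs_law t", OF measurable_obs_law]])

lemma policy_evidence_bounds: "0 \<le> policy_evidence t \<pi> y" "policy_evidence t \<pi> y \<le> Z t y"
proof -
  show "0 \<le> policy_evidence t \<pi> y" by (simp add: policy_evidence_def)
  show "policy_evidence t \<pi> y \<le> Z t y"
    unfolding policy_evidence_def evidence_def
    by (intro integral_mono integrable_policy_evidence integrable_likelihood measurable_obs_law)
       (auto simp: indicator_def)
qed

lemma sum_evidence_Suc:
  assumes "y \<in> obs t"
  shows "(\<Sum>\<tau>\<in>trajs M H. policy_evidence (Suc t) \<pi> (fst y, snd y @ [\<tau>])) = policy_evidence t \<pi> y"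
    and "(\<Sum>\<tau>\<in>trajs M H. Z (Suc t) (fst y, snd y @ [\<tau>])) = Z t y"
proof -
  have "(\<Sum>\<tau>\<in>trajs M H. policy_evidence (Suc t) \<pi> (fst y, snd y @ [\<tau>]))
      = (LINT \<theta>|\<mu>0. (\<Sum>\<tau>\<in>trajs M H. pmf (obs_law (Suc t) \<theta>) (fst y, snd y @ [\<tau>])
          * indicator {\<theta> \<in> \<Theta>. pistar \<theta> = \<pi>} \<theta>))"
    unfolding policy_evidence_def
    by (intro Bochner_Integration.integral_sum[symmetric] integrable_policy_evidence)
  also have "\<dots> = policy_evidence t \<pi> y"
    unfolding policy_evidence_def sum_distrib_right[symmetric]
    by (intro Bochner_Integration.integral_cong refl) (simp only: space_prior sum_likelihood_Suc[OF _ assms])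
  finally show "(\<Sum>\<tau>\<in>trajs M H. policy_evidence (Suc t) \<pi> (fst y, snd y @ [\<tau>])) = policy_evidence t \<pi> y" .
  have "(\<Sum>\<tau>\<in>trajs M H. Z (Suc t) (fst y, snd y @ [\<tau>]))
      = (LINT \<theta>|\<mu>0. (\<Sum>\<tau>\<in>trajs M H. pmf (obs_law (Suc t) \<theta>) (fst y, snd y @ [\<tau>])))"
    unfolding evidence_def
    by (intro Bochner_Integration.integral_sum[symmetric] integrable_likelihood measurable_obs_law)
  also have "\<dots> = Z t y"
    unfolding evidence_def
    by (intro Bochner_Integration.integral_cong refl) (simp only: space_prior sum_likelihood_Suc[OF _ assms])
  finally show "(\<Sum>\<tau>\<in>trajs M H. Z (Suc t) (fst y, snd y @ [\<tau>])) = Z t y" .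
qed

lemma policy_evidence_eq:
  assumes "y \<in> pos_obs t"
  shows "policy_evidence t \<pi> y = Z t y * pmf (post_policy (obs_law t) y) \<pi>"
proof -
  have pos: "0 < Z t y" using assms by (simp add: pos_obs_def)
  interpret prob_space "\<rho> t y" by (rule prob_space_rho[OF assms])
  have "pmf (post_policy (obs_law t) y) \<pi> = (LINT \<theta>|\<rho> t y. indicator {\<theta> \<in> \<Theta>. pistar \<theta> = \<pi>} \<theta>)"
    by (simp add: pmf_post_policy[of "obs_law t", OF measurable_obs_law pos] Int_absorb2 Collect_mono_iff)
  also have "\<dots> = (LINT \<theta>|\<mu>0. (pmf (obs_law t \<theta>) y / Z t y) *\<^sub>R indicator {\<theta> \<in> \<Theta>. pistar \<theta> = \<pi>} \<theta>)"
    unfolding post_def using pos measurable_pistar_eq by (intro integral_density) auto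
  also have "\<dots> = policy_evidence t \<pi> y / Z t y"
    by (simp add: policy_evidence_def)
  finally show ?thesis using pos by simp
qed

text \<open>
  The mismatch probability is one minus the expected collision probability of the posterior law
  of the optimal policy. Posteriors are martingales, so the latter increases, by convexity.
\<close>

lemma integral_mismatch_eq:
  "(LINT \<theta>|\<mu>0. mismatch t \<theta>)
    = 1 - (\<Sum>\<pi>\<in>policies M. \<Sum>y\<in>obs t. (policy_evidence t \<pi> y)\<^sup>2 / Z t y)"
proof -
  have one: "(\<Sum>y\<in>obs t. Z t y) = 1"
  proof -
    have "(LINT \<theta>|\<mu>0. expect (obs_law t \<theta>) (\<lambda>_. 1)) = (\<Sum>y\<in>obs t. LINT \<theta>|\<mu>0. pmf (obs_law t \<theta>) y * 1)"
      by (rule integrable_obs_law(2)[where B = "\<lambda>_. 1"]) auto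
    then show ?thesis by (simp add: evidence_def prior.prob_space[unfolded space_prior])
  qed
  have eq: "Z t y * (LINT x|\<rho>2 t y. of_bool (pistar (snd x) \<noteq> pistar (fst x)))
      = Z t y - (\<Sum>\<pi>\<in>policies M. (policy_evidence t \<pi> y)\<^sup>2 / Z t y)" if y: "y \<in> pos_obs t" for y
  proof -
    have pos: "0 < Z t y" using y by (simp add: pos_obs_def)
    note pp = expect_post_policy[of "obs_law t", OF measurable_obs_law pos]
    define q where "q = pmf (post_policy (obs_law t) y)"
    have m: "(\<lambda>x. of_bool (pistar (snd x) \<noteq> pistar (fst x)) :: real) \<in> borel_measurable (\<mu>0 \<Otimes>\<^sub>M \<mu>0)"
      by (rule measurable_pistar_snd) (rule measurable_policy_mismatch)
    have "integrable (\<rho>2 t y) (\<lambda>x. of_bool (pistar (snd x) \<noteq> pistar (fst x)) :: real)"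
      by (rule integrable_rho2[OF y m, of 1]) auto
    from integral_rho2[OF y this]
    have "(LINT x|\<rho>2 t y. of_bool (pistar (snd x) \<noteq> pistar (fst x)))
        = (LINT \<theta>|\<rho> t y. LINT \<theta>'|\<rho> t y. (of_bool (pistar \<theta>' \<noteq> pistar \<theta>) :: real))"
      by simp
    also have "\<dots> = expect (post_policy (obs_law t) y) (\<lambda>\<pi>. expect (post_policy (obs_law t) y) (\<lambda>\<pi>'. of_bool (\<pi>' \<noteq> \<pi>)))"
      unfolding pp[of "\<lambda>\<pi>'. of_bool (\<pi>' \<noteq> _)"] by (rule pp)
    also have "\<dots> = expect (post_policy (obs_law t) y) (\<lambda>\<pi>. 1 - q \<pi>)"
    proof (rule expect_cong)
      fix \<pi>
      have "expect (post_policy (obs_law t) y) (\<lambda>\<pi>'. of_bool (\<pi>' \<noteq> \<pi>))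
          = expect (post_policy (obs_law t) y) (\<lambda>\<pi>'. 1 - indicator {\<pi>} \<pi>')"
        by (rule expect_cong) (auto simp: indicator_def)
      then show "expect (post_policy (obs_law t) y) (\<lambda>\<pi>'. of_bool (\<pi>' \<noteq> \<pi>)) = 1 - q \<pi>"
        unfolding expect_diff[OF finite_subset[OF set_obs_policy finite_policies]]
        by (simp add: measure_pmf_single q_def)
    qed
    also have "\<dots> = 1 - (\<Sum>\<pi>\<in>policies M. (q \<pi>)\<^sup>2)"
      unfolding expect_diff[OF finite_subset[OF set_obs_policy finite_policies]]
      by (simp add: expect_finite[OF finite_policies set_obs_policy] q_def power2_eq_square)
    finally show ?thesis
      using pos
      by (simp add: policy_evidence_eq[OF y] q_def right_diff_distrib sum_distrib_left power_mult_distrib power2_eq_square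
          mult_ac)
  qed
  \<comment> \<open>Quotients with \<open>Z t y = 0\<close> are 0 by convention, so the sum may run
    over all of \<open>obs t\<close>, which splits neatly when \<open>t\<close> increases.\<close>
  have "(\<Sum>y\<in>pos_obs t. Z t y - (\<Sum>\<pi>\<in>policies M. (policy_evidence t \<pi> y)\<^sup>2 / Z t y))
      = (\<Sum>y\<in>obs t. Z t y - (\<Sum>\<pi>\<in>policies M. (policy_evidence t \<pi> y)\<^sup>2 / Z t y))"
  proof (rule sum.mono_neutral_left)
    show "\<forall>y\<in>obs t - pos_obs t. Z t y - (\<Sum>\<pi>\<in>policies M. (policy_evidence t \<pi> y)\<^sup>2 / Z t y) = 0"
    proof
      fix y assume "y \<in> obs t - pos_obs t"
      then have "Z t y = 0" using evidence_nonneg[of "obs_law t" y] by (simp add: pos_obs_def)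
      then show "Z t y - (\<Sum>\<pi>\<in>policies M. (policy_evidence t \<pi> y)\<^sup>2 / Z t y) = 0" by simp
    qed
  qed (auto simp: pos_obs_def)
  then show ?thesis
    unfolding integral_mismatch
    by (simp add: eq sum_subtractf one sum.swap[of _ "obs t" "policies M"])
qed

text \<open>Each \<open>y\<close> is split into its continuations by one trajectory. Numerators
  before squaring and denominators both add up over these, so \<open>sum_sq_divide_ge\<close>
  applies.\<close>

lemma integral_mismatch_antimono: "(LINT \<theta>|\<mu>0. mismatch (Suc t) \<theta>) \<le> (LINT \<theta>|\<mu>0. mismatch t \<theta>)"
proof -
  have "(policy_evidence t \<pi> y)\<^sup>2 / Z t y
      \<le> (\<Sum>\<tau>\<in>trajs M H. (policy_evidence (Suc t) \<pi> (fst y, snd y @ [\<tau>]))\<^sup>2 / Z (Suc t) (fst y, snd y @ [\<tau>]))"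
    if "y \<in> obs t" for y \<pi>
    unfolding sum_evidence_Suc[OF that, symmetric]
    \<comment> \<open>\<open>policy_evidence\<close> lies between 0 and \<open>Z\<close>, so it
      vanishes wherever \<open>Z\<close> does.\<close>
    using policy_evidence_bounds[of "Suc t" \<pi>]
    by (intro sum_sq_divide_ge evidence_nonneg) (metis order_antisym)
  then show ?thesis
    unfolding integral_mismatch_eq sum_obs_Suc
    by (intro diff_left_mono sum_mono)
qed

lemma integral_mismatch_le: "(LINT \<theta>|\<mu>0. mismatch t \<theta>) \<le> (LINT \<theta>|\<mu>0. mismatch 0 \<theta>)"
  using integral_mismatch_antimono by (induction t) (auto intro: order_trans)

section \<open>Regret and first error expressed through \<open>obs_law\<close>\<close>

lemma prob_space_ipsrl: "prob_space (J t)"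
  by (rule prob_space_J[OF sets_ipsrl nn_integral_ipsrl])

lemma AE_observed_ipsrl: "AE \<omega> in J t. observed \<omega> \<in> obs t"
  by (rule AE_observed_J[OF sets_ipsrl nn_integral_ipsrl])

lemma space_ipsrl: "space (J t) = \<Theta> \<times> RS"
  using sets_eq_imp_space_eq[OF sets_ipsrl] by (simp add: space_OS)

text \<open>What is known about \<open>J T\<close> concerns nonnegative integrals. Adding the bound
  \<open>B\<close> makes the integrand nonnegative on \<open>obs T\<close>, and outside, where there
  is no mass, \<open>G\<close> is set to 0.\<close>

lemma integral_ipsrl:
  assumes meas: "\<And>y. y \<in> obs T \<Longrightarrow> (\<lambda>\<theta>. F \<theta> y) \<in> borel_measurable \<mu>0"
    and bound: "\<And>\<theta> y. \<theta> \<in> \<Theta> \<Longrightarrow> y \<in> obs T \<Longrightarrow> \<bar>F \<theta> y\<bar> \<le> B"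
    and \<Phi>: "\<Phi> \<in> borel_measurable OS"
    and eq: "\<And>\<omega>. \<omega> \<in> \<Theta> \<times> RS \<Longrightarrow> observed \<omega> \<in> obs T \<Longrightarrow> \<Phi> \<omega> = F (fst \<omega>) (observed \<omega>)"
  shows "(LINT \<omega>|J T. \<Phi> \<omega>) = (LINT \<theta>|\<mu>0. expect (obs_law T \<theta>) (F \<theta>))"
proof -
  interpret P: prob_space "J T" by (rule prob_space_ipsrl)
  define G where "G = (\<lambda>(\<theta>, y). if y \<in> obs T then F \<theta> y + B else 0)"
  have F0: "0 \<le> F \<theta> y + B" if "\<theta> \<in> \<Theta>" "y \<in> obs T" for \<theta> y
    using bound[OF that] by linarith
  have G: "(\<lambda>x. G (fst x, snd x)) \<in> borel_measurable (\<mu>0 \<Otimes>\<^sub>M count_space UNIV)"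
  proof (rule measurable_compose_countable'[where I = UNIV and g = snd and f = "\<lambda>y x. G (fst x, y)"])
    fix y :: observation
    have "(\<lambda>\<theta>. G (\<theta>, y)) \<in> borel_measurable \<mu>0" using meas by (cases "y \<in> obs T") (simp_all add: G_def)
    from measurable_compose[OF measurable_fst this]
    show "(\<lambda>x. G (fst x, y)) \<in> borel_measurable (\<mu>0 \<Otimes>\<^sub>M count_space UNIV)" .
  qed auto
  then have G': "G \<in> borel_measurable (\<mu>0 \<Otimes>\<^sub>M count_space UNIV)" by simp
  have GJ: "(\<lambda>\<omega>. G (fst \<omega>, observed \<omega>)) \<in> borel_measurable (J T)"
    unfolding measurable_cong_sets[OF sets_ipsrl refl] by (rule measurable_compose[OF measurable_fst_observed G'])
  have \<Phi>J: "\<Phi> \<in> borel_measurable (J T)" unfolding measurable_cong_sets[OF sets_ipsrl refl] by (rule \<Phi>)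
  have AE: "AE \<omega> in J T. \<Phi> \<omega> + B = G (fst \<omega>, observed \<omega>) \<and> \<bar>\<Phi> \<omega>\<bar> \<le> B \<and> 0 \<le> G (fst \<omega>, observed \<omega>)"
    using AE_observed_ipsrl AE_space
  proof eventually_elim
    fix \<omega> assume "observed \<omega> \<in> obs T" "\<omega> \<in> space (J T)"
    then show "\<Phi> \<omega> + B = G (fst \<omega>, observed \<omega>) \<and> \<bar>\<Phi> \<omega>\<bar> \<le> B \<and> 0 \<le> G (fst \<omega>, observed \<omega>)"
      using eq[of \<omega>] bound[of "fst \<omega>" "observed \<omega>"] F0[of "fst \<omega>" "observed \<omega>"]
      by (auto simp: G_def space_ipsrl)
  qed
  have int_\<Phi>: "integrable (J T) \<Phi>"
    by (rule P.integrable_const_bound[OF eventually_mono[OF AE] \<Phi>J, of B]) simp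
  have nonneg: "0 \<le> expect (obs_law T \<theta>) (F \<theta>) + B" if \<theta>: "\<theta> \<in> \<Theta>" for \<theta>
    proof -
      have "- B \<le> expect (obs_law T \<theta>) (F \<theta>)"
      proof (rule expect_ge_const[OF finite_set_obs_law[OF \<theta>]])
        fix y assume "y \<in> set_pmf (obs_law T \<theta>)"
        then have "y \<in> obs T" using set_obs_law[OF \<theta>] by blast
        then show "- B \<le> F \<theta> y" using F0[OF \<theta>, of y] by simp
      qed
      then show ?thesis by simp
    qed
  have "(LINT \<omega>|J T. \<Phi> \<omega>) + B = (LINT \<omega>|J T. \<Phi> \<omega> + B)"
    by (simp add: int_\<Phi> P.prob_space)
  also have "\<dots> = (LINT \<omega>|J T. G (fst \<omega>, observed \<omega>))"
    by (rule integral_cong_AE[OF borel_measurable_add[OF \<Phi>J borel_measurable_const] GJ eventually_mono[OF AE]]) simp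
  also have "\<dots> = enn2real (\<integral>\<^sup>+\<omega>. ennreal (G (fst \<omega>, observed \<omega>)) \<partial>J T)"
    by (rule integral_eq_nn_integral[OF GJ eventually_mono[OF AE]]) simp
  also have "(\<integral>\<^sup>+\<omega>. ennreal (G (fst \<omega>, observed \<omega>)) \<partial>J T) = (\<integral>\<^sup>+\<theta>. \<integral>\<^sup>+y. ennreal (G (\<theta>, y)) \<partial>obs_law T \<theta> \<partial>\<mu>0)"
    by (rule nn_integral_ipsrl[of "\<lambda>x. ennreal (G x)"]) (rule measurable_compose[OF G' measurable_ennreal])
  also have "\<dots> = (\<integral>\<^sup>+\<theta>. ennreal (expect (obs_law T \<theta>) (F \<theta>) + B) \<partial>\<mu>0)"
  proof (rule nn_integral_cong)
    fix \<theta> assume "\<theta> \<in> space \<mu>0"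
    then have \<theta>: "\<theta> \<in> \<Theta>" by simp
    note set = set_obs_law[OF \<theta>, of T] and fin = finite_set_obs_law[OF \<theta>, of T]
    have "(\<integral>\<^sup>+y. ennreal (G (\<theta>, y)) \<partial>obs_law T \<theta>) = (\<integral>\<^sup>+y. ennreal (F \<theta> y + B) \<partial>obs_law T \<theta>)"
      using set by (intro nn_integral_cong_AE) (auto simp: AE_measure_pmf_iff G_def)
    also have "\<dots> = ennreal (expect (obs_law T \<theta>) (\<lambda>y. F \<theta> y + B))"
      using set F0[OF \<theta>] by (intro nn_integral_eq_integral integrable_measure_pmf_finite fin)
        (auto simp: AE_measure_pmf_iff)
    finally show "(\<integral>\<^sup>+y. ennreal (G (\<theta>, y)) \<partial>obs_law T \<theta>) = ennreal (expect (obs_law T \<theta>) (F \<theta>) + B)"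
      by (simp add: expect_add[OF fin])
  qed
  also have "\<dots> = ennreal (LINT \<theta>|\<mu>0. expect (obs_law T \<theta>) (F \<theta>) + B)"
  proof (rule nn_integral_eq_integral)
    show "integrable \<mu>0 (\<lambda>\<theta>. expect (obs_law T \<theta>) (F \<theta>) + B)"
      using integrable_obs_law(1)[OF meas bound] by auto
    show "AE \<theta> in \<mu>0. 0 \<le> expect (obs_law T \<theta>) (F \<theta>) + B" using nonneg by auto
  qed
  also have "enn2real (ennreal (LINT \<theta>|\<mu>0. expect (obs_law T \<theta>) (F \<theta>) + B))
      = (LINT \<theta>|\<mu>0. expect (obs_law T \<theta>) (F \<theta>) + B)"
  proof -
    have "0 \<le> (LINT \<theta>|\<mu>0. expect (obs_law T \<theta>) (F \<theta>) + B)"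
      by (rule integral_nonneg_AE) (use nonneg in auto)
    then show ?thesis by simp
  qed
  finally show ?thesis
    using integrable_obs_law(1)[OF meas bound]
    by (simp add: prior.prob_space[unfolded space_prior])
qed

lemma bayes_regret_eq: "bayes_regret M \<beta> L \<mu>0 pistar T = (\<Sum>t<T. LINT \<theta>|\<mu>0. round_regret t \<theta>)"
proof -
  define f where "f = (\<lambda>\<theta> \<tau>. opt_V M \<theta> 0 (init_state \<tau>) - total_reward M \<tau>)"
  define \<Phi> where "\<Phi> = (\<lambda>\<omega>. case \<omega> of (\<theta>, D :: traj list, es :: (policy \<times> traj) list) \<Rightarrow> (\<Sum>t<T. f \<theta> (snd (es ! t))))"
  define B where "B = (\<Sum>t<T. real H + 1)"
  have f: "(\<lambda>\<theta>. f \<theta> \<tau>) \<in> borel_measurable \<mu>0" for \<tau>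
    unfolding f_def by measurable
  have fb: "\<bar>f \<theta> \<tau>\<bar> \<le> real H + 1" if "\<theta> \<in> \<Theta>" "\<tau> \<in> trajs M H" for \<theta> \<tau>
  proof -
    have s: "init_state \<tau> \<in> S" using traj_state_in[OF that(2)] init_state_eq[OF that(2)] by simp
    have *: "0 \<le> total_reward M \<tau>' \<and> total_reward M \<tau>' \<le> real H + 1"
      if "\<tau>' \<in> set_pmf (rollout \<theta> (det_policy (pistar \<theta>)) 0 H (init_state \<tau>))" for \<tau>'
      using set_rollout[OF in_kernels[OF \<open>\<theta> \<in> \<Theta>\<close>] valid_det_policy[OF pistar_in[OF \<open>\<theta> \<in> \<Theta>\<close>]], of 0 H "init_state \<tau>"] s that
      by (intro total_reward_bounds) auto
    have fin: "finite (set_pmf (rollout \<theta> (det_policy (pistar \<theta>)) 0 H (init_state \<tau>)))"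
      using that s by (intro finite_set_rollout valid_det_policy) auto
    \<comment> \<open>The bounds on \<open>opt_V\<close> are taken from the value of an optimal
      policy, so its recursion need not be unfolded.\<close>
    have "opt_V M \<theta> 0 (init_state \<tau>) = policy_value M \<theta> (pistar \<theta>) (init_state \<tau>)"
      using optimal[OF that(1)] s by (simp add: optimal_policy_def)
    moreover have "0 \<le> policy_value M \<theta> (pistar \<theta>) (init_state \<tau>)"
      "policy_value M \<theta> (pistar \<theta>) (init_state \<tau>) \<le> real H + 1"
      unfolding policy_value_def using * by (auto intro!: expect_ge_const expect_le_const fin)
    ultimately show ?thesis using total_reward_bounds[OF that(2)] by (auto simp: f_def abs_le_iff)
  qed
  have "(\<lambda>\<omega>. \<Phi> (fst \<omega>, snd \<omega>)) \<in> borel_measurable OS"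
  proof (rule measurable_compose_countable'[OF _ measurable_snd_OS countable_RS, where f = "\<lambda>z \<omega>. \<Phi> (fst \<omega>, z)"])
    fix z :: "traj list \<times> (policy \<times> traj) list"
    have "(\<lambda>\<theta>. \<Phi> (\<theta>, z)) \<in> borel_measurable \<mu>0"
      unfolding \<Phi>_def case_prod_unfold by (intro borel_measurable_sum) (simp add: f)
    from measurable_compose[OF measurable_fst_OS this]
    show "(\<lambda>\<omega>. \<Phi> (fst \<omega>, z)) \<in> borel_measurable OS" .
  qed
  then have \<Phi>: "\<Phi> \<in> borel_measurable OS" by (simp only: prod.collapse)
  have "bayes_regret M \<beta> L \<mu>0 pistar T = (LINT \<omega>|J T. \<Phi> \<omega>)"
    unfolding bayes_regret_def \<Phi>_def f_def ..
  \<comment> \<open>Summing up to the length of the data instead of \<open>T\<close> gives a single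
    functional for all times, as \<open>expect_telescope\<close> requires.\<close>
  also have "\<dots> = (LINT \<theta>|\<mu>0. expect (obs_law T \<theta>) (\<lambda>y. \<Sum>t<length (snd y). f \<theta> (snd y ! t)))"
  proof (rule integral_ipsrl[OF _ _ \<Phi>])
    show "(\<lambda>\<theta>. \<Sum>t<length (snd y). f \<theta> (snd y ! t)) \<in> borel_measurable \<mu>0" for y :: observation
      by (intro borel_measurable_sum f)
    show "\<bar>\<Sum>t<length (snd y). f \<theta> (snd y ! t)\<bar> \<le> B" if "\<theta> \<in> \<Theta>" "y \<in> obs T" for \<theta> y
    proof -
      have "\<bar>f \<theta> (snd y ! t)\<bar> \<le> real H + 1" if "t < length (snd y)" for t
        using nth_mem[OF that] set_obs[OF \<open>y \<in> obs T\<close>] by (intro fb \<open>\<theta> \<in> \<Theta>\<close>) blast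
      then have "\<bar>\<Sum>t<length (snd y). f \<theta> (snd y ! t)\<bar> \<le> (\<Sum>t<length (snd y). real H + 1)"
        by (intro order_trans[OF sum_abs] sum_mono) auto
      then show ?thesis unfolding B_def length_obs[OF that(2)] .
    qed
    show "\<Phi> \<omega> = (\<Sum>t<length (snd (observed \<omega>)). f (fst \<omega>) (snd (observed \<omega>) ! t))"
      if "observed \<omega> \<in> obs T" for \<omega>
      using length_obs[OF that] by (cases \<omega>) (simp add: \<Phi>_def observed_def)
  qed
  also have "\<dots> = (LINT \<theta>|\<mu>0. (\<Sum>t<T. round_regret t \<theta>))"
    unfolding f_def by (intro Bochner_Integration.integral_cong refl expect_total_regret) simp
  also have "\<dots> = (\<Sum>t<T. LINT \<theta>|\<mu>0. round_regret t \<theta>)"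
    by (intro Bochner_Integration.integral_sum integrable_round_regret)
  finally show ?thesis .
qed

lemma mismatch_nonneg: "\<theta> \<in> \<Theta> \<Longrightarrow> 0 \<le> mismatch t \<theta>"
  unfolding mismatch_def by (intro Bochner_Integration.integral_nonneg) auto

text \<open>The policy of the first episode is not part of the data, so
  \<open>integral_ipsrl\<close> does not apply and the first step is evaluated by
  \<open>nn_integral_next\<close>.\<close>

lemma first_error_eq: "first_error M \<beta> L \<mu>0 pistar = (LINT \<theta>|\<mu>0. mismatch 0 \<theta>)"
proof -
  define E where "E = {\<omega> \<in> space OS. fst (snd (snd \<omega>) ! 0) \<noteq> pistar (fst \<omega>)}"
  have "Measurable.pred OS (\<lambda>\<omega>. fst (snd (snd \<omega>) ! 0) \<noteq> pistar (fst \<omega>))"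
  proof (rule measurable_compose_countable'[OF _ measurable_snd_OS countable_RS,
        where f = "\<lambda>z \<omega>. fst (snd z ! 0) \<noteq> pistar (fst \<omega>)"])
    fix z :: "traj list \<times> (policy \<times> traj) list"
    have "(\<lambda>\<pi>. fst (snd z ! 0) \<noteq> \<pi>) \<in> measurable (count_space (policies M)) (count_space UNIV)" by simp
    from measurable_compose[OF measurable_compose[OF measurable_fst_OS measurable_pistar] this]
    show "Measurable.pred OS (\<lambda>\<omega>. fst (snd z ! 0) \<noteq> pistar (fst \<omega>))" .
  qed
  then have E: "E \<in> sets OS" unfolding E_def by measurable
  have eq: "J 1 = J 0 \<bind> (\<lambda>\<omega>. posterior \<mu>0 (J 0) (observed \<omega>) \<bind> (\<lambda>\<theta>'. run \<omega> \<theta>'))"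
    unfolding One_nat_def ipsrl.simps(2) ..
  have "first_error M \<beta> L \<mu>0 pistar = measure (J 1) E"
    unfolding first_error_def E_def sets_eq_imp_space_eq[OF sets_ipsrl] case_prod_unfold prod.collapse ..
  also have "\<dots> = enn2real (\<integral>\<^sup>+\<omega>. indicator E \<omega> \<partial>J 1)"
  proof -
    have "E \<in> sets (J 1)" unfolding sets_ipsrl by (rule E)
    from nn_integral_indicator[OF this] show ?thesis unfolding measure_def by (rule arg_cong[OF sym])
  qed
  also have "(\<integral>\<^sup>+\<omega>. indicator E \<omega> \<partial>J 1) = (\<integral>\<^sup>+\<theta>. \<integral>\<^sup>+y. \<integral>\<^sup>+\<pi>. \<integral>\<^sup>+\<tau>. ennreal (of_bool (\<pi> \<noteq> pistar \<theta>))
     \<partial>episode M \<theta> (det_policy \<pi>) \<partial>post_policy (obs_law 0) y \<partial>obs_law 0 \<theta> \<partial>\<mu>0)"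
    unfolding eq
  proof (rule nn_integral_next[OF sets_ipsrl nn_integral_ipsrl])
    show "indicator E \<in> borel_measurable OS" by (rule borel_measurable_indicator[OF E])
    show "(\<lambda>\<theta>. ennreal (of_bool (\<pi> \<noteq> pistar \<theta>))) \<in> borel_measurable \<mu>0" for \<pi>
      by (rule measurable_compose[OF measurable_policy_mismatch measurable_ennreal])
    show "indicator E (\<theta>, D, es @ [(\<pi>, \<tau>)]) = ennreal (of_bool (\<pi> \<noteq> pistar \<theta>))"
      if "\<theta> \<in> \<Theta>" "(D, es) \<in> RS" "length es = 0" "\<pi> \<in> policies M" for \<theta> D es \<pi> \<tau>
      using that by (auto simp: E_def space_OS indicator_def)
  qed
  also have "\<dots> = (\<integral>\<^sup>+\<theta>. ennreal (mismatch 0 \<theta>) \<partial>\<mu>0)"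
  proof (rule nn_integral_cong)
    fix \<theta> assume "\<theta> \<in> space \<mu>0"
    then have fin: "finite (set_pmf (obs_law 0 \<theta>))" by (intro finite_set_obs_law) simp
    have const: "(\<integral>\<^sup>+\<tau>. r \<partial>measure_pmf p) = r" for r and p :: "traj pmf"
      by (simp add: measure_pmf.emeasure_space_1)
    have "(\<integral>\<^sup>+\<pi>. \<integral>\<^sup>+\<tau>. ennreal (of_bool (\<pi> \<noteq> pistar \<theta>)) \<partial>episode M \<theta> (det_policy \<pi>) \<partial>post_policy (obs_law 0) y)
        = ennreal (expect (post_policy (obs_law 0) y) (\<lambda>\<pi>. of_bool (\<pi> \<noteq> pistar \<theta>)))" for y
      unfolding const
      by (intro nn_integral_eq_integral integrable_measure_pmf_finite finite_subset[OF set_obs_policy finite_policies]) auto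
    then show "(\<integral>\<^sup>+y. \<integral>\<^sup>+\<pi>. \<integral>\<^sup>+\<tau>. ennreal (of_bool (\<pi> \<noteq> pistar \<theta>))
       \<partial>episode M \<theta> (det_policy \<pi>) \<partial>post_policy (obs_law 0) y \<partial>obs_law 0 \<theta>) = ennreal (mismatch 0 \<theta>)"
      unfolding mismatch_def
      by (simp only:) (intro nn_integral_eq_integral integrable_measure_pmf_finite fin AE_I2
          Bochner_Integration.integral_nonneg, auto)
  qed
  also have "\<dots> = ennreal (LINT \<theta>|\<mu>0. mismatch 0 \<theta>)"
    by (rule nn_integral_eq_integral[OF integrable_mismatch AE_I2]) (simp add: mismatch_nonneg)
  finally have "first_error M \<beta> L \<mu>0 pistar = enn2real (ennreal (LINT \<theta>|\<mu>0. mismatch 0 \<theta>))" .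
  moreover have "0 \<le> (LINT \<theta>|\<mu>0. mismatch 0 \<theta>)"
    by (rule integral_nonneg_AE[OF AE_I2]) (simp add: mismatch_nonneg)
  ultimately show ?thesis by simp
qed

section \<open>Constants and the choice of the weight\<close>

text \<open>The origin of \<open>x\<close>: the exponent \<open>x / 2\<close> has to pay for the
  sign vectors, at most \<open>exp (card S)\<close> many, and for two factors \<open>T\<close>, one
  from the possible visit counts and one from the sum over episodes. As \<open>card S\<close> is at
  least 1, twice \<open>card S * (1 + ln T)\<close> is enough.\<close>

lemma exp_tail_bound:
  assumes "1 \<le> T"
  defines "x \<equiv> 4 * real (card S) * (1 + ln (real T))"
  shows "real T * (4 * exp (- x / 2) * (real T * 2 ^ card S)) \<le> 4"
proof -
  have S1: "1 \<le> real (card S)" by (simp add: Suc_le_eq card_gt_0_iff)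
  have T: "0 \<le> ln (real T)" using assms by simp
  have "2 ^ card S \<le> (exp 1 :: real) ^ card S"
    using exp_ge_add_one_self[of 1] by (intro power_mono) auto
  then have 1: "2 ^ card S \<le> exp (real (card S))" by (simp add: exp_of_nat_mult[symmetric])
  have "real T * real T = exp (2 * ln (real T))"
    using assms(1) by (simp add: exp_double power2_eq_square)
  also have "\<dots> \<le> exp (2 * real (card S) * ln (real T))"
    using S1 T by (simp add: mult_right_mono)
  finally have 2: "real T * real T \<le> exp (2 * real (card S) * ln (real T))" .
  have "real T * (4 * exp (- x / 2) * (real T * 2 ^ card S))
      = 4 * exp (- x / 2) * ((real T * real T) * 2 ^ card S)" by simp
  also have "\<dots> \<le> 4 * exp (- x / 2) * (exp (2 * real (card S) * ln (real T)) * exp (real (card S)))"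
    using 1 2 by (intro mult_left_mono mult_mono) auto
  also have "\<dots> = 4 * exp (- real (card S))"
  proof -
    have "- x / 2 = - 2 * real (card S) * (1 + ln (real T))" by (simp add: x_def)
    then show ?thesis by (simp add: exp_add[symmetric] algebra_simps)
  qed
  also have "\<dots> \<le> 4" by simp
  finally show ?thesis .
qed

text \<open>The exponents: \<open>H ^ 3\<close> comes from \<open>init_value_diff_le\<close> and
  \<open>HSA\<close> from the number of triples; the other \<open>S\<close> and one logarithmic
  factor come from \<open>x\<close>, the second such factor from the harmonic sum.\<close>

lemma bayes_regret_le_weighted:
  assumes T: "1 \<le> T" and c: "0 < c"
  shows "bayes_regret M \<beta> L \<mu>0 pistar T \<le> c / 2 * (real T * first_error M \<beta> L \<mu>0 pistar)
    + 48 * real H ^ 4 * real (card S) ^ 2 * real (card A) * (1 + ln (real T))\<^sup>2 / (2 * c)"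
proof -
  define l where "l = 1 + ln (real T)"
  define x where "x = 4 * real (card S) * l"
  define n where "n = real (card (triples M))"
  define k where "k = real H ^ 3 / (2 * c)"
  have l: "1 \<le> l" using T by (simp add: l_def)
  have x: "0 \<le> x" using l by (simp add: x_def)
  have k: "0 \<le> k" using c by (simp add: k_def)
  have S1: "1 \<le> real (card S)" by (simp add: Suc_le_eq card_gt_0_iff)
  have bonus: "(\<Sum>t<T. LINT \<theta>|\<mu>0. bonus_cost x t \<theta>) \<le> n * (4 + x * l)"
  proof -
    have "(\<Sum>t<T. LINT \<theta>|\<mu>0. bonus_cost x t \<theta>) = (LINT \<theta>|\<mu>0. (\<Sum>t<T. bonus_cost x t \<theta>))"
      by (intro Bochner_Integration.integral_sum[symmetric] integrable_bonus_cost x)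
    also have "\<dots> \<le> (LINT \<theta>|\<mu>0. n * (4 + x * l))"
      using sum_bonus_cost[OF _ T x]
      by (intro integral_mono Bochner_Integration.integrable_sum integrable_bonus_cost x) (auto simp: n_def l_def)
    finally show ?thesis by (simp add: prior.prob_space[unfolded space_prior])
  qed
  have excess: "(\<Sum>t<T. LINT \<theta>|\<mu>0. excess_cost x t \<theta>) \<le> n * 4"
  proof -
    define q where "q = 4 * exp (- x / 2) * (real T * 2 ^ card S)"
    have "(LINT \<theta>|\<mu>0. excess_cost x t \<theta>) \<le> n * q" if "t < T" for t
    proof -
      have "(LINT \<theta>|\<mu>0. excess_cost x t \<theta>) \<le> (LINT \<theta>|\<mu>0. n * q)"
        using excess_cost_le[of _ t T x] that x
        by (intro integral_mono integrable_excess_cost x) (auto simp: n_def q_def)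
      then show ?thesis by (simp add: prior.prob_space[unfolded space_prior])
    qed
    then have "(\<Sum>t<T. LINT \<theta>|\<mu>0. excess_cost x t \<theta>) \<le> (\<Sum>t<T. n * q)"
      by (intro sum_mono) auto
    also have "\<dots> = n * (real T * q)" by simp
    also have "\<dots> \<le> n * 4"
      using exp_tail_bound[OF T] by (intro mult_left_mono) (auto simp: q_def x_def l_def n_def)
    finally show ?thesis .
  qed
  have "bayes_regret M \<beta> L \<mu>0 pistar T \<le> (\<Sum>t<T. c / 2 * (LINT \<theta>|\<mu>0. mismatch t \<theta>)
      + k * (4 * (LINT \<theta>|\<mu>0. bonus_cost x t \<theta>) + 4 * (LINT \<theta>|\<mu>0. excess_cost x t \<theta>)))"
    unfolding bayes_regret_eq k_def by (intro sum_mono round_regret_le c x)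
  also have "\<dots> \<le> (\<Sum>t<T. c / 2 * first_error M \<beta> L \<mu>0 pistar
      + k * (4 * (LINT \<theta>|\<mu>0. bonus_cost x t \<theta>) + 4 * (LINT \<theta>|\<mu>0. excess_cost x t \<theta>)))"
    unfolding first_error_eq using c by (intro sum_mono add_right_mono mult_left_mono integral_mismatch_le) auto
  also have "\<dots> = c / 2 * (real T * first_error M \<beta> L \<mu>0 pistar)
      + k * (4 * (\<Sum>t<T. LINT \<theta>|\<mu>0. bonus_cost x t \<theta>) + 4 * (\<Sum>t<T. LINT \<theta>|\<mu>0. excess_cost x t \<theta>))"
    by (simp add: sum.distrib sum_distrib_left[symmetric])
  also have "\<dots> \<le> c / 2 * (real T * first_error M \<beta> L \<mu>0 pistar) + k * (4 * (n * (4 + x * l)) + 4 * (n * 4))"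
    using bonus excess k by (intro add_left_mono mult_left_mono add_mono) auto
  \<comment> \<open>Half of the 32 stems from the bonuses at count zero, half from the excess. As
    \<open>1 \<le> real (card S) * l\<^sup>2\<close>, it is absorbed below into 48 = 32 +
    16.\<close>
  also have "4 * (n * (4 + x * l)) + 4 * (n * 4) = n * (32 + 16 * (real (card S) * l\<^sup>2))"
    by (simp add: x_def power2_eq_square algebra_simps)
  also have "c / 2 * (real T * first_error M \<beta> L \<mu>0 pistar) + k * (n * (32 + 16 * (real (card S) * l\<^sup>2)))
      \<le> c / 2 * (real T * first_error M \<beta> L \<mu>0 pistar) + k * (n * (48 * (real (card S) * l\<^sup>2)))"
  proof -
    have "1 * 1 \<le> real (card S) * l\<^sup>2" using S1 l by (intro mult_mono) (auto simp: one_le_power)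
    then show ?thesis using k by (intro add_left_mono mult_left_mono) (auto simp: n_def)
  qed
  also have "k * (n * (48 * (real (card S) * l\<^sup>2)))
      = 48 * real H ^ 4 * real (card S) ^ 2 * real (card A) * l\<^sup>2 / (2 * c)"
    by (simp add: k_def n_def card_triples power2_eq_square power3_eq_cube power4_eq_xxxx)
  finally show ?thesis unfolding l_def .
qed

end

text \<open>For \<open>p > 0\<close> the best weight is \<open>c = sqrt q / sqrt p\<close>, which
  makes the two terms equal.\<close>

lemma le_sqrt_of_weighted_bounds:
  fixes r p q :: real
  assumes "0 \<le> p" "0 < q" and *: "\<And>c. 0 < c \<Longrightarrow> r \<le> c / 2 * p + q / (2 * c)"
  shows "r \<le> sqrt (p * q)"
proof (cases "p = 0")
  case True
  have "r \<le> 0"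
  proof (rule ccontr)
    assume "\<not> r \<le> 0"
    \<comment> \<open>With \<open>p = 0\<close> the infimum over \<open>c\<close> is not attained,
      but \<open>c = q / r\<close> already gives \<open>r \<le> r / 2\<close>.\<close>
    then have "r \<le> q / (2 * (q / r))" using *[of "q / r"] assms True by simp
    then show False using assms \<open>\<not> r \<le> 0\<close> by simp
  qed
  then show ?thesis using True by simp
next
  case False
  then have pq: "0 < sqrt p" "0 < sqrt q" "p = sqrt p * sqrt p" "q = sqrt q * sqrt q"
    using assms by auto
  have "r \<le> sqrt q / sqrt p / 2 * p + q / (2 * (sqrt q / sqrt p))"
    using pq by (intro *) simp
  also have "sqrt q / sqrt p / 2 * p = sqrt p * sqrt q / 2"
    using pq(1) by (subst pq(3)) (simp add: field_simps)
  also have "q / (2 * (sqrt q / sqrt p)) = sqrt p * sqrt q / 2"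
    using pq(1,2) by (subst pq(4)) (simp add: field_simps)
  finally show ?thesis by (simp add: real_sqrt_mult)
qed

theorem lemma3p1:
  "\<exists>C>0. \<forall>(M::mdp) (\<Theta>::kernel set) (\<mu>0::kernel measure) (pistar::kernel \<Rightarrow> policy)
      (\<beta>::real) (L::nat) (T::nat).
     wf_mdp M \<longrightarrow> \<Theta> \<subseteq> kernels M \<longrightarrow> is_prior M \<Theta> \<mu>0 \<longrightarrow>
     pistar \<in> measurable \<mu>0 (count_space (policies M)) \<longrightarrow>
     (\<forall>\<theta>\<in>\<Theta>. optimal_policy M \<theta> (pistar \<theta>)) \<longrightarrow>
     0 \<le> \<beta> \<longrightarrow> 1 \<le> T \<longrightarrow>
     bayes_regret M \<beta> L \<mu>0 pistar T
       \<le> C * sqrt (first_error M \<beta> L \<mu>0 pistar * real (horizon M) ^ 4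
                    * real (card (states M)) ^ 2 * real (card (actions M)) * real T)
           * (1 + ln (real T))"
proof (rule exI[of _ "sqrt 48"], intro conjI allI impI)
  fix M \<Theta> \<mu>0 pistar \<beta> L and T :: nat
  assume "wf_mdp M" "\<Theta> \<subseteq> kernels M" "is_prior M \<Theta> \<mu>0" "pistar \<in> measurable \<mu>0 (count_space (policies M))"
    "\<forall>\<theta>\<in>\<Theta>. optimal_policy M \<theta> (pistar \<theta>)" and T: "1 \<le> T"
  then interpret bayes_mdp M \<Theta> \<mu>0 pistar \<beta> L
    by unfold_locales auto
  define \<epsilon> where "\<epsilon> = first_error M \<beta> L \<mu>0 pistar"
  define l where "l = 1 + ln (real T)"
  have l: "1 \<le> l" using T by (simp add: l_def)
  have \<epsilon>: "0 \<le> \<epsilon>" by (simp add: \<epsilon>_def first_error_def)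
  \<comment> \<open>Keeps \<open>q\<close> positive in
    \<open>le_sqrt_of_weighted_bounds\<close>.\<close>
  have card: "0 < card S" "0 < card A" by (simp_all add: card_gt_0_iff)
  \<comment> \<open>Under the root \<open>l\<^sup>2\<close> becomes the single factor
    \<open>l\<close>, and 48 becomes the absolute constant.\<close>
  have "bayes_regret M \<beta> L \<mu>0 pistar T
      \<le> sqrt ((real T * \<epsilon>) * (48 * real H ^ 4 * real (card S) ^ 2 * real (card A) * l\<^sup>2))"
    using bayes_regret_le_weighted[OF T] \<epsilon> l card
    by (intro le_sqrt_of_weighted_bounds) (auto simp: \<epsilon>_def l_def)
  also have "\<dots> = sqrt (48 * (\<epsilon> * real H ^ 4 * real (card S) ^ 2 * real (card A) * real T) * l\<^sup>2)"
    by (simp add: mult_ac)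
  also have "\<dots> = sqrt 48 * sqrt (\<epsilon> * real H ^ 4 * real (card S) ^ 2 * real (card A) * real T) * l"
    using l by (simp only: real_sqrt_mult real_sqrt_abs)
  finally show "bayes_regret M \<beta> L \<mu>0 pistar T
       \<le> sqrt 48 * sqrt (first_error M \<beta> L \<mu>0 pistar * real (horizon M) ^ 4
                    * real (card (states M)) ^ 2 * real (card (actions M)) * real T)
           * (1 + ln (real T))"
    unfolding \<epsilon>_def l_def .
qed simp

end
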